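(* Let $n>1$ be an odd integer, and let $a,b$ be integers such that $a\equiv 19 \pmod{30}$, $b\equiv 6\pmod{15}$, and $\gcd(a,b)=1$. Then $3$ divides the class number of the quadratic field $\mathbb{Q}\left(\sqrt{3(a^{3n}-b^{2n})}\right)$. *)

theory Defs
  imports
    Complex_Main
    "HOL-Computational_Algebra.Polynomial"
    "HOL-Number_Theory.Cong"
    "HOL-Algebra.Coset"
begin

text \<open>
  Number fields are represented as subfields of the complex numbers, given by their carrier sets.
\<close>

definition quadratic_field :: "int \<Rightarrow> complex set" where
  "quadratic_field d = {of_rat x + of_rat y * csqrt (of_int d) | x y. True}"

definition ring_of_integers :: "complex set \<Rightarrow> complex set" where
  "ring_of_integers K = {x \<in> K. algebraic_int x}"

definition fractional_ideal :: "complex set \<Rightarrow> complex set \<Rightarrow> bool" where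
  "fractional_ideal K I \<longleftrightarrow>
     I \<subseteq> K \<and> 0 \<in> I \<and> I \<noteq> {0} \<and>
     (\<forall>x\<in>I. \<forall>y\<in>I. x + y \<in> I) \<and>
     (\<forall>r\<in>ring_of_integers K. \<forall>x\<in>I. r * x \<in> I) \<and>
     (\<exists>c\<in>ring_of_integers K. c \<noteq> 0 \<and> (\<forall>x\<in>I. c * x \<in> ring_of_integers K))"

definition ideal_mult :: "complex set \<Rightarrow> complex set \<Rightarrow> complex set" where
  "ideal_mult I J =
     {\<Sum>i<k. x i * y i | (k::nat) x y. \<forall>i<k. x i \<in> I \<and> y i \<in> J}"

definition fractional_ideal_group :: "complex set \<Rightarrow> complex set monoid" where
  "fractional_ideal_group K =
     \<lparr>carrier = {I. fractional_ideal K I}, monoid.mult = ideal_mult, one = ring_of_integers K\<rparr>"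

definition principal_fractional_ideals :: "complex set \<Rightarrow> complex set set" where
  "principal_fractional_ideals K = {(\<lambda>r. c * r) ` ring_of_integers K | c. c \<in> K \<and> c \<noteq> 0}"

definition class_group :: "complex set \<Rightarrow> complex set set monoid" where
  "class_group K = fractional_ideal_group K Mod principal_fractional_ideals K"

text \<open>
  The order of a group is \<open>0\<close> by convention if the group is infinite; the class group of a number
  field is always finite, so for number fields this is the usual class number.
\<close>

definition class_number :: "complex set \<Rightarrow> nat" where
  "class_number K = Coset.order (class_group K)"

end

theory Submission
  imports Defs "HOL-Number_Theory.Residue_Primitive_Roots"
    "HOL-Computational_Algebra.Polynomial_Factorial"
begin

text \<open>
  Write \<open>c = a ^ n\<close>, \<open>B = b ^ n\<close> and \<open>D = 3 * (c\<^sup>3 - B\<^sup>2)\<close>. The splitting field of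
  \<open>x\<^sup>3 - 3 * c * x - 2 * B\<close> is an unramified cyclic cubic extension of \<open>K = \<rat>(\<surd>D)\<close> in which the primes
  above \<open>5\<close> do not split. Class field theory would finish from here; instead, the one case of Artin
  reciprocity that is needed is reduced to cubic reciprocity for rational integers in \<open>\<int>[\<omega>]\<close>.

  If \<open>3\<close> does not divide the class number \<open>h\<close>, then \<open>h > 0\<close> (an infinite class group has order \<open>0\<close>),
  and the \<open>h\<close>-th power of a prime above \<open>5\<close> is generated by some \<open>u + v * \<surd>D\<close> of norm
  \<open>\<plusminus>5 ^ h\<close> that is not divisible by \<open>5\<close>. Let \<open>F\<close> be the denominator of \<open>v\<close> and put \<open>X = F * u\<close>,
  \<open>Y = F * v\<close> and \<open>\<kappa> = X + Y * B * \<surd>(-3)\<close>, which has norm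
  \<open>3 * Y\<^sup>2 * c\<^sup>3 \<plusminus> F\<^sup>2 * 5 ^ h\<close>. Modulo \<open>\<kappa>\<close> the cubic residue symbols of \<open>F\<close>, \<open>Y\<close> and \<open>3\<close> are
  trivial by reciprocity, so that of \<open>5 ^ h\<close>, hence that of \<open>5\<close>, is trivial too; but the symbol of
  \<open>\<kappa>\<close> modulo \<open>5\<close> is not.
\<close>

text \<open>Origin of \<open>\<kappa>\<close>: by Cardano, over \<open>K\<close> with a cube root of
  unity adjoined, the cubic is split by a cube root of B + sqrt D / sqrt(-3), whose norm is c^3.
  Modulo X + Y * sqrt D one may replace Y * sqrt D by -X, so the radicand times Y * sqrt(-3) becomes
  -X + Y * B * sqrt(-3), up to sign the conjugate of \<open>\<kappa>\<close>. In the norm of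
  \<open>\<kappa>\<close> the number c enters only through a cube, which no cubic symbol sees. The
  symbols of F and Y are trivial because modulo an odd prime factor other than 3 one coordinate of
  \<open>\<kappa>\<close> vanishes, and rational numbers and rational multiples of sqrt(-3) have
  trivial symbol. For F this rests on F^2 dividing 4 * D. The prime 3 escapes this argument and
  costs the most work; there 9 must divide B, which is where n > 1 enters. Odd n gives c = -1 modulo
  5, which makes D a nonzero square modulo 5; a odd and coprime to b makes F prime to c.\<close>

hide_const (open) up_ring.monom up_ring.coeff module.smult

section \<open>Eisenstein integers\<close>

text \<open>\<open>Eis a b\<close> is \<open>a + b * omega\<close> with \<open>omega\<^sup>2 + omega + 1 = 0\<close>.\<close>

datatype eis = Eis (ere: int) (eim: int)

instantiation eis :: comm_ring_1
begin

definition "0 = Eis 0 0"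
definition "1 = Eis 1 0"
definition "x + y = Eis (ere x + ere y) (eim x + eim y)"
definition "x - y = Eis (ere x - ere y) (eim x - eim y)"
definition "- x = Eis (- ere x) (- eim x)"
definition "x * y = Eis (ere x * ere y - eim x * eim y)
  (ere x * eim y + eim x * ere y - eim x * eim y)"

instance
  by standard (auto simp: zero_eis_def one_eis_def plus_eis_def minus_eis_def uminus_eis_def
      times_eis_def algebra_simps)

end

lemma ere_eim_simps [simp]:
  "ere 0 = 0" "eim 0 = 0" "ere 1 = 1" "eim 1 = 0"
  "ere (x + y) = ere x + ere y" "eim (x + y) = eim x + eim y"
  "ere (x - y) = ere x - ere y" "eim (x - y) = eim x - eim y"
  "ere (- x) = - ere x" "eim (- x) = - eim x"
  "ere (x * y) = ere x * ere y - eim x * eim y"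
  "eim (x * y) = ere x * eim y + eim x * ere y - eim x * eim y"
  by (simp_all add: zero_eis_def one_eis_def plus_eis_def minus_eis_def uminus_eis_def
      times_eis_def)

lemma ere_eim_of_nat [simp]: "ere (of_nat n) = int n" "eim (of_nat n) = 0"
  by (induction n) auto

lemma ere_eim_of_int [simp]: "ere (of_int n) = n" "eim (of_int n) = 0"
  by (cases n; simp)+

lemma ere_eim_numeral [simp]: "ere (numeral n) = numeral n" "eim (numeral n) = 0"
  using ere_eim_of_nat[of "numeral n"] by simp_all

lemma eis_eq_iff: "x = y \<longleftrightarrow> ere x = ere y \<and> eim x = eim y"
  by (cases x; cases y) auto

instance eis :: ring_char_0
proof
  show "inj (of_nat :: nat \<Rightarrow> eis)"
    by (rule injI) (simp add: eis_eq_iff)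
qed

definition omega :: eis where "omega = Eis 0 1"

definition eis_cnj :: "eis \<Rightarrow> eis" where "eis_cnj x = Eis (ere x - eim x) (- eim x)"

definition eis_norm :: "eis \<Rightarrow> int" where "eis_norm x = ere x ^ 2 - ere x * eim x + eim x ^ 2"

lemma ere_eim_omega [simp]: "ere omega = 0" "eim omega = 1"
  by (simp_all add: omega_def)

lemma ere_eim_cnj [simp]: "ere (eis_cnj x) = ere x - eim x" "eim (eis_cnj x) = - eim x"
  by (simp_all add: eis_cnj_def)

lemma eis_cnj_simps [simp]:
  "eis_cnj 0 = 0" "eis_cnj 1 = 1" "eis_cnj (x + y) = eis_cnj x + eis_cnj y"
  "eis_cnj (x - y) = eis_cnj x - eis_cnj y"
  "eis_cnj (x * y) = eis_cnj x * eis_cnj y" "eis_cnj (of_int k) = of_int k"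
  "eis_cnj (of_nat n) = of_nat n"
  "eis_cnj (eis_cnj x) = x"
  by (auto simp: eis_eq_iff algebra_simps)

lemma eis_cnj_power [simp]: "eis_cnj (x ^ n) = eis_cnj x ^ n"
  by (induction n) auto

lemma eis_cnj_sum: "eis_cnj (sum f A) = (\<Sum>a\<in>A. eis_cnj (f a))"
  by (induction A rule: infinite_finite_induct) auto

lemma eis_cnj_dvd: "x dvd y \<Longrightarrow> eis_cnj x dvd eis_cnj y"
  by (auto elim!: dvdE)

lemma eis_mult_cnj: "x * eis_cnj x = of_int (eis_norm x)"
  by (auto simp: eis_eq_iff eis_norm_def algebra_simps power2_eq_square)

lemma eis_norm_mult: "eis_norm (x * y) = eis_norm x * eis_norm y"
  by (simp add: eis_norm_def algebra_simps power2_eq_square)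

lemma eis_norm_cnj [simp]: "eis_norm (eis_cnj x) = eis_norm x"
  by (simp add: eis_norm_def algebra_simps power2_eq_square)

lemma eis_norm_of_int [simp]: "eis_norm (of_int k) = k ^ 2"
  by (simp add: eis_norm_def)

lemma four_eis_norm: "4 * eis_norm x = (2 * ere x - eim x) ^ 2 + 3 * eim x ^ 2"
  by (simp add: eis_norm_def algebra_simps power2_eq_square)

lemma eis_norm_nonneg: "eis_norm x \<ge> 0"
proof -
  have "4 * eis_norm x \<ge> 0"
    unfolding four_eis_norm by simp
  then show ?thesis by simp
qed

lemma eis_norm_eq_0_iff [simp]: "eis_norm x = 0 \<longleftrightarrow> x = 0"
proof
  assume "eis_norm x = 0"
  then have "(2 * ere x - eim x) ^ 2 + 3 * eim x ^ 2 = 0"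
    using four_eis_norm[of x] by simp
  moreover have "(2 * ere x - eim x) ^ 2 \<ge> 0" "eim x ^ 2 \<ge> 0" by simp_all
  ultimately have "eim x ^ 2 = 0" "(2 * ere x - eim x) ^ 2 = 0" by linarith+
  then show "x = 0" by (simp add: eis_eq_iff)
qed (simp add: eis_norm_def)

instance eis :: idom
proof
  fix x y :: eis
  assume "x \<noteq> 0" "y \<noteq> 0"
  then have "eis_norm (x * y) \<noteq> 0" by (simp add: eis_norm_mult)
  then show "x * y \<noteq> 0" by auto
qed

lemma of_int_dvd_eis_iff: "of_int m dvd x \<longleftrightarrow> m dvd ere x \<and> m dvd eim x"
proof
  assume "m dvd ere x \<and> m dvd eim x"
  then obtain a b where "ere x = m * a" "eim x = m * b" by (auto elim!: dvdE)
  then have "x = of_int m * Eis a b" by (simp add: eis_eq_iff)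
  then show "of_int m dvd x" by simp
qed (auto elim!: dvdE)

lemma omega_cubed: "omega ^ 3 = 1"
  by (simp add: eis_eq_iff power3_eq_cube)

definition mu3 :: "eis set" where "mu3 = {1, omega, omega ^ 2}"

lemma mu3_mult: "x \<in> mu3 \<Longrightarrow> y \<in> mu3 \<Longrightarrow> x * y \<in> mu3"
  by (auto simp: mu3_def eis_eq_iff power2_eq_square)

lemma mu3_one [simp]: "1 \<in> mu3"
  by (simp add: mu3_def)

lemma zero_notin_mu3: "0 \<notin> mu3"
  by (auto simp: mu3_def eis_eq_iff power2_eq_square)

lemma mu3_cube: "x \<in> mu3 \<Longrightarrow> x ^ 3 = 1"
  by (auto simp: mu3_def eis_eq_iff power2_eq_square power3_eq_cube)

lemma mu3_cnj: "x \<in> mu3 \<Longrightarrow> eis_cnj x = x ^ 2"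
  by (auto simp: mu3_def eis_eq_iff power2_eq_square)

lemma mu3_cnj_mem: "x \<in> mu3 \<Longrightarrow> eis_cnj x \<in> mu3"
  by (auto simp: mu3_def eis_eq_iff power2_eq_square)

lemma mu3_power: "x \<in> mu3 \<Longrightarrow> x ^ n \<in> mu3"
  by (induction n) (auto intro: mu3_mult)

lemma mu3_power_eq_one:
  assumes "x \<in> mu3" "x ^ n = 1" "\<not> 3 dvd n"
  shows "x = 1"
proof -
  have "n = 3 * (n div 3) + n mod 3" by simp
  then have *: "x ^ n = x ^ (n mod 3)"
    by (metis mult_1 mu3_cube[OF assms(1)] power_add power_mult power_one)
  have "n mod 3 = 1 \<or> n mod 3 = 2" using assms(3) by (simp add: dvd_eq_mod_eq_0) arith
  then show ?thesis
  proof
    assume "n mod 3 = 2"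
    then have "x ^ 2 = 1" using * assms by simp
    then have "x * x ^ 2 = x" by simp
    then show ?thesis using mu3_cube[OF assms(1)] by (metis mult.assoc mult_1 power2_eq_square power3_eq_cube)
  qed (use * assms in simp)
qed

text \<open>A rational integer congruent to a cube root of unity forces that root to be \<open>1\<close>, since
  otherwise the \<open>omega\<close>-coordinate is \<open>1\<close> or \<open>-1\<close>.\<close>

lemma mu3_eq_one_if_rational:
  assumes "x \<in> mu3" "of_int q dvd of_int c - x" "\<not> q dvd 1"
  shows "x = 1"
  using assms by (auto simp: mu3_def of_int_dvd_eis_iff power2_eq_square)

section \<open>Gauss and Jacobi sums of cubic characters\<close>

lemma dvd_power_diff:
  fixes a b c :: "'a :: comm_ring_1"
  assumes "c dvd a - b"
  shows "c dvd a ^ n - b ^ n"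
  using assms power_diff_sumr2[of a n b] by (metis dvd_mult2)

lemma prime_dvd_add_power:
  fixes a b :: "'a :: comm_ring_1"
  assumes "prime q"
  shows "of_nat q dvd (a + b) ^ q - (a ^ q + b ^ q)"
proof -
  have q: "q > 0" "q \<ge> 1" using assms prime_gt_0_nat[of q] by auto
  have "(a + b) ^ q = (\<Sum>k\<le>q. of_nat (q choose k) * a ^ k * b ^ (q - k))"
    by (rule binomial_ring)
  also have "{..q} = insert 0 (insert q {1..<q})" using q by auto
  also have "(\<Sum>k\<in>\<dots>. of_nat (q choose k) * a ^ k * b ^ (q - k)) =
      b ^ q + (a ^ q + (\<Sum>k\<in>{1..<q}. of_nat (q choose k) * a ^ k * b ^ (q - k)))"
    using q by simp
  finally have "(a + b) ^ q - (a ^ q + b ^ q) =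
      (\<Sum>k\<in>{1..<q}. of_nat (q choose k) * a ^ k * b ^ (q - k))"
    by (simp add: algebra_simps)
  moreover have "of_nat q dvd (of_nat (q choose k) :: 'a)" if "k \<in> {1..<q}" for k
  proof -
    have "q dvd q choose k" using that assms by (intro dvd_choose_prime) auto
    then show ?thesis by (metis dvd_def of_nat_mult)
  qed
  ultimately show ?thesis by (auto intro!: dvd_sum dvd_mult2)
qed

lemma prime_dvd_sum_power:
  fixes f :: "'b \<Rightarrow> 'a :: comm_ring_1"
  assumes "prime q"
  shows "of_nat q dvd (\<Sum>i\<in>A. f i) ^ q - (\<Sum>i\<in>A. f i ^ q)"
proof (induction A rule: infinite_finite_induct)
  case (insert x A)
  have "of_nat q dvd ((f x + sum f A) ^ q - (f x ^ q + sum f A ^ q)) +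
      (sum f A ^ q - (\<Sum>i\<in>A. f i ^ q))"
    by (intro dvd_add prime_dvd_add_power assms insert.IH)
  then show ?case using insert.hyps by (simp add: algebra_simps)
qed (use assms in \<open>simp_all add: power_0_left prime_gt_0_nat\<close>)

lemma prime_dvd_sum_power_power:
  fixes f :: "'b \<Rightarrow> 'a :: comm_ring_1"
  assumes "prime q"
  shows "of_nat q dvd (\<Sum>i\<in>A. f i) ^ (q ^ k) - (\<Sum>i\<in>A. f i ^ (q ^ k))"
proof (induction k)
  case (Suc k)
  have "of_nat q dvd (((\<Sum>i\<in>A. f i) ^ (q ^ k)) ^ q - (\<Sum>i\<in>A. f i ^ (q ^ k)) ^ q) +
      ((\<Sum>i\<in>A. f i ^ (q ^ k)) ^ q - (\<Sum>i\<in>A. (f i ^ (q ^ k)) ^ q))"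
    by (intro dvd_add prime_dvd_sum_power assms dvd_power_diff Suc.IH)
  then show ?case by (simp add: power_mult [symmetric] mult.commute)
qed simp

lemma smult_sum_right: "smult c (sum f A) = (\<Sum>i\<in>A. smult c (f i))"
  by (induction A rule: infinite_finite_induct) (auto simp: smult_add_right)

lemma square_minus_one_dvd:
  assumes "prime q" "q \<noteq> 3"
  shows "3 * ((q\<^sup>2 - 1) div 3) = q\<^sup>2 - (1::nat)"
proof -
  have "q mod 3 \<noteq> 0" using assms primes_dvd_imp_eq[of 3 q] by (auto simp: dvd_eq_mod_eq_0)
  then have "q mod 3 = 1 \<or> q mod 3 = 2" by arith
  moreover have "q\<^sup>2 mod 3 = (q mod 3)\<^sup>2 mod 3" by (simp add: power_mod)
  ultimately have "q\<^sup>2 mod 3 = 1" by auto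
  then show ?thesis by presburger
qed

section \<open>Cubic characters modulo a prime and their group ring\<close>

locale cubic_residue_character =
  fixes p :: nat and chi :: "int \<Rightarrow> eis"
  assumes prime_p: "prime p" and p_neq_3: "p \<noteq> 3"
    and chi_mult: "chi (a * b) = chi a * chi b"
    and chi_eq_0: "int p dvd a \<Longrightarrow> chi a = 0"
    and chi_mu3: "\<not> int p dvd a \<Longrightarrow> chi a \<in> mu3"
    and chi_mod: "chi (a mod int p) = chi a"
    and chi_nontrivial: "\<exists>a. \<not> int p dvd a \<and> chi a \<noteq> 1"
begin

lemma p_gt_1: "p > 1"
  using prime_p prime_gt_1_nat by blast

lemma chi_cong: "[a = b] (mod int p) \<Longrightarrow> chi a = chi b"
  by (metis cong_def chi_mod)

lemma chi_1 [simp]: "chi 1 = 1"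
proof -
  have "\<not> int p dvd 1" using p_gt_1 by auto
  then have "chi 1 \<in> mu3" by (rule chi_mu3)
  moreover have "chi 1 = chi 1 * chi 1" using chi_mult[of 1 1] by simp
  ultimately show ?thesis using zero_notin_mu3 by auto
qed

lemma chi_power: "chi (a ^ n) = chi a ^ n"
  by (induction n) (auto simp: chi_mult)

lemma chi_minus: "chi (- a) = chi a"
proof -
  have "\<not> int p dvd -1" using p_gt_1 by auto
  then have m: "chi (-1) \<in> mu3" by (rule chi_mu3)
  have "chi (-1) ^ 2 = 1" using chi_power[of "-1" 2] by simp
  then have "chi (-1) = 1" by (rule mu3_power_eq_one[OF m]) simp
  then show ?thesis using chi_mult[of "-1" a] by simp
qed

lemma chi_cube: "chi a ^ 3 = (if int p dvd a then 0 else 1)"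
  using chi_eq_0 chi_mu3 mu3_cube by auto

lemma chi_square: "chi a ^ 2 = eis_cnj (chi a)"
  using chi_eq_0[of a] chi_mu3[of a] mu3_cnj[of "chi a"] by (cases "int p dvd a") auto

lemma cnj_character: "cubic_residue_character p (\<lambda>a. eis_cnj (chi a))"
proof
  obtain a where a: "\<not> int p dvd a" "chi a \<noteq> 1" using chi_nontrivial by blast
  then have "eis_cnj (chi a) \<noteq> 1" by (metis eis_cnj_simps(2,8))
  then show "\<exists>a. \<not> int p dvd a \<and> eis_cnj (chi a) \<noteq> 1" using a by blast
qed (auto simp: prime_p p_neq_3 chi_mult chi_eq_0 chi_mod mu3_cnj_mem chi_mu3)

definition R :: "int set" where "R = {0..<int p}"

lemma finite_R [simp]: "finite R"
  by (simp add: R_def)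

lemma sum_R_shift:
  assumes "\<And>a. h (a mod int p) = h a"
  shows "(\<Sum>a\<in>R. h (a + c)) = (\<Sum>a\<in>R. h a)"
proof (rule sum.reindex_bij_witness[where i = "\<lambda>b. (b - c) mod int p" and j = "\<lambda>a. (a + c) mod int p"])
  fix a assume "a \<in> R"
  then have "a mod int p = a" by (simp add: R_def)
  then show "((a + c) mod int p - c) mod int p = a"
    and "((a - c) mod int p + c) mod int p = a"
    by (simp_all add: mod_simps)
  show "(a + c) mod int p \<in> R" "(a - c) mod int p \<in> R" using p_gt_1 by (simp_all add: R_def)
  show "h ((a + c) mod int p) = h (a + c)" by (rule assms)
qed

lemma sum_R_scale:
  assumes "\<And>a. h (a mod int p) = h a" "\<not> int p dvd u"
  shows "(\<Sum>a\<in>R. h (u * a)) = (\<Sum>a\<in>R. h a)"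
proof -
  have "coprime u (int p)"
    using assms(2) prime_p prime_imp_coprime[of "int p" u] by (simp add: coprime_commute)
  then obtain v where v: "[u * v = 1] (mod int p)" using cong_solve_coprime_int by blast
  have *: "(u * (v * a mod int p)) mod int p = a" "(v * (u * a mod int p)) mod int p = a"
    if "a \<in> R" for a
  proof -
    have "[u * v * a = 1 * a] (mod int p)" by (intro cong_mult v cong_refl)
    then have "(u * v * a) mod int p = a" using that by (simp add: cong_def R_def)
    then show "(u * (v * a mod int p)) mod int p = a" "(v * (u * a mod int p)) mod int p = a"
      by (simp_all add: mod_simps mult_ac)
  qed
  show ?thesis
    by (rule sum.reindex_bij_witness[where i = "\<lambda>b. (v * b) mod int p" and j = "\<lambda>a. (u * a) mod int p"])
      (use * p_gt_1 assms(1) in \<open>auto simp: R_def\<close>)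
qed

lemma sum_chi: "(\<Sum>a\<in>R. chi a) = 0"
proof -
  obtain b where b: "\<not> int p dvd b" "chi b \<noteq> 1" using chi_nontrivial by blast
  have "(\<Sum>a\<in>R. chi (b * a)) = (\<Sum>a\<in>R. chi a)" using b chi_mod by (intro sum_R_scale) auto
  then have "(chi b - 1) * (\<Sum>a\<in>R. chi a) = 0"
    by (simp only: chi_mult sum_distrib_left [symmetric] left_diff_distrib mult_1) simp
  then show ?thesis using b by simp
qed

text \<open>The group ring of the integers modulo \<open>p\<close> over the Eisenstein integers is represented by
  polynomials modulo \<open>M\<close>, with \<open>E a\<close> standing for the group element \<open>a\<close>; congruence modulo
  \<open>M\<close> is \<open>cg\<close>, and \<open>cc\<close> extracts the coefficient of \<open>E 1\<close>. Working here rather than with complex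
  roots of unity makes divisibility by a prime a coefficientwise statement.\<close>

definition M :: "eis poly" where "M = monom 1 p - 1"

definition E :: "int \<Rightarrow> eis poly" where "E a = monom 1 (nat (a mod int p))"

definition S :: "(int \<Rightarrow> eis) \<Rightarrow> eis poly" where "S f = (\<Sum>a\<in>R. smult (f a) (E a))"

definition cg :: "eis poly \<Rightarrow> eis poly \<Rightarrow> bool" where "cg f g \<longleftrightarrow> M dvd f - g"

lemma cg_refl [simp]: "cg f f"
  by (simp add: cg_def)

lemma cg_trans [trans]: "cg f g \<Longrightarrow> cg g h \<Longrightarrow> cg f h"
  unfolding cg_def using dvd_add[of M "f - g" "g - h"] by simp

lemma cg_sym: "cg f g \<Longrightarrow> cg g f"
  unfolding cg_def by (metis dvd_minus_iff minus_diff_eq)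

lemma cg_mult: "cg f g \<Longrightarrow> cg f' g' \<Longrightarrow> cg (f * f') (g * g')"
  unfolding cg_def by (metis dvd_add dvd_mult dvd_mult2 mult_diff_mult)

lemma cg_smult: "cg f g \<Longrightarrow> cg (smult c f) (smult c g)"
  unfolding cg_def by (metis dvd_smult smult_diff_right)

lemma cg_sum: "(\<And>i. i \<in> A \<Longrightarrow> cg (f i) (g i)) \<Longrightarrow> cg (sum f A) (sum g A)"
  unfolding cg_def by (simp add: sum_subtractf [symmetric] dvd_sum)

lemma cg_monom_mod: "cg (monom 1 k) (monom 1 (k mod p))"
proof -
  have "M dvd monom 1 p ^ (k div p) - 1 ^ (k div p)"
    unfolding M_def by (intro dvd_power_diff) simp
  then have "M dvd monom 1 (k mod p) * (monom 1 p ^ (k div p) - 1)" by simp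
  moreover have "monom 1 (k mod p) * monom 1 p ^ (k div p) = (monom 1 k :: eis poly)"
    by (simp add: monom_power mult_monom add.commute)
  ultimately show ?thesis by (simp add: cg_def right_diff_distrib)
qed

lemma E_mult: "cg (E a * E b) (E (a + b))"
proof -
  have "nat (a mod int p) + nat (b mod int p) = nat (a mod int p + b mod int p)"
    using p_gt_1 by (simp add: nat_add_distrib)
  also have "\<dots> mod p = nat ((a mod int p + b mod int p) mod int p)"
    using p_gt_1 by (simp add: nat_mod_distrib)
  also have "(a mod int p + b mod int p) mod int p = (a + b) mod int p" by (rule mod_add_eq)
  finally show ?thesis
    using cg_monom_mod[of "nat (a mod int p) + nat (b mod int p)"] by (simp add: E_def mult_monom)
qed

lemma E_mod: "E (a mod int p) = E a"
  by (simp add: E_def)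

lemma E_0: "E 0 = 1"
  by (simp add: E_def)

lemma E_power: "cg (E a ^ n) (E (int n * a))"
proof (induction n)
  case (Suc n)
  have "cg (E a * E a ^ n) (E (a + int n * a))"
    using cg_mult[OF cg_refl Suc.IH] E_mult cg_trans by blast
  then show ?case by (simp add: algebra_simps)
qed (simp add: E_0)

lemma S_mult:
  assumes "\<And>a. g (a mod int p) = g a"
  shows "cg (S f * S g) (S (\<lambda>c. \<Sum>a\<in>R. f a * g (c - a)))"
proof -
  have "S f * S g = (\<Sum>a\<in>R. \<Sum>b\<in>R. smult (f a * g b) (E a * E b))"
    by (simp add: S_def sum_product mult.commute)
  moreover have "cg \<dots> (\<Sum>a\<in>R. \<Sum>b\<in>R. smult (f a * g b) (E (a + b)))"
    by (intro cg_sum cg_smult E_mult)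
  moreover have "(\<Sum>b\<in>R. smult (f a * g b) (E (a + b))) = (\<Sum>c\<in>R. smult (f a * g (c - a)) (E c))" for a
  proof -
    have "(\<Sum>c\<in>R. smult (f a * g (c + a - a)) (E (c + a))) = (\<Sum>c\<in>R. smult (f a * g (c - a)) (E c))"
      by (rule sum_R_shift) (metis E_mod assms mod_diff_left_eq)
    then show ?thesis by (simp add: add.commute)
  qed
  moreover have "(\<Sum>a\<in>R. \<Sum>c\<in>R. smult (f a * g (c - a)) (E c)) = S (\<lambda>c. \<Sum>a\<in>R. f a * g (c - a))"
    unfolding S_def by (subst sum.swap) (simp add: smult_sum)
  ultimately show ?thesis by simp
qed

definition cc :: "eis poly \<Rightarrow> eis" where
  "cc f = (\<Sum>i\<le>degree f. if i mod p = 1 then coeff f i else 0)"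

lemma cc_altdef: "degree f \<le> n \<Longrightarrow> cc f = (\<Sum>i\<le>n. if i mod p = 1 then coeff f i else 0)"
  unfolding cc_def by (rule sum.mono_neutral_left) (auto simp: coeff_eq_0)

lemma cc_add: "cc (f + g) = cc f + cc g"
proof -
  define n where "n = max (degree f) (degree g)"
  have "degree (f + g) \<le> n" "degree f \<le> n" "degree g \<le> n"
    using degree_add_le_max[of f g] by (auto simp: n_def)
  then show ?thesis
    by (simp add: cc_altdef[of _ n] sum.distrib[symmetric]) (rule sum.cong, auto)
qed

lemma cc_smult: "cc (smult c f) = c * cc f"
  using degree_smult_le[of c f]
  by (simp add: cc_altdef[of _ "degree f"] sum_distrib_left) (rule sum.cong, auto)

lemma cc_0 [simp]: "cc 0 = 0"
  by (simp add: cc_def)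

lemma cc_diff: "cc (f - g) = cc f - cc g"
  using cc_add[of "f - g" g] by simp

lemma cc_sum: "cc (sum f A) = (\<Sum>i\<in>A. cc (f i))"
  by (induction A rule: infinite_finite_induct) (auto simp: cc_add)

lemma cc_monom: "cc (monom c k) = (if k mod p = 1 then c else 0)"
proof -
  have "cc (monom c k) = (\<Sum>i\<le>k. if i mod p = 1 then coeff (monom c k) i else 0)"
    by (intro cc_altdef degree_monom_le)
  also have "\<dots> = (\<Sum>i\<le>k. if i = k then (if k mod p = 1 then c else 0) else 0)"
    by (rule sum.cong) auto
  finally show ?thesis by simp
qed

text \<open>\<open>cc\<close> adds up a whole residue class of exponents, so it makes sense on
  unreduced polynomials: the two terms of \<open>M * monom c i\<close> fall into the same class and
  cancel.\<close>

lemma cc_M_mult: "cc (M * u) = 0"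
proof -
  have *: "cc (M * monom c i) = 0" for c i
    by (simp add: M_def left_diff_distrib mult_monom cc_diff cc_monom)
  have "M * u = (\<Sum>i\<le>degree u. M * monom (coeff u i) i)"
    by (simp add: sum_distrib_left[symmetric] poly_as_sum_of_monoms)
  then show ?thesis by (simp add: cc_sum *)
qed

lemma cc_cong: "cg f g \<Longrightarrow> cc f = cc g"
  by (auto simp: cg_def cc_M_mult cc_diff[symmetric] elim!: dvdE) (metis cc_M_mult cc_diff right_minus_eq)

lemma cc_E: "cc (E a) = (if [a = 1] (mod int p) then 1 else 0)"
proof -
  have "nat (a mod int p) mod p = nat (a mod int p)"
    using p_gt_1 by (simp add: nat_less_iff)
  moreover have "nat (a mod int p) = 1 \<longleftrightarrow> a mod int p = 1" using p_gt_1 by linarith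
  ultimately show ?thesis using p_gt_1 by (simp add: E_def cc_monom cong_def)
qed

lemma cc_S: "cc (S f) = f 1"
proof -
  have "cc (S f) = (\<Sum>a\<in>R. if a = 1 then f a else 0)"
    unfolding S_def cc_sum cc_smult
    by (rule sum.cong) (use p_gt_1 in \<open>auto simp: cc_E cong_def R_def\<close>)
  also have "\<dots> = f 1" using p_gt_1 by (simp add: R_def)
  finally show ?thesis .
qed

lemma cc_of_nat_dvd:
  assumes "of_nat q dvd f - g"
  shows "of_nat q dvd cc f - cc g"
proof -
  obtain h where "f - g = of_nat q * h" using assms by blast
  then have "f - g = smult (of_nat q) h" by (simp add: of_nat_poly)
  then show ?thesis by (metis cc_diff cc_smult dvd_triv_left)
qed

section \<open>The Gauss sum \<open>G\<close> and the Jacobi sum \<open>J\<close>\<close>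

definition J :: eis where "J = (\<Sum>t\<in>R. chi t * chi (1 - t))"

abbreviation G :: "eis poly" where "G \<equiv> S chi"

abbreviation Gbar :: "eis poly" where "Gbar \<equiv> S (\<lambda>a. eis_cnj (chi a))"

lemma sum_chi_cnj: "(\<Sum>a\<in>R. eis_cnj (chi a)) = 0"
  using sum_chi eis_cnj_sum[of chi R] by simp

lemma chi_mod_diff: "chi (c - a mod int p) = chi (c - a)"
  by (metis chi_mod mod_diff_right_eq)

text \<open>The coefficient at c is a convolution of \<open>chi\<close> with itself. For c prime to
  p, substituting c * a for a pulls out chi(c)^2, the conjugate of chi(c), and leaves
  \<open>J\<close>. For p dividing c it is the sum of the conjugate character, hence 0.\<close>

lemma G_square: "cg (G * G) (smult J Gbar)"
proof -
  have "(\<Sum>a\<in>R. chi a * chi (c - a)) = J * eis_cnj (chi c)" for c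
  proof (cases "int p dvd c")
    case True
    have "chi (c - a) = chi a" for a
      using True chi_minus[of a] chi_cong[of "c - a" "- a"]
      by (simp add: cong_iff_dvd_diff)
    then have "(\<Sum>a\<in>R. chi a * chi (c - a)) = (\<Sum>a\<in>R. eis_cnj (chi a))"
      by (simp add: chi_square [symmetric] power2_eq_square)
    then show ?thesis using True by (simp add: sum_chi_cnj chi_eq_0)
  next
    case False
    have "(\<Sum>a\<in>R. chi (c * a) * chi (c - c * a)) = (\<Sum>a\<in>R. chi a * chi (c - a))"
      by (rule sum_R_scale[OF _ False]) (simp add: chi_mod chi_mod_diff)
    moreover have "chi (c * a) * chi (c - c * a) = eis_cnj (chi c) * (chi a * chi (1 - a))" for a
    proof -
      have "c - c * a = c * (1 - a)" by (simp add: algebra_simps)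
      then show ?thesis by (simp add: chi_mult chi_square[symmetric] power2_eq_square mult_ac)
    qed
    ultimately show ?thesis by (simp add: J_def sum_distrib_left[symmetric] mult.commute)
  qed
  then have "S (\<lambda>c. \<Sum>a\<in>R. chi a * chi (c - a)) = smult J Gbar"
    by (simp add: S_def smult_sum_right)
  then show ?thesis using S_mult[of chi chi] chi_mod by simp
qed

lemma cnj_J: "eis_cnj J = cubic_residue_character.J p (\<lambda>a. eis_cnj (chi a))"
  by (simp add: J_def cubic_residue_character.J_def[OF cnj_character] eis_cnj_sum R_def
      cubic_residue_character.R_def[OF cnj_character])

lemma Gbar_square: "cg (Gbar * Gbar) (smult (eis_cnj J) G)"
proof -
  interpret c: cubic_residue_character p "\<lambda>a. eis_cnj (chi a)" by (rule cnj_character)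
  show ?thesis
    using c.G_square
    by (simp add: cnj_J[symmetric] cg_def c.cg_def M_def c.M_def S_def c.S_def R_def c.R_def
        E_def c.E_def)
qed

text \<open>The sum of all group elements. It vanishes at a primitive p-th root of unity but not in
  the group ring, so it is carried along until a factor \<open>G\<close> kills it
  (\<open>G_T\<close>).\<close>

abbreviation T :: "eis poly" where "T \<equiv> S (\<lambda>_. 1)"

lemma G_T: "cg (T * G) 0"
proof -
  have "(\<Sum>a\<in>R. chi (c - a)) = 0" for c
  proof -
    have "(\<Sum>a\<in>R. chi (a + (- c))) = (\<Sum>a\<in>R. chi a)" by (rule sum_R_shift) (rule chi_mod)
    then show ?thesis using chi_minus[of "c - a" for a] by (simp add: sum_chi)
  qed
  then have "S (\<lambda>c. \<Sum>a\<in>R. 1 * chi (c - a)) = 0" by (simp add: S_def)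
  then show ?thesis using S_mult[of chi "\<lambda>_. 1"] chi_mod by simp
qed

lemma chi_cnj: "chi a * eis_cnj (chi a) = (if int p dvd a then 0 else 1)"
  using chi_cube[of a] by (simp only: chi_square[symmetric] power2_eq_square power3_eq_cube mult.assoc)

text \<open>The convolution coefficients \<open>g\<close> are p - 1 at 0 and constant elsewhere, by
  scaling. Their total is 0 because the conjugate character sums to 0, so the constant is
  -1.\<close>

lemma G_Gbar: "cg (G * Gbar) (smult (of_nat p) 1 - T)"
proof -
  define g where "g c = (\<Sum>a\<in>R. chi a * eis_cnj (chi (c - a)))" for c
  have g0: "g c = of_nat (p - 1)" if "int p dvd c" for c
  proof -
    have "chi (c - a) = chi a" for a
      using that chi_minus[of a] chi_cong[of "c - a" "- a"]
      by (simp add: cong_iff_dvd_diff)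
    then have "g c = (\<Sum>a\<in>R. if int p dvd a then 0 else 1)" by (simp add: g_def chi_cnj)
    also have "\<dots> = (\<Sum>a\<in>R - {0}. 1)"
      by (rule sum.mono_neutral_cong_right) (auto simp: R_def dest: zdvd_imp_le)
    also have "\<dots> = of_nat (card (R - {0}))" by simp
    also have "card (R - {0}) = p - 1" using p_gt_1 by (subst card_Diff_singleton) (auto simp: R_def)
    finally show ?thesis .
  qed
  have g1: "g c = g 1" if "\<not> int p dvd c" for c
  proof -
    have "(\<Sum>a\<in>R. chi (c * a) * eis_cnj (chi (c - c * a))) = g c"
      unfolding g_def by (rule sum_R_scale[OF _ that]) (simp add: chi_mod chi_mod_diff)
    moreover have "chi (c * a) * eis_cnj (chi (c - c * a)) = chi a * eis_cnj (chi (1 - a))" for a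
    proof -
      have "c - c * a = c * (1 - a)" by (simp add: algebra_simps)
      then have "chi (c * a) * eis_cnj (chi (c - c * a)) =
          (chi c * eis_cnj (chi c)) * (chi a * eis_cnj (chi (1 - a)))"
        by (simp add: chi_mult mult_ac)
      then show ?thesis using that by (simp add: chi_cnj)
    qed
    ultimately show ?thesis by (simp add: g_def)
  qed
  have "(\<Sum>c\<in>R. g c) = 0"
  proof -
    have "(\<Sum>c\<in>R. eis_cnj (chi (c - a))) = 0" for a
      using sum_R_shift[of "\<lambda>c. eis_cnj (chi c)" "- a"] by (simp add: chi_mod sum_chi_cnj)
    then show ?thesis unfolding g_def by (subst sum.swap) (simp add: sum_distrib_left[symmetric])
  qed
  moreover have "(\<Sum>c\<in>R. g c) = g 0 + (\<Sum>c\<in>R - {0}. g c)"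
    using p_gt_1 by (subst sum.remove[of _ 0]) (auto simp: R_def)
  moreover have "(\<Sum>c\<in>R - {0}. g c) = (\<Sum>c\<in>R - {0}. g 1)"
    by (intro sum.cong refl g1) (auto simp: R_def dest: zdvd_imp_le)
  moreover have "card (R - {0}) = p - 1"
    using p_gt_1 by (subst card_Diff_singleton) (auto simp: R_def)
  ultimately have "of_nat (p - 1) * (1 + g 1) = 0" using g0[of 0] by (simp add: algebra_simps)
  moreover have "of_nat (p - 1) \<noteq> (0 :: eis)" using p_gt_1 by (simp only: of_nat_eq_0_iff)
  ultimately have "g 1 = -1" by (simp add: add_eq_0_iff)
  then have g: "g c = (if c = 0 then of_nat p else 0) - 1" if "c \<in> R" for c
  proof (cases "c = 0")
    case True
    then show ?thesis using g0[of c] p_gt_1 by (simp add: of_nat_diff)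
  next
    case False
    then have "\<not> int p dvd c" using that by (simp add: R_def zdvd_not_zless)
    then show ?thesis using False g1[of c] \<open>g 1 = -1\<close> by simp
  qed
  have "S g = (\<Sum>c\<in>R. smult (if c = 0 then of_nat p else 0) (E c)) - T"
    by (simp add: S_def g smult_diff_left sum_subtractf)
  also have "(\<Sum>c\<in>R. smult (if c = 0 then of_nat p else 0) (E c)) =
      (\<Sum>c\<in>R. if c = 0 then smult (of_nat p) (E 0) else 0)"
    by (rule sum.cong) auto
  also have "\<dots> = smult (of_nat p) 1" using p_gt_1 by (simp add: R_def E_0)
  finally have "S g = smult (of_nat p) 1 - T" .
  then show ?thesis
    using S_mult[of "\<lambda>a. eis_cnj (chi a)" chi] chi_mod by (simp add: g_def[abs_def])
qed

lemma norm_J: "J * eis_cnj J = of_nat p"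
proof -
  have "cg (smult (of_nat p) G) (G * (smult (of_nat p) 1 - T))"
    using cg_sym[OF G_T] unfolding cg_def by (simp add: algebra_simps)
  also have "cg \<dots> (G * (G * Gbar))" by (intro cg_mult cg_refl cg_sym[OF G_Gbar])
  also have "G * (G * Gbar) = G * G * Gbar" by (simp only: mult.assoc)
  also have "cg \<dots> (smult J Gbar * Gbar)" by (intro cg_mult cg_refl G_square)
  also have "smult J Gbar * Gbar = smult J (Gbar * Gbar)" by simp
  also have "cg \<dots> (smult J (smult (eis_cnj J) G))" by (intro cg_smult Gbar_square)
  also have "\<dots> = smult (J * eis_cnj J) G" by simp
  finally have "cg (smult (of_nat p) G) (smult (J * eis_cnj J) G)" .
  then have "cc (smult (of_nat p) G) = cc (smult (J * eis_cnj J) G)" by (rule cc_cong)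
  then show ?thesis by (simp add: cc_smult cc_S)
qed

text \<open>The classical G^3 = p * J is false here, the cube being J * (p - T). One more factor
  \<open>G\<close> removes \<open>T\<close>: G^4 = (J * Gbar)^2 = J^2 * eis_cnj J * G. Hence the
  exponents 1 modulo 3.\<close>

lemma G_power: "cg (G ^ (3 * k + 1)) (smult ((J ^ 2 * eis_cnj J) ^ k) G)"
proof (induction k)
  case (Suc k)
  define A where "A = (J ^ 2 * eis_cnj J) ^ k"
  have "G ^ 4 = (G * G) * (G * G)" by (simp only: power4_eq_xxxx mult.assoc)
  also have "cg \<dots> (smult J Gbar * smult J Gbar)" by (intro cg_mult G_square)
  also have "\<dots> = smult (J * J) (Gbar * Gbar)" by simp
  also have "cg \<dots> (smult (J * J) (smult (eis_cnj J) G))" by (intro cg_smult Gbar_square)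
  also have "\<dots> = smult (J ^ 2 * eis_cnj J) G" by (simp add: power2_eq_square)
  finally have *: "cg (G ^ 4) (smult (J ^ 2 * eis_cnj J) G)" .
  have "G ^ (3 * Suc k + 1) = G ^ (3 * k + 1) * G ^ 3"
    unfolding power_add[symmetric] by (rule arg_cong[of _ _ "power G"]) simp
  also have "cg \<dots> (smult A G * G ^ 3)"
    unfolding A_def by (intro cg_mult Suc.IH cg_refl)
  also have "smult A G * G ^ 3 = smult A (G ^ 4)"
    by (simp add: power3_eq_cube power4_eq_xxxx mult_ac)
  also have "cg \<dots> (smult A (smult (J ^ 2 * eis_cnj J) G))" by (intro cg_smult *)
  also have "\<dots> = smult ((J ^ 2 * eis_cnj J) ^ Suc k) G"
    by (simp add: A_def mult.commute)
  finally show ?case .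
qed simp

text \<open>Modulo q, raising \<open>G\<close> to the power N = q^k acts termwise and moves the
  group element a to N * a. Only the index b inverse to N modulo p lands on
  \<open>E 1\<close>.\<close>

lemma cc_G_power:
  assumes "prime q" "q \<noteq> p" "k > 0"
  obtains b where "of_nat q dvd cc (G ^ (q ^ k)) - chi b ^ (q ^ k)" "[int (q ^ k) * b = 1] (mod int p)"
proof -
  define N where "N = q ^ k"
  have "coprime q p" using assms prime_p by (simp add: primes_coprime)
  then have "coprime (int N) (int p)" by (simp add: N_def)
  then obtain b where b: "[int N * b = 1] (mod int p)" using cong_solve_coprime_int by blast
  have bN: "coprime (int N) (int p)" by fact
  have "of_nat q dvd G ^ N - (\<Sum>a\<in>R. smult (chi a) (E a) ^ N)"
    unfolding S_def N_def by (intro prime_dvd_sum_power_power assms)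
  then have "of_nat q dvd cc (G ^ N) - cc (\<Sum>a\<in>R. smult (chi a) (E a) ^ N)"
    by (rule cc_of_nat_dvd)
  also have "cc (\<Sum>a\<in>R. smult (chi a) (E a) ^ N) = cc (\<Sum>a\<in>R. smult (chi a ^ N) (E (int N * a)))"
    by (intro cc_cong cg_sum) (simp add: smult_power cg_smult E_power)
  also have "\<dots> = (\<Sum>a\<in>R. if a = b mod int p then chi (b mod int p) ^ N else 0)"
    unfolding cc_sum cc_smult cc_E
  proof (rule sum.cong[OF refl])
    fix a assume a: "a \<in> R"
    have "[int N * a = 1] (mod int p) \<longleftrightarrow> [int N * a = int N * b] (mod int p)"
      using b by (metis cong_sym cong_trans)
    also have "\<dots> \<longleftrightarrow> [a = b] (mod int p)" using bN by (rule cong_mult_lcancel)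
    also have "\<dots> \<longleftrightarrow> a = b mod int p" using a by (simp add: cong_def R_def)
    finally show "chi a ^ N * (if [int N * a = 1] (mod int p) then 1 else 0) =
        (if a = b mod int p then chi (b mod int p) ^ N else 0)" by simp
  qed
  also have "\<dots> = chi b ^ N" using p_gt_1 by (simp add: R_def chi_mod)
  finally show thesis using that b by (simp add: N_def)
qed

text \<open>Frobenius at 3 makes the \<open>E 1\<close> coefficient of G^3 congruent to 1. On the
  other hand G^3 = J * (p - T), where p contributes only at \<open>E 0\<close>, so that coefficient
  is -J.\<close>

lemma J_cong: "3 dvd J + 1"
proof -
  have 3: "prime (3::nat)" by simp
  obtain b where b: "of_nat 3 dvd cc (G ^ (3 ^ 1)) - chi b ^ (3 ^ 1)" "[int (3 ^ 1) * b = 1] (mod int p)"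
    using cc_G_power[OF 3, of 1] p_neq_3 by auto
  have "\<not> int p dvd b"
  proof
    assume "int p dvd b"
    then have "int p dvd 1" using b(2) by (metis cong_dvd_iff dvd_mult)
    then show False using p_gt_1 by simp
  qed
  then have "chi b ^ 3 = 1" by (simp add: chi_cube)
  moreover have "cc (G ^ 3) = - J"
  proof -
    have "cg (G * G * G) (smult J Gbar * G)" by (intro cg_mult G_square cg_refl)
    moreover have "cg (smult J (G * Gbar)) (smult J (smult (of_nat p) 1 - T))"
      by (intro cg_smult G_Gbar)
    ultimately have "cg (G ^ 3) (smult J (smult (of_nat p) 1 - T))"
      using cg_trans by (simp add: power3_eq_cube mult_ac)
    then have "cc (G ^ 3) = cc (smult J (smult (of_nat p) 1 - T))" by (rule cc_cong)
    also have "\<dots> = J * (of_nat p * cc (E 0) - 1)" by (simp only: cc_smult cc_diff cc_S E_0)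
    also have "cc (E 0) = 0" using p_gt_1 by (simp add: cc_E cong_def)
    finally show ?thesis by simp
  qed
  ultimately have "3 dvd - J - 1" using b(1) by simp
  moreover have "- J - 1 = - (J + 1)" by simp
  ultimately show ?thesis by (metis dvd_minus_iff)
qed

text \<open>The \<open>E 1\<close> coefficient of G^(q^2) is computed by \<open>G_power\<close> and
  by Frobenius. The square of q serves twice: q^2 is 1 modulo 3 for every q other than 3, and the
  value at the inverse of q^2 is chi(q)^(-2) = chi(q). The base \<open>J ^ 2 * eis_cnj J\<close>
  equals p * J, the classical cube of the Gauss sum.\<close>

theorem J_reciprocity:
  assumes "prime q" "q \<noteq> p" "q \<noteq> 3"
  shows "of_nat q dvd (J ^ 2 * eis_cnj J) ^ ((q\<^sup>2 - 1) div 3) - chi (int q)"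
proof -
  obtain b where b: "of_nat q dvd cc (G ^ q\<^sup>2) - chi b ^ q\<^sup>2" "[int (q\<^sup>2) * b = 1] (mod int p)"
    using cc_G_power[OF assms(1,2), of 2] by auto
  define k where "k = (q\<^sup>2 - 1) div 3"
  have "q\<^sup>2 > 0" using prime_gt_0_nat[OF assms(1)] by simp
  then have k: "q\<^sup>2 = 3 * k + 1" using square_minus_one_dvd[OF assms(1,3)] unfolding k_def by simp
  have "cc (G ^ q\<^sup>2) = cc (smult ((J ^ 2 * eis_cnj J) ^ k) G)"
    unfolding k by (intro cc_cong G_power)
  also have "\<dots> = (J ^ 2 * eis_cnj J) ^ k" by (simp add: cc_smult cc_S)
  finally have 1: "cc (G ^ q\<^sup>2) = (J ^ 2 * eis_cnj J) ^ k" .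
  have nd: "\<not> int p dvd b"
  proof
    assume "int p dvd b"
    then have "int p dvd 1" using b(2) by (metis cong_dvd_iff dvd_mult)
    then show False using p_gt_1 by simp
  qed
  have "\<not> int p dvd int q"
    using assms(1,2) prime_p primes_dvd_imp_eq by auto
  then have cq: "chi (int q) ^ 3 = 1" by (simp add: chi_cube)
  have "chi b ^ q\<^sup>2 = chi b" using nd chi_cube[of b] by (simp add: k power_add power_mult)
  also have "chi b = chi (int q)"
  proof -
    have "chi (int q) ^ 2 * chi b = 1"
      using chi_cong[OF b(2)] by (simp add: chi_mult chi_power)
    then have "chi (int q) ^ 3 * chi b = chi (int q)"
      by (simp add: power3_eq_cube power2_eq_square mult_ac)
    then show ?thesis using cq by simp
  qed
  finally show ?thesis using b(1) 1 by (simp add: k_def)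
qed

end

section \<open>Rational cubic reciprocity\<close>

text \<open>The i-th power of a primitive root g is sent to omega^i. This does not depend on the
  choice of the index i because 3 divides p - 1, the order of g.\<close>

lemma cubic_residue_character_exists:
  assumes "prime p" "p mod 3 = 1"
  shows "\<exists>chi. cubic_residue_character p chi"
proof -
  have "p > 2" using assms prime_ge_2_nat[of p] by (cases "p = 2") auto
  obtain g where g: "residue_primroot p g"
    using prime_primitive_root_exists[of p] \<open>p > 2\<close> \<open>prime p\<close> by auto
  then have cop: "coprime p g" and ord: "ord p g = p - 1"
    using \<open>prime p\<close> by (auto simp: residue_primroot_def totient_prime)
  have gen: "\<exists>i. [int g ^ i = a] (mod int p)" if "\<not> int p dvd a" for a
  proof -
    define d where "d = nat (a mod int p)"
    have d: "int d = a mod int p" using \<open>p > 2\<close> by (simp add: d_def)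
    then have "\<not> int p dvd int d" using that by (simp add: dvd_mod_iff)
    then have "\<not> p dvd d" by simp
    then have "coprime d p"
      using prime_imp_coprime[of p d] \<open>prime p\<close> by (simp add: coprime_commute)
    moreover have "d < p" using \<open>p > 2\<close> d by (metis of_nat_less_iff pos_mod_bound of_nat_0_less_iff zero_less_numeral less_trans)
    moreover have "d > 0" using \<open>\<not> p dvd d\<close> by (cases "d = 0") auto
    ultimately have "d \<in> totatives p" by (simp add: totatives_def)
    then obtain i where "d = g ^ i mod p"
      using residue_primroot_is_generator[OF _ g] \<open>p > 2\<close>
      by (auto simp: bij_betw_def image_iff)
    then have "int (g ^ i mod p) = a mod int p" using d by simp
    then show ?thesis by (auto simp: cong_def zmod_int)
  qed
  define ind where "ind a = (SOME i. [int g ^ i = a] (mod int p))" for a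
  have ind: "[int g ^ ind a = a] (mod int p)" if "\<not> int p dvd a" for a
    unfolding ind_def using gen[OF that] by (rule someI_ex)
  define chi where "chi a = (if int p dvd a then 0 else omega ^ ind a)" for a
  have chi: "chi a = omega ^ i" if "[int g ^ i = a] (mod int p)" "\<not> int p dvd a" for a i
  proof -
    have "[int g ^ ind a = int g ^ i] (mod int p)" using ind that cong_trans cong_sym by blast
    then have "[g ^ ind a = g ^ i] (mod p)" by (simp flip: cong_int_iff)
    then have "[ind a = i] (mod ord p g)" using order_divides_expdiff[OF cop] by blast
    moreover have "3 dvd ord p g" using ord assms(2) by presburger
    ultimately have "[ind a = i] (mod 3)" by (rule cong_dvd_modulus_nat)
    then have im: "ind a mod 3 = i mod 3" by (simp add: cong_def)
    have red: "omega ^ j = omega ^ (j mod 3)" for j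
    proof -
      have "omega ^ j = omega ^ (3 * (j div 3) + j mod 3)" by simp
      then show ?thesis by (simp only: power_add power_mult omega_cubed power_one mult_1)
    qed
    have "omega ^ ind a = omega ^ (i mod 3)" using red[of "ind a"] unfolding im .
    also have "\<dots> = omega ^ i" by (rule red[symmetric])
    finally have "omega ^ ind a = omega ^ i" .
    then show ?thesis using that by (simp add: chi_def)
  qed
  have mult: "chi (a * b) = chi a * chi b" for a b
  proof (cases "int p dvd a \<or> int p dvd b")
    case False
    then have ab: "\<not> int p dvd a * b" using \<open>prime p\<close> by (simp add: prime_dvd_mult_iff)
    have "[int g ^ ind a * int g ^ ind b = a * b] (mod int p)"
      using False by (intro cong_mult ind) auto
    then have "chi (a * b) = omega ^ (ind a + ind b)" by (intro chi ab) (simp add: power_add)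
    then show ?thesis using False by (simp add: chi_def power_add)
  qed (auto simp: chi_def)
  have "\<not> int p dvd int g"
    using cop \<open>prime p\<close> by (metis coprime_int_iff coprime_absorb_left int_dvd_int_iff not_prime_unit)
  then have "chi (int g) = omega ^ 1" by (intro chi) auto
  then have nontriv: "\<not> int p dvd int g \<and> chi (int g) \<noteq> 1"
    using \<open>\<not> int p dvd int g\<close> by (simp add: eis_eq_iff)
  have "cubic_residue_character p chi"
  proof
    fix a :: int
    show "chi a \<in> mu3" if "\<not> int p dvd a"
    proof -
      have "omega \<in> mu3" by (simp add: mu3_def)
      then show ?thesis using that by (simp add: chi_def mu3_power)
    qed
    show "chi (a mod int p) = chi a"
    proof (cases "int p dvd a")
      case False
      have "[int g ^ ind a = a mod int p] (mod int p)" using ind[OF False] by (simp add: cong_def)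
      then show ?thesis using False by (subst chi[of "ind a"]) (auto simp: chi_def dvd_mod_iff)
    qed (simp add: chi_def dvd_mod_iff)
    show "chi (a * b) = chi a * chi b" for b by (rule mult)
    show "\<exists>a. \<not> int p dvd a \<and> chi a \<noteq> 1" using nontriv by blast
    show "chi a = 0" if "int p dvd a" using that by (simp add: chi_def)
    show "p \<noteq> 3" using assms(2) by auto
  qed (rule assms(1))
  then show ?thesis by blast
qed

text \<open>\<open>f\<close> is the cubic residue symbol modulo \<open>k\<close>, restricted to rational integers. The last
  clause is the reciprocity law: the power of \<open>k\<^sup>2 * eis_cnj k\<close> is the residue symbol of \<open>k\<close>
  modulo \<open>q\<close>, uniformly for \<open>q\<close> split (product over both prime factors) and \<open>q\<close> inert.\<close>

definition cubic_char :: "eis \<Rightarrow> (int \<Rightarrow> eis) \<Rightarrow> bool" where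
  "cubic_char k f \<longleftrightarrow>
     (\<forall>m n. f (m * n) = f m * f n) \<and>
     (\<forall>m. coprime m (eis_norm k) \<longrightarrow> f m \<in> mu3) \<and>
     (\<forall>m n. [m = n] (mod eis_norm k) \<longrightarrow> f m = f n) \<and>
     (\<forall>q. prime q \<longrightarrow> q \<noteq> 3 \<longrightarrow> \<not> int q dvd eis_norm k \<longrightarrow>
        of_nat q dvd (k\<^sup>2 * eis_cnj k) ^ ((q\<^sup>2 - 1) div 3) - f (int q))"

lemma cubic_charD:
  assumes "cubic_char k f"
  shows "f (m * n) = f m * f n"
    and "coprime m (eis_norm k) \<Longrightarrow> f m \<in> mu3"
    and "[m = n] (mod eis_norm k) \<Longrightarrow> f m = f n"
    and "prime q \<Longrightarrow> q \<noteq> 3 \<Longrightarrow> \<not> int q dvd eis_norm k \<Longrightarrow>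
      of_nat q dvd (k\<^sup>2 * eis_cnj k) ^ ((q\<^sup>2 - 1) div 3) - f (int q)"
  using assms by (auto simp: cubic_char_def)

lemma cubic_char_mult:
  assumes "cubic_char k f" "cubic_char l g"
  shows "cubic_char (k * l) (\<lambda>m. f m * g m)"
  unfolding cubic_char_def
proof (intro conjI allI impI)
  fix m n
  show "f (m * n) * g (m * n) = f m * g m * (f n * g n)"
    using assms by (simp add: cubic_charD(1) mult_ac)
  show "f m * g m \<in> mu3" if "coprime m (eis_norm (k * l))"
    using that cubic_charD(2)[OF assms(1), of m] cubic_charD(2)[OF assms(2), of m]
    by (auto simp: eis_norm_mult intro: mu3_mult)
  show "f m * g m = f n * g n" if "[m = n] (mod eis_norm (k * l))"
  proof -
    have "[m = n] (mod eis_norm k)" "[m = n] (mod eis_norm l)"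
      using that by (auto simp: eis_norm_mult intro: cong_modulus_mult cong_dvd_modulus)
    then have "f m = f n" "g m = g n" using assms cubic_charD(3) by blast+
    then show ?thesis by simp
  qed
next
  fix q :: nat
  assume q: "prime q" "q \<noteq> 3" "\<not> int q dvd eis_norm (k * l)"
  define e where "e = (q\<^sup>2 - 1) div 3"
  have "of_nat q dvd (k\<^sup>2 * eis_cnj k) ^ e - f (int q)" "of_nat q dvd (l\<^sup>2 * eis_cnj l) ^ e - g (int q)"
    unfolding e_def using cubic_charD(4)[OF assms(1) q(1,2)] cubic_charD(4)[OF assms(2) q(1,2)] q(3)
    by (metis dvd_mult dvd_mult2 eis_norm_mult)+
  then have "of_nat q dvd ((k\<^sup>2 * eis_cnj k) ^ e - f (int q)) * (l\<^sup>2 * eis_cnj l) ^ e +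
      f (int q) * ((l\<^sup>2 * eis_cnj l) ^ e - g (int q))"
    by simp
  then show "of_nat q dvd ((k * l)\<^sup>2 * eis_cnj (k * l)) ^ ((q\<^sup>2 - 1) div 3) - f (int q) * g (int q)"
    by (simp add: e_def algebra_simps power_mult_distrib)
qed

lemma cubic_char_cnj:
  assumes "cubic_char k f"
  shows "cubic_char (eis_cnj k) (\<lambda>m. eis_cnj (f m))"
  unfolding cubic_char_def
proof (intro conjI allI impI)
  fix q :: nat
  assume "prime q" "q \<noteq> 3" "\<not> int q dvd eis_norm (eis_cnj k)"
  then have "of_nat q dvd (k\<^sup>2 * eis_cnj k) ^ ((q\<^sup>2 - 1) div 3) - f (int q)"
    using assms by (intro cubic_charD(4)) auto
  then have "eis_cnj (of_int (int q)) dvd eis_cnj ((k\<^sup>2 * eis_cnj k) ^ ((q\<^sup>2 - 1) div 3) - f (int q))"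
    by (intro eis_cnj_dvd) simp
  then show "of_nat q dvd ((eis_cnj k)\<^sup>2 * eis_cnj (eis_cnj k)) ^ ((q\<^sup>2 - 1) div 3) - eis_cnj (f (int q))"
    by simp
qed (use assms in \<open>auto simp: cubic_charD(1) mu3_cnj_mem cubic_charD(2) dest: cubic_charD(3)\<close>)

lemma fermat_theorem_int:
  fixes c :: int
  assumes "prime p" "\<not> int p dvd c"
  shows "[c ^ (p - 1) = 1] (mod int p)"
proof -
  define d where "d = nat (c mod int p)"
  have d: "int d = c mod int p" using prime_gt_0_nat[OF assms(1)] by (simp add: d_def)
  then have "\<not> int p dvd int d" using assms(2) by (simp add: dvd_mod_iff)
  then have "[d ^ (p - 1) = 1] (mod p)" using assms(1) by (intro fermat_theorem) auto
  then have "[int (d ^ (p - 1)) = int 1] (mod int p)" by (simp only: cong_int_iff)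
  moreover have "[c = int d] (mod int p)" by (simp add: d cong_def)
  ultimately show ?thesis by (metis cong_pow cong_trans of_nat_1 of_nat_power)
qed

text \<open>Rational integers are cubes modulo inert primes, and their symbols at two conjugate
  primes cancel, so the symbol is trivial. The reciprocity clause is Fermat's theorem: with k = c
  the power is c^(q^2 - 1).\<close>

lemma cubic_char_of_int: "cubic_char (of_int c) (\<lambda>m. if coprime m c then 1 else 0)"
  unfolding cubic_char_def
proof (intro conjI allI impI)
  fix q :: nat
  assume q: "prime q" "q \<noteq> 3" "\<not> int q dvd eis_norm (of_int c)"
  then have nd: "\<not> int q dvd c" by (simp add: prime_dvd_power_iff)
  have "[c ^ (q - 1) = 1] (mod int q)" using fermat_theorem_int q(1) nd .
  then have "[(c ^ (q - 1)) ^ (q + 1) = 1 ^ (q + 1)] (mod int q)" by (rule cong_pow)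
  moreover have "(q - 1) * (q + 1) = q\<^sup>2 - 1"
    by (cases q) (auto simp: power2_eq_square algebra_simps)
  ultimately have "[c ^ (q\<^sup>2 - 1) = 1] (mod int q)" by (simp only: power_mult[symmetric] power_one)
  moreover have "(c ^ 3) ^ ((q\<^sup>2 - 1) div 3) = c ^ (q\<^sup>2 - 1)"
    unfolding power_mult[symmetric] square_minus_one_dvd[OF q(1,2)] ..
  ultimately have "int q dvd (c ^ 3) ^ ((q\<^sup>2 - 1) div 3) - 1" by (simp add: cong_iff_dvd_diff)
  then have "(of_int (int q) :: eis) dvd of_int ((c ^ 3) ^ ((q\<^sup>2 - 1) div 3) - 1)"
    by (simp only: of_int_dvd_eis_iff ere_eim_of_int dvd_0_right)
  moreover have "coprime (int q) c" using nd q(1) by (intro prime_imp_coprime) auto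
  ultimately show "of_nat q dvd ((of_int c)\<^sup>2 * eis_cnj (of_int c)) ^ ((q\<^sup>2 - 1) div 3) -
      (if coprime (int q) c then 1 else 0)"
    by (simp add: power2_eq_square power3_eq_cube)
next
  fix m n assume "[m = n] (mod eis_norm (of_int c))"
  then have "[m = n] (mod c)" by (auto intro: cong_dvd_modulus)
  then show "(if coprime m c then 1 else 0) = (if coprime n c then (1::eis) else 0)"
    using cong_imp_coprime cong_sym by metis
qed auto

lemma (in cubic_residue_character) eis_norm_J: "eis_norm J = int p"
proof -
  have "of_int (eis_norm J) = (of_int (int p) :: eis)" using norm_J eis_mult_cnj[of J] by simp
  then show ?thesis by (simp only: of_int_eq_iff)
qed

lemma (in cubic_residue_character) cubic_char_J: "cubic_char J chi"
  unfolding cubic_char_def eis_norm_J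
proof (intro conjI allI impI)
  fix m :: int assume "coprime m (int p)"
  then have "\<not> int p dvd m"
    using p_gt_1 by (auto simp: coprime_absorb_right)
  then show "chi m \<in> mu3" by (rule chi_mu3)
next
  fix q :: nat assume "prime q" "q \<noteq> 3" "\<not> int q dvd int p"
  then show "of_nat q dvd (J\<^sup>2 * eis_cnj J) ^ ((q\<^sup>2 - 1) div 3) - chi (int q)"
    by (intro J_reciprocity) auto
qed (simp_all add: chi_mult chi_cong)

text \<open>When \<open>p\<close> divides the norm of \<open>k\<close>, the \<open>omega\<close>-coordinates of \<open>k * x\<close> and of its
  companion \<open>k * eis_cnj x\<close> have product divisible by \<open>p\<close>.\<close>

lemma prime_norm_dvd:
  assumes "prime p" "eis_norm x = int p" "int p dvd eis_norm k"
  shows "x dvd k \<or> eis_cnj x dvd k"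
proof -
  have *: "y dvd k" if "int p dvd eim (k * eis_cnj y)" "eis_norm y = int p" for y
  proof -
    have "int p dvd eis_norm (k * eis_cnj y)" using assms by (simp add: eis_norm_mult)
    moreover have "int p dvd ere z ^ 2" if "int p dvd eis_norm z" "int p dvd eim z" for z
    proof -
      have "ere z ^ 2 = eis_norm z + eim z * (ere z - eim z)"
        by (simp add: eis_norm_def power2_eq_square algebra_simps)
      then show ?thesis using that by simp
    qed
    ultimately have "int p dvd ere (k * eis_cnj y)"
      using that assms(1) by (metis prime_dvd_power prime_int_nat_transfer prime_nat_int_transfer)
    then have "of_int (int p) dvd k * eis_cnj y" using that by (simp only: of_int_dvd_eis_iff)
    then have "y * eis_cnj y dvd k * eis_cnj y" using that by (simp add: eis_mult_cnj)
    moreover have "eis_cnj y \<noteq> 0"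
      using that assms(1) by (metis eis_norm_cnj eis_norm_eq_0_iff of_nat_0_eq_iff not_prime_0)
    ultimately show ?thesis by simp
  qed
  have "eim (k * eis_cnj x) * eim (k * x) = eim k ^ 2 * eis_norm x - eim x ^ 2 * eis_norm k"
    by (simp add: eis_norm_def power2_eq_square algebra_simps)
  then have "int p dvd eim (k * eis_cnj x) * eim (k * x)" using assms by simp
  then have "int p dvd eim (k * eis_cnj x) \<or> int p dvd eim (k * x)"
    using assms(1) prime_dvd_mult_iff[of "int p"] by simp
  then show ?thesis using *[of x] *[of "eis_cnj x"] assms(2) by auto
qed

text \<open>If a and b are units modulo p and a^2 - a*b + b^2 vanishes there, then a^3 = (-b)^3.
  Cubing is injective modulo p because 3 does not divide p - 1, so a = -b and the form becomes 3 *
  a^2, a contradiction.\<close>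

lemma inert_prime_dvd:
  assumes "prime p" "p mod 3 = 2" "int p dvd eis_norm k"
  shows "of_int (int p) dvd k"
proof -
  define a b where "a = ere k" and "b = eim k"
  have N: "int p dvd a ^ 2 - a * b + b ^ 2" using assms(3) by (simp add: eis_norm_def a_def b_def)
  have P: "prime (int p)" using assms(1) by simp
  have fermat: "[c ^ (p - 1) = 1] (mod int p)" if "\<not> int p dvd c" for c
    using fermat_theorem_int assms(1) that .
  have "int p dvd a \<and> int p dvd b"
  proof (cases "int p dvd a \<or> int p dvd b")
    case True
    then show ?thesis
    proof
      assume "int p dvd a"
      then have "int p dvd (a ^ 2 - a * b + b ^ 2) - a * (a - b)" using N by simp
      moreover have "(a ^ 2 - a * b + b ^ 2) - a * (a - b) = b ^ 2"
        by (simp add: power2_eq_square algebra_simps)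
      ultimately have "int p dvd b ^ 2" by simp
      then show ?thesis using P \<open>int p dvd a\<close> prime_dvd_power by blast
    next
      assume "int p dvd b"
      then have "int p dvd (a ^ 2 - a * b + b ^ 2) - b * (b - a)" using N by simp
      moreover have "(a ^ 2 - a * b + b ^ 2) - b * (b - a) = a ^ 2"
        by (simp add: power2_eq_square algebra_simps)
      ultimately have "int p dvd a ^ 2" by simp
      then show ?thesis using P \<open>int p dvd b\<close> prime_dvd_power by blast
    qed
  next
    case False
    define j where "j = p div 3"
    have p: "p - 1 = 3 * j + 1" using assms(2) unfolding j_def by presburger
    have "a ^ 3 - (- b) ^ 3 = (a + b) * (a ^ 2 - a * b + b ^ 2)"
      by (simp add: power2_eq_square power3_eq_cube algebra_simps)
    then have "[a ^ 3 = (- b) ^ 3] (mod int p)" using N by (simp add: cong_iff_dvd_diff)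
    then have "[(a ^ 3) ^ j = ((- b) ^ 3) ^ j] (mod int p)" by (rule cong_pow)
    then have 1: "[a ^ (3 * j) = (- b) ^ (3 * j)] (mod int p)" by (simp add: power_mult)
    have "[a ^ (p - 1) = (- b) ^ (p - 1)] (mod int p)"
      using fermat[of a] fermat[of "- b"] False cong_trans cong_sym by (metis dvd_minus_iff)
    then have "[a ^ (3 * j) * a = (- b) ^ (3 * j) * (- b)] (mod int p)"
      unfolding p power_add power_one_right .
    moreover have "[a ^ (3 * j) * (- b) = (- b) ^ (3 * j) * (- b)] (mod int p)"
      using 1 by (rule cong_scalar_right)
    ultimately have "[a ^ (3 * j) * a = a ^ (3 * j) * (- b)] (mod int p)"
      using cong_trans cong_sym by blast
    moreover have "coprime (a ^ (3 * j)) (int p)"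
      using False P prime_imp_coprime[of "int p" a] by (simp add: coprime_commute)
    ultimately have "[a = - b] (mod int p)" by (metis cong_mult_lcancel)
    then have "int p dvd a + b" by (simp add: cong_iff_dvd_diff)
    then have "int p dvd (a ^ 2 - a * b + b ^ 2) + (a + b) * (2 * a - b)" using N by simp
    moreover have "(a ^ 2 - a * b + b ^ 2) + (a + b) * (2 * a - b) = 3 * a ^ 2"
      by (simp add: power2_eq_square algebra_simps)
    ultimately have "int p dvd 3 * a ^ 2" by simp
    moreover have "\<not> int p dvd 3"
    proof
      assume "int p dvd 3"
      then have "p dvd 3" by presburger
      then have "p = 3" using assms(1) primes_dvd_imp_eq[of p 3] by simp
      then show False using assms(2) by simp
    qed
    ultimately have "int p dvd a" using P by (simp add: prime_dvd_mult_iff prime_dvd_power_iff)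
    then show ?thesis using False by simp
  qed
  then show ?thesis by (simp only: of_int_dvd_eis_iff a_def b_def)
qed

text \<open>Congruent to 1 or -1 modulo 3. Allowing both signs admits every rational integer prime
  to 3, as well as \<open>J\<close>, which is -1 modulo 3; the only units that qualify are 1 and
  -1.\<close>

definition primary :: "eis \<Rightarrow> bool" where "primary k \<longleftrightarrow> 3 dvd eim k \<and> \<not> 3 dvd ere k"

lemma primary_cnj: "primary k \<Longrightarrow> primary (eis_cnj k)"
  unfolding primary_def by simp presburger

lemma primary_factor:
  assumes "primary (x * y)" "primary x"
  shows "primary y"
proof -
  obtain u where u: "eim x = 3 * u" using assms(2) by (auto simp: primary_def)
  have e: "eim (x * y) = ere x * eim y + 3 * (u * ere y - u * eim y)"
    by (simp add: u algebra_simps)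
  have "3 dvd ere x * eim y" using assms(1) unfolding primary_def e by (simp add: dvd_add_left_iff)
  moreover have "prime (3::int)" by simp
  ultimately have y: "3 dvd eim y" using assms(2) prime_dvd_mult_iff[of "3::int"] by (auto simp: primary_def)
  moreover have "\<not> 3 dvd ere y"
  proof
    assume "3 dvd ere y"
    then have "3 dvd ere (x * y)" using y by simp
    then show False using assms(1) by (simp add: primary_def)
  qed
  ultimately show ?thesis by (simp add: primary_def)
qed

lemma not_3_dvd_eis_norm:
  assumes "primary k"
  shows "\<not> 3 dvd eis_norm k"
proof
  assume "3 dvd eis_norm k"
  moreover have "ere k ^ 2 = eis_norm k + eim k * (ere k - eim k)"
    by (simp add: eis_norm_def power2_eq_square algebra_simps)
  ultimately have "3 dvd ere k ^ 2" using assms by (simp add: primary_def)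
  moreover have "prime (3::int)" by simp
  ultimately have "3 dvd ere k" using prime_dvd_power by blast
  then show False using assms by (simp add: primary_def)
qed

text \<open>The symbol is assembled along a factorization of k, by induction on the norm. A split p
  contributes \<open>J\<close> or its conjugate with the character that produced \<open>J\<close>,
  an inert p contributes itself with the trivial symbol, and norm 1 leaves 1 or -1.\<close>

theorem cubic_char_exists:
  assumes "primary k"
  shows "\<exists>f. cubic_char k f"
  using assms
proof (induction "nat (eis_norm k)" arbitrary: k rule: less_induct)
  case less
  have "k \<noteq> 0" using less.prems by (auto simp: primary_def)
  then have pos: "eis_norm k > 0" using eis_norm_nonneg[of k] eis_norm_eq_0_iff[of k] by linarith
  have step: "\<exists>f. cubic_char k f"
    if x: "x dvd k" "primary x" "eis_norm x > 1" "cubic_char x g" for x g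
  proof -
    obtain y where y: "k = x * y" using x(1) by blast
    have ny: "eis_norm k = eis_norm x * eis_norm y" by (simp add: y eis_norm_mult)
    then have "eis_norm y > 0" using pos x(3) by (simp add: zero_less_mult_iff)
    then have "eis_norm y < eis_norm k" using ny x(3) by simp
    moreover have "primary y" using less.prems x(2) y primary_factor by blast
    ultimately obtain f where "cubic_char y f" using less.hyps[of y] pos by auto
    then show ?thesis using cubic_char_mult[OF x(4)] y by blast
  qed
  show ?case
  proof (cases "eis_norm k = 1")
    case True
    then have 4: "4 = (2 * ere k - eim k) ^ 2 + 3 * eim k ^ 2" using four_eis_norm[of k] by simp
    have "eim k = 0"
    proof (rule ccontr)
      assume "eim k \<noteq> 0"
      then have "\<bar>eim k\<bar> \<ge> 3" using less.prems zdvd_imp_le[of 3 "\<bar>eim k\<bar>"] by (simp add: primary_def)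
      then have "\<bar>eim k\<bar> ^ 2 \<ge> 3 ^ 2" by (intro power_mono) auto
      then have "eim k ^ 2 \<ge> 9" by simp
      then show False using 4 by (smt (verit) zero_le_power2)
    qed
    then have "k = of_int (ere k)" by (simp add: eis_eq_iff)
    then show ?thesis using cubic_char_of_int by metis
  next
    case False
    then obtain p' where p': "prime p'" "p' dvd nat (eis_norm k)"
      using prime_factor_nat[of "nat (eis_norm k)"] pos False
      by (metis nat_eq_iff2 nat_one_as_int of_nat_1 less_le)
    define p where "p = p'"
    have p: "prime p" "int p dvd eis_norm k"
      using p' pos int_dvd_int_iff[of p' "nat (eis_norm k)"] by (auto simp: p_def)
    have "p \<noteq> 3" using p not_3_dvd_eis_norm[OF less.prems] by auto
    then have "\<not> 3 dvd p" using p(1) primes_dvd_imp_eq[of 3 p] by auto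
    then consider "p mod 3 = 1" | "p mod 3 = 2" by (auto simp: dvd_eq_mod_eq_0) linarith
    then show ?thesis
    proof cases
      case 1
      obtain chi where "cubic_residue_character p chi"
        using cubic_residue_character_exists p(1) 1 by blast
      then interpret cubic_residue_character p chi .
      have "of_int 3 dvd J + 1" using J_cong by simp
      then have "primary J" unfolding of_int_dvd_eis_iff primary_def by simp presburger
      then have J: "primary J" "primary (eis_cnj J)" by (auto intro: primary_cnj)
      have "J dvd k \<or> eis_cnj J dvd k" using prime_norm_dvd p eis_norm_J by blast
      then show ?thesis
        using step[OF _ J(1) _ cubic_char_J] step[OF _ J(2) _ cubic_char_cnj[OF cubic_char_J]]
          p_gt_1 eis_norm_J by auto
    next
      case 2
      have "of_int (int p) dvd k" using inert_prime_dvd p 2 by blast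
      moreover have "primary (of_int (int p))"
        using \<open>\<not> 3 dvd p\<close> unfolding primary_def by simp presburger
      moreover have "eis_norm (of_int (int p)) > 1"
        using prime_gt_1_nat[OF p(1)] by (simp only: eis_norm_of_int) (simp add: one_less_power)
      ultimately show ?thesis using step cubic_char_of_int by blast
    qed
  qed
qed

section \<open>Values of the symbol at rational integers\<close>

lemma cubic_char_one: "cubic_char k f \<Longrightarrow> f 1 = 1"
proof -
  assume f: "cubic_char k f"
  have "f 1 \<in> mu3" using f by (rule cubic_charD) simp
  moreover have "f 1 * f 1 = f 1" using cubic_charD(1)[OF f, of 1 1] by simp
  ultimately show ?thesis using zero_notin_mu3 by auto
qed

lemma cubic_char_power: "cubic_char k f \<Longrightarrow> f (m ^ n) = f m ^ n"
  by (induction n) (simp_all add: cubic_char_one cubic_charD(1))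

lemma cubic_char_minus_one:
  assumes "cubic_char k f"
  shows "f (-1) = 1"
proof (rule mu3_power_eq_one)
  show "f (-1) \<in> mu3" using assms by (rule cubic_charD) simp
  show "f (-1) ^ 2 = 1"
    using cubic_char_power[OF assms, of "-1" 2] cubic_char_one[OF assms] by simp
qed simp

lemma cubic_char_eq_one:
  assumes f: "cubic_char k f" and m: "m \<noteq> 0"
    and primes: "\<And>q. prime q \<Longrightarrow> int q dvd m \<Longrightarrow> f (int q) = 1"
  shows "f m = 1"
proof -
  have "f (int n) = 1" if "n > 0" "\<And>q. prime q \<Longrightarrow> q dvd n \<Longrightarrow> f (int q) = 1" for n :: nat
    using that
  proof (induction n rule: less_induct)
    case (less n)
    show ?case
    proof (cases "n = 1")
      case False
      then obtain q where q: "prime q" "q dvd n" using prime_factor_nat by blast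
      then obtain r where r: "n = q * r" by blast
      have "r < n" "r > 0" using less.prems(1) r prime_gt_1_nat[OF q(1)] by auto
      then have "f (int r) = 1" using less r by auto
      then show ?thesis using less.prems(2) q r f by (simp add: cubic_charD(1))
    qed (simp add: cubic_char_one[OF f])
  qed
  from this[of "nat \<bar>m\<bar>"] m primes have "f \<bar>m\<bar> = 1" by auto
  moreover have "f (- m) = f m"
    using cubic_charD(1)[OF f, of "-1" m] cubic_char_minus_one[OF f] by simp
  ultimately show ?thesis by (cases "m \<ge> 0") auto
qed

text \<open>\<open>Eis (X + Y) (2 * Y)\<close> is \<open>X + Y * sqrt (-3)\<close>.\<close>

definition sqrt3 :: "int \<Rightarrow> int \<Rightarrow> eis" where "sqrt3 X Y = Eis (X + Y) (2 * Y)"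

lemma eis_norm_sqrt3: "eis_norm (sqrt3 X Y) = X ^ 2 + 3 * Y ^ 2"
  by (simp add: sqrt3_def eis_norm_def power2_eq_square algebra_simps)

lemma sqrt3_mult: "sqrt3 X Y * sqrt3 X' Y' = sqrt3 (X * X' - 3 * Y * Y') (X * Y' + Y * X')"
  by (simp add: sqrt3_def eis_eq_iff algebra_simps)

lemma primary_sqrt3:
  assumes "\<not> 3 dvd X" "3 dvd Y"
  shows "primary (sqrt3 X Y)"
  using assms by (simp add: sqrt3_def primary_def dvd_add_left_iff)

lemma cubic_residue_cong:
  assumes "of_int q dvd x - y"
  shows "of_int q dvd (x\<^sup>2 * eis_cnj x) ^ e - (y\<^sup>2 * eis_cnj y) ^ e"
proof (rule dvd_power_diff)
  have "eis_cnj (of_int q) dvd eis_cnj (x - y)" using assms by (rule eis_cnj_dvd)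
  then have "of_int q dvd eis_cnj x - eis_cnj y" by simp
  moreover have "of_int q dvd x ^ 2 - y ^ 2" using assms by (rule dvd_power_diff)
  moreover have "x\<^sup>2 * eis_cnj x - y\<^sup>2 * eis_cnj y =
      (x ^ 2 - y ^ 2) * eis_cnj x + y ^ 2 * (eis_cnj x - eis_cnj y)"
    by (simp add: algebra_simps)
  ultimately show "of_int q dvd x\<^sup>2 * eis_cnj x - y\<^sup>2 * eis_cnj y" by simp
qed

text \<open>Modulo \<open>q\<close> the element is a rational integer, possibly times \<open>sqrt (-3)\<close>, and the even
  power in the definition of the residue symbol (for odd \<open>q\<close>) makes the result rational.\<close>

lemma cubic_char_trivial_prime:
  assumes f: "cubic_char (sqrt3 X Y) f"
    and q: "prime q" "q \<noteq> 3" "\<not> int q dvd X ^ 2 + 3 * Y ^ 2"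
    and XY: "int q dvd X \<or> int q dvd Y \<or> q = 2"
  shows "f (int q) = 1"
proof -
  define e where "e = (q\<^sup>2 - 1) div 3"
  define k where "k = sqrt3 X Y"
  have r: "of_nat q dvd (k\<^sup>2 * eis_cnj k) ^ e - f (int q)"
    unfolding e_def k_def using f q by (intro cubic_charD(4)) (auto simp: eis_norm_sqrt3)
  have "\<exists>c. of_int (int q) dvd (k\<^sup>2 * eis_cnj k) ^ e - of_int c"
  proof (cases "int q dvd Y \<or> q = 2")
    case True
    \<comment> \<open>Since sqrt(-3) = 1 + 2 * \<open>omega\<close> is 1 modulo 2, the case q = 2
      gives the same rational representative as q dividing Y.\<close>
    then have "of_int (int q) dvd k - of_int (X + Y)"
      unfolding of_int_dvd_eis_iff by (auto simp: k_def sqrt3_def)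
    then have "of_int (int q) dvd (k\<^sup>2 * eis_cnj k) ^ e -
        ((of_int (X + Y))\<^sup>2 * eis_cnj (of_int (X + Y))) ^ e"
      by (rule cubic_residue_cong)
    then have "of_int (int q) dvd (k\<^sup>2 * eis_cnj k) ^ e - of_int (((X + Y)\<^sup>2 * (X + Y)) ^ e)"
      by (simp del: of_int_add)
    then show ?thesis by blast
  next
    case False
    have "odd q" using q(1) False prime_odd_nat prime_gt_1_nat[OF q(1)]
      by (metis le_neq_implies_less prime_ge_2_nat)
    then have "even (q\<^sup>2 - 1)" by simp
    then have "even (3 * e)" using square_minus_one_dvd[OF q(1,2)] by (simp add: e_def)
    then obtain j where j: "e = 2 * j" by auto
    have "int q dvd X" using XY False by blast
    then have "of_int (int q) dvd k - sqrt3 0 Y"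
      unfolding of_int_dvd_eis_iff by (auto simp: k_def sqrt3_def)
    then have "of_int (int q) dvd (k\<^sup>2 * eis_cnj k) ^ e - ((sqrt3 0 Y)\<^sup>2 * eis_cnj (sqrt3 0 Y)) ^ e"
      by (rule cubic_residue_cong)
    \<comment> \<open>For k = Y * sqrt(-3) the base k^2 * cnj k is 3 * Y^3 * sqrt(-3), whose square
      is rational.\<close>
    moreover have "((sqrt3 0 Y)\<^sup>2 * eis_cnj (sqrt3 0 Y))\<^sup>2 = of_int (- 27 * Y ^ 6)"
      by (simp add: eis_eq_iff sqrt3_def power2_eq_square eval_nat_numeral algebra_simps)
    ultimately have "of_int (int q) dvd (k\<^sup>2 * eis_cnj k) ^ e - of_int ((- 27 * Y ^ 6) ^ j)"
      by (simp only: j power_mult of_int_power)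
    then show ?thesis by blast
  qed
  then obtain c where c: "of_int (int q) dvd (k\<^sup>2 * eis_cnj k) ^ e - of_int c" by blast
  have "of_int (int q) dvd (k\<^sup>2 * eis_cnj k) ^ e - f (int q)" using r by simp
  then have "of_int (int q) dvd ((k\<^sup>2 * eis_cnj k) ^ e - f (int q)) - ((k\<^sup>2 * eis_cnj k) ^ e - of_int c)"
    using c by (rule dvd_diff)
  then have "of_int (int q) dvd of_int c - f (int q)" by simp
  moreover have "coprime (int q) (eis_norm (sqrt3 X Y))"
    using q by (intro prime_imp_coprime) (auto simp: eis_norm_sqrt3)
  then have "f (int q) \<in> mu3" by (rule cubic_charD(2)[OF f])
  moreover have "\<not> int q dvd 1" using prime_gt_1_nat[OF q(1)] by simp
  ultimately show ?thesis using mu3_eq_one_if_rational by blast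
qed

lemma coprime_3_eis_norm_sqrt3:
  assumes "\<not> 3 dvd X"
  shows "coprime 3 (eis_norm (sqrt3 X Y))"
proof -
  have "prime (3::int)" by simp
  then have "\<not> 3 dvd X ^ 2" using assms prime_dvd_power by blast
  then have "\<not> 3 dvd X ^ 2 + 3 * Y ^ 2" by (simp add: dvd_add_left_iff)
  then show ?thesis using \<open>prime (3::int)\<close> by (simp add: eis_norm_sqrt3 prime_imp_coprime)
qed

lemma prime_dvd_sum_squares:
  fixes X Y :: int
  assumes "prime q" "q \<noteq> 3" "coprime X Y" "int q dvd X ^ 2 + 3 * Y ^ 2" "int q dvd X \<or> int q dvd Y"
  shows False
proof -
  have P: "prime (int q)" using assms(1) by simp
  have "int q dvd X \<and> int q dvd Y"
    using assms(5)
  proof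
    assume X: "int q dvd X"
    then have "int q dvd 3 * Y ^ 2" using assms(4) by (simp add: dvd_add_right_iff power2_eq_square)
    moreover have "\<not> int q dvd 3"
    proof
      assume "int q dvd 3"
      then have "q dvd 3" by presburger
      then show False using assms(1,2) primes_dvd_imp_eq[of q 3] by simp
    qed
    ultimately show ?thesis using X P by (simp add: prime_dvd_mult_iff prime_dvd_power_iff)
  next
    assume Y: "int q dvd Y"
    then have "int q dvd X ^ 2" using assms(4) by (simp add: dvd_add_left_iff power2_eq_square)
    then show ?thesis using Y P by (simp add: prime_dvd_power_iff)
  qed
  then have "is_unit (int q)" using assms(3) coprime_common_divisor by blast
  then show False using prime_gt_1_nat[OF assms(1)] by simp
qed

text \<open>From \<open>X\<^sup>2 = - 3 * Y\<^sup>2\<close> modulo the norm, \<open>f 3 ^ (1 + 2 * multiplicity 3 Y) = 1\<close>.\<close>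

lemma cubic_char_three_aux:
  assumes f: "cubic_char (sqrt3 X Y) f" and XY: "coprime X Y" "\<not> 3 dvd X" "Y \<noteq> 0"
    and v: "multiplicity 3 Y mod 3 \<noteq> 1"
  shows "f 3 = 1"
proof -
  define v where "v = multiplicity 3 Y"
  obtain Y' where Y': "Y = 3 ^ v * Y'" and nY': "\<not> 3 dvd Y'"
    using multiplicity_decompose'[of Y 3] XY(3) unfolding v_def by auto
  have X: "f X = 1"
  proof (rule cubic_char_eq_one[OF f])
    show "X \<noteq> 0" using XY(2) by auto
    fix q assume q: "prime q" "int q dvd X"
    then have "q \<noteq> 3" using XY(2) by auto
    then show "f (int q) = 1"
      using q prime_dvd_sum_squares[OF q(1) _ XY(1)] by (intro cubic_char_trivial_prime[OF f]) auto
  qed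
  have Y: "f Y' = 1"
  proof (rule cubic_char_eq_one[OF f])
    show "Y' \<noteq> 0" using nY' by auto
    fix q assume q: "prime q" "int q dvd Y'"
    then have "q \<noteq> 3" "int q dvd Y" using nY' Y' by auto
    then show "f (int q) = 1"
      using q prime_dvd_sum_squares[OF q(1) _ XY(1)] by (intro cubic_char_trivial_prime[OF f]) auto
  qed
  have "[X ^ 2 = (-1) * (3 * (3 ^ v * Y') ^ 2)] (mod eis_norm (sqrt3 X Y))"
    by (simp add: cong_iff_dvd_diff eis_norm_sqrt3 Y')
  then have "f (X ^ 2) = f ((-1) * (3 * (3 ^ v * Y') ^ 2))" by (rule cubic_charD(3)[OF f])
  then have "f 3 * (f 3 ^ v) ^ 2 = 1"
    by (simp only: cubic_charD(1)[OF f] cubic_char_power[OF f] X Y cubic_char_minus_one[OF f]) simp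
  then have "f 3 ^ (1 + 2 * v) = 1"
    by (simp add: power_mult[symmetric] mult.commute)
  moreover have "f 3 \<in> mu3" using cubic_charD(2)[OF f] coprime_3_eis_norm_sqrt3 XY(2) by blast
  moreover have "\<not> 3 dvd 1 + 2 * v" using v unfolding v_def by presburger
  ultimately show ?thesis using mu3_power_eq_one by blast
qed

text \<open>The exceptional case \<open>multiplicity 3 Y mod 3 = 1\<close> is reduced to the previous lemma by
  multiplying with one of the elements \<open>8 + 9 * sqrt (-3)\<close> and \<open>8 - 9 * sqrt (-3)\<close>, whose norm is
  the prime \<open>307\<close>: the product then has \<open>multiplicity 3 Y = 2\<close>.\<close>

lemma cubic_char_three:
  assumes f: "cubic_char (sqrt3 X Y) f" and XY: "coprime X Y" "\<not> 3 dvd X" "9 dvd Y"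
  shows "f 3 = 1"
proof -
  have mult2: "multiplicity 3 Z = 2" if "9 dvd Z" "\<not> 27 dvd Z" for Z :: int
    using that by (intro multiplicity_eqI) (auto simp: numeral_eq_Suc)
  \<comment> \<open>Exact multiplicity 2 falls under the second case, so 9 dividing Y leaves only
    multiplicity at least 3. The third case contains the exceptional one.\<close>
  consider "Y = 0" | "Y \<noteq> 0" "multiplicity 3 Y mod 3 \<noteq> 1" | "Y \<noteq> 0" "27 dvd Y"
    using mult2[of Y] XY(3) by (cases "27 dvd Y") auto
  then show ?thesis
  proof cases
    case 1
    then have "\<bar>X\<bar> = 1" using XY(1) by simp
    then have "X ^ 2 = 1" by (metis power2_abs power_one)
    then have "[3 = 1] (mod eis_norm (sqrt3 X Y))" using 1 by (simp add: eis_norm_sqrt3)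
    then show ?thesis using cubic_charD(3)[OF f] cubic_char_one[OF f] by metis
  next
    case 2
    then show ?thesis using cubic_char_three_aux[OF f] XY by blast
  next
    case 3
    have P: "prime (307::int)" by simp
    \<comment> \<open>A common divisor of the new coordinates divides 307 = 64 + 243. The sign s
      keeps 307 itself from being one: were it bad for both signs, 307 would divide X and Y.\<close>
    have "\<exists>s. (s = 1 \<or> s = -1) \<and> \<not> 307 dvd (9 * s * X + 8 * Y)"
    proof (rule ccontr)
      assume "\<not> ?thesis"
      then have d: "307 dvd 9 * X + 8 * Y" "307 dvd - 9 * X + 8 * Y" by auto
      then have "307 dvd 18 * X" "307 dvd 16 * Y"
        using dvd_diff[OF d] dvd_add[OF d] by simp_all
      then have "(307::int) dvd 18 \<or> 307 dvd X" "(307::int) dvd 16 \<or> 307 dvd Y"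
        by (auto dest!: prime_dvd_multD[OF P])
      then have "307 dvd X" "307 dvd Y" by auto
      then have "is_unit (307::int)" using XY(1) coprime_common_divisor by blast
      then show False by simp
    qed
    then obtain s where s: "s = 1 \<or> s = -1" "\<not> 307 dvd (9 * s * X + 8 * Y)" by blast
    define l where "l = sqrt3 8 (9 * s)"
    define X' Y' where "X' = X * 8 - 3 * Y * (9 * s)" and "Y' = X * (9 * s) + Y * 8"
    have "primary l" unfolding l_def by (rule primary_sqrt3) auto
    then obtain g where g: "cubic_char l g" using cubic_char_exists by blast
    have h: "cubic_char (sqrt3 X' Y') (\<lambda>m. f m * g m)"
      using cubic_char_mult[OF f g] by (simp add: l_def sqrt3_mult X'_def Y'_def)
    have "g 3 = 1"
    proof (rule cubic_char_three_aux)
      show "cubic_char (sqrt3 8 (9 * s)) g" using g by (simp add: l_def)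
      have "multiplicity 3 (9 * s) = 2" using s(1) by (intro mult2) auto
      then show "multiplicity 3 (9 * s) mod 3 \<noteq> 1" by simp
      show "coprime 8 (9 * s)"
      proof (rule coprimeI)
        fix c :: int assume c: "c dvd 8" "c dvd 9 * s"
        then have "c dvd 9" using s(1) by auto
        then have "c dvd 9 - 8" using c(1) by (rule dvd_diff)
        then show "is_unit c" by simp
      qed
    qed (use s(1) in auto)
    moreover have "f 3 * g 3 = 1"
    proof (rule cubic_char_three_aux[OF h])
      have "\<not> 3 dvd s * X" using s(1) XY(2) by auto
      obtain t where t: "Y = 27 * t" using 3(2) by blast
      have Y': "Y' = 9 * (s * X + 24 * t)" by (simp add: Y'_def t)
      have "\<not> 3 dvd s * X + 24 * t"
        using \<open>\<not> 3 dvd s * X\<close> by (simp add: dvd_add_left_iff)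
      then have "\<not> 9 * 3 dvd Y'" unfolding Y' by (subst dvd_mult_cancel_left) simp
      then have "multiplicity 3 Y' = 2" using Y' by (intro mult2) simp_all
      then show "multiplicity 3 Y' mod 3 \<noteq> 1" and "Y' \<noteq> 0" by auto
      show "\<not> 3 dvd X'"
      proof
        assume "3 dvd X'"
        then have "3 dvd X' + 3 * (Y * (9 * s))" by simp
        moreover have "X' + 3 * (Y * (9 * s)) = 8 * X" by (simp add: X'_def)
        ultimately have "3 dvd 8 * X" by simp
        then show False using XY(2) by presburger
      qed
      have s2: "s * s = 1" using s(1) by auto
      show "coprime X' Y'"
      proof (rule coprimeI)
        fix c assume c: "c dvd X'" "c dvd Y'"
        have "8 * Y' - 9 * s * X' = Y * (64 + 243 * (s * s))" "8 * X' + 27 * s * Y' = X * (64 + 243 * (s * s))"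
          by (simp_all add: X'_def Y'_def algebra_simps)
        then have "c dvd 307 * Y" "c dvd 307 * X"
          using c by (metis (no_types, opaque_lifting) dvd_diff dvd_add dvd_mult s2 mult.commute mult.right_neutral
              numeral_plus_numeral add_num_simps numeral_eq_iff)+
        then have "c dvd gcd (307 * X) (307 * Y)" by simp
        also have "\<dots> = 307" using XY(1) by (simp add: gcd_mult_distrib_int[symmetric] coprime_iff_gcd_eq_1)
        finally have c307: "c dvd 307" .
        show "is_unit c"
        proof (rule ccontr)
          assume "\<not> is_unit c"
          then have "307 dvd c"
            using prime_imp_coprime[OF P, of c] c307 coprime_common_divisor[of 307 c c] dvd_refl[of c]
              \<open>\<not> is_unit c\<close> by metis
          then have "307 dvd Y'" using c(2) dvd_trans by blast
          then show False using s(2) by (simp add: Y'_def mult_ac)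
        qed
      qed
    qed
    ultimately show ?thesis by simp
  qed
qed

text \<open>\<open>cubic_char_three\<close> wants coprime coordinates. Their gcd g is prime to 3, so
  it can be split off with the character of \<open>cubic_char_of_int\<close>, which is 1 at
  3.\<close>

lemma cubic_char_sqrt3_exists:
  assumes "\<not> 3 dvd X" "9 dvd Y"
  shows "\<exists>f. cubic_char (sqrt3 X Y) f \<and> f 3 = 1"
proof -
  define g where "g = gcd X Y"
  have "X \<noteq> 0" using assms(1) by auto
  then obtain X0 Y0 where XY: "X = X0 * g" "Y = Y0 * g" "coprime X0 Y0"
    using gcd_coprime_exists[of X Y] unfolding g_def by auto
  have "\<not> 3 dvd X0" "\<not> 3 dvd g" using assms(1) XY by auto
  moreover have "coprime (3 ^ 2) g"
    using \<open>\<not> 3 dvd g\<close> prime_imp_coprime[of "3::int" g]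
    by (simp only: coprime_power_left_iff) simp
  then have "9 dvd Y0" using assms(2) XY(2) by (simp add: coprime_dvd_mult_left_iff)
  moreover from this have "3 dvd Y0" by presburger
  ultimately have "primary (sqrt3 X0 Y0)" by (intro primary_sqrt3)
  then obtain f where f: "cubic_char (sqrt3 X0 Y0) f" using cubic_char_exists by blast
  have "f 3 = 1" using cubic_char_three f XY(3) \<open>\<not> 3 dvd X0\<close> \<open>9 dvd Y0\<close> by blast
  moreover have "coprime 3 g" using \<open>\<not> 3 dvd g\<close> by (intro prime_imp_coprime) auto
  moreover have "sqrt3 X0 Y0 * of_int g = sqrt3 X Y"
    by (simp add: eis_eq_iff sqrt3_def XY algebra_simps)
  ultimately show ?thesis using cubic_char_mult[OF f cubic_char_of_int[of g]] by auto
qed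

lemma Eis_mult: "Eis a b * Eis c d = Eis (a * c - b * d) (a * d + b * c - b * d)"
  by (simp add: eis_eq_iff)

lemma eis_power_8: "(x::eis) ^ 8 = ((x * x) * (x * x)) * ((x * x) * (x * x))"
  by (simp add: eval_nat_numeral mult.assoc)

text \<open>As 5 is inert, the residue field has 25 elements and 8 = (25 - 1) / 3 is the exponent of
  the cubic symbol. The congruence says X = 2 * Y or X = -2 * Y modulo 5, which leaves eight pairs
  of residues to be computed.\<close>

lemma cubic_residue_5:
  assumes "[X ^ 2 = 4 * Y ^ 2] (mod 5)" "\<not> 5 dvd Y"
  shows "\<not> of_int 5 dvd ((sqrt3 X Y)\<^sup>2 * eis_cnj (sqrt3 X Y)) ^ 8 - 1"
proof
  define x y where "x = X mod 5" and "y = Y mod 5"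
  define k where "k = sqrt3 x y"
  define P where "P u v \<longleftrightarrow> of_int 5 dvd ((sqrt3 u v)\<^sup>2 * eis_cnj (sqrt3 u v)) ^ 8 - 1" for u v
  assume "of_int 5 dvd ((sqrt3 X Y)\<^sup>2 * eis_cnj (sqrt3 X Y)) ^ 8 - 1"
  moreover have "of_int 5 dvd sqrt3 x y - sqrt3 X Y"
    unfolding of_int_dvd_eis_iff by (simp add: sqrt3_def x_def y_def) presburger
  then have "of_int 5 dvd (k\<^sup>2 * eis_cnj k) ^ 8 - ((sqrt3 X Y)\<^sup>2 * eis_cnj (sqrt3 X Y)) ^ 8"
    unfolding k_def by (rule cubic_residue_cong)
  ultimately have "of_int 5 dvd ((k\<^sup>2 * eis_cnj k) ^ 8 - ((sqrt3 X Y)\<^sup>2 * eis_cnj (sqrt3 X Y)) ^ 8) +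
      (((sqrt3 X Y)\<^sup>2 * eis_cnj (sqrt3 X Y)) ^ 8 - 1)"
    by (intro dvd_add)
  then have d: "P x y" by (simp add: P_def k_def)
  have xy: "(x ^ 2) mod 5 = (4 * y ^ 2) mod 5"
    using assms(1) unfolding x_def y_def cong_def by (metis mod_mult_right_eq power_mod)
  have "x \<in> {0,1,2,3,4}" "y \<in> {1,2,3,4}"
    using assms(2) by (auto simp: x_def y_def) presburger+
  then have "(x, y) \<in> {(2,1),(3,1),(4,2),(1,2),(1,3),(4,3),(2,4),(3,4)}"
    using xy by (elim insertE emptyE) simp_all
  moreover have "\<not> P 2 1" "\<not> P 3 1" "\<not> P 4 2" "\<not> P 1 2" "\<not> P 1 3" "\<not> P 4 3" "\<not> P 2 4" "\<not> P 3 4"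
    unfolding P_def of_int_dvd_eis_iff eis_power_8 power2_eq_square
    by (simp_all add: sqrt3_def eis_cnj_def Eis_mult)
  ultimately show False using d by auto
qed

text \<open>The substitute for Artin reciprocity: the cubic residue symbol of \<open>5 ^ h\<close> modulo
  \<open>X + Y * B * sqrt (-3)\<close> would have to be both trivial and nontrivial.\<close>

lemma norm_equation_impossible:
  fixes X Y F B c s :: int and h :: nat
  assumes eq: "X ^ 2 + 3 * (Y * B) ^ 2 = 3 * Y ^ 2 * c ^ 3 + s * F ^ 2 * 5 ^ h"
    and s: "s = 1 \<or> s = -1" and h: "h > 0" "\<not> 3 dvd h"
    and B: "9 dvd B" "[B = 1] (mod 5)" and c: "[c = -1] (mod 5)"
    and F: "\<not> 3 dvd F" "\<not> 5 dvd F" "coprime F c" "coprime F Y" and Y: "\<not> 5 dvd Y"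
    and FX: "\<And>q. prime q \<Longrightarrow> int q dvd F \<Longrightarrow> q \<noteq> 2 \<Longrightarrow> int q dvd X"
  shows False
proof -
  have P3: "prime (3::int)" and P5: "prime (5::int)" by simp_all
  define N where "N = X ^ 2 + 3 * (Y * B) ^ 2"
  have c5: "\<not> 5 dvd c" using c by (auto simp: cong_def dvd_eq_mod_eq_0)
  have X3: "\<not> 3 dvd X"
  proof
    assume "3 dvd X"
    then have "3 dvd X ^ 2 + 3 * (Y * B) ^ 2 - 3 * Y ^ 2 * c ^ 3" by (simp add: power2_eq_square)
    then have "3 dvd s * F ^ 2 * 5 ^ h" using eq by simp
    moreover have "\<not> 3 dvd (5::int)" by simp
    moreover have "\<not> 3 dvd s" using s by auto
    ultimately show False using F(1) P3 by (simp add: prime_dvd_mult_iff prime_dvd_power_iff h)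
  qed
  have "9 dvd Y * B" using B(1) by simp
  then obtain f where f: "cubic_char (sqrt3 X (Y * B)) f" and f3: "f 3 = 1"
    using cubic_char_sqrt3_exists[OF X3] by blast
  have N: "eis_norm (sqrt3 X (Y * B)) = N" by (simp add: eis_norm_sqrt3 N_def)
  have NY: "\<not> q dvd N" if "prime q" "q dvd F" for q :: int
  proof
    assume "q dvd N"
    moreover have "q dvd s * F ^ 2 * 5 ^ h" using that(2) by (simp add: power2_eq_square)
    ultimately have "q dvd N - s * F ^ 2 * 5 ^ h" by (rule dvd_diff)
    then have "q dvd 3 * Y ^ 2 * c ^ 3" using eq by (simp add: N_def)
    then have "q dvd 3 \<or> q dvd Y \<or> q dvd c"
      using that(1) by (simp add: prime_dvd_mult_iff prime_dvd_power_iff)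
    moreover have "\<not> q dvd 3"
      using that F(1) P3 by (metis primes_dvd_imp_eq)
    ultimately show False using that F(3,4) coprime_common_divisor not_prime_unit by blast
  qed
  \<comment> \<open>Here 5 must be excluded because of the factor 5^h; it divides neither Y nor c
    anyway.\<close>
  have NF: "\<not> q dvd N" if "prime q" "q dvd Y \<or> q dvd c" "q \<noteq> 5" for q :: int
  proof
    assume "q dvd N"
    moreover have "q dvd 3 * Y ^ 2 * c ^ 3" using that(2) by (auto simp: power2_eq_square power3_eq_cube)
    ultimately have "q dvd N - 3 * Y ^ 2 * c ^ 3" by (rule dvd_diff)
    then have "q dvd s * F ^ 2 * 5 ^ h" using eq by (simp add: N_def)
    moreover have "\<not> q dvd s" using s that(1) by auto
    moreover have "\<not> q dvd 5" using that P5 by (metis primes_dvd_imp_eq)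
    ultimately have "q dvd F"
      using that(1) h by (simp add: prime_dvd_mult_iff prime_dvd_power_iff)
    then show False using that F(3,4) coprime_common_divisor not_prime_unit by blast
  qed
  have N5: "\<not> 5 dvd N"
  proof
    assume "5 dvd N"
    moreover have "5 dvd s * F ^ 2 * 5 ^ h" using h(1) by (simp add: dvd_power)
    ultimately have "5 dvd N - s * F ^ 2 * 5 ^ h" by (rule dvd_diff)
    then have "5 dvd 3 * Y ^ 2 * c ^ 3" using eq by (simp add: N_def)
    then show False using c5 Y P5 by (simp add: prime_dvd_mult_iff prime_dvd_power_iff)
  qed
  have fF: "f F = 1"
  proof (rule cubic_char_eq_one[OF f])
    show "F \<noteq> 0" using F(1) by auto
    fix q assume q: "prime q" "int q dvd F"
    then have "q \<noteq> 3" using F(1) by auto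
    then show "f (int q) = 1"
      using q NY[of "int q"] FX[of q] by (intro cubic_char_trivial_prime[OF f]) (auto simp: N_def)
  qed
  have fY: "f Y = 1"
  proof (rule cubic_char_eq_one[OF f])
    show "Y \<noteq> 0" using Y by auto
    fix q assume q: "prime q" "int q dvd Y"
    show "f (int q) = 1"
    proof (cases "q = 3")
      case False
      have "int q \<noteq> 5" using q Y by auto
      then show ?thesis
        using q False NF[of "int q"] by (intro cubic_char_trivial_prime[OF f]) (auto simp: N_def)
    qed (use f3 in simp)
  qed
  have fc: "f c ^ 3 = 1"
  proof -
    have "coprime c N"
    proof (rule ccontr)
      assume "\<not> coprime c N"
      then have "\<not> is_unit (gcd c N)" by (simp add: coprime_iff_gcd_eq_1)
      moreover have "gcd c N \<noteq> 0" using c5 by auto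
      ultimately obtain q :: int where "prime q" "q dvd gcd c N" using prime_divisorE by blast
      then show False using NF[of q] c5 by auto
    qed
    then show ?thesis using cubic_charD(2)[OF f] N mu3_cube by simp
  qed
  have fs: "f s = 1" using s cubic_char_one[OF f] cubic_char_minus_one[OF f] by auto
  \<comment> \<open>The two summands of the norm are opposite modulo N. Applying \<open>f\<close>
    removes s, F, 3, Y and -1, and the cube of c has value 1, so only f(5)^h remains.\<close>
  have "[s * (F ^ 2 * 5 ^ h) = (-1) * (3 * (Y ^ 2 * c ^ 3))] (mod N)"
  proof -
    have "s * (F ^ 2 * 5 ^ h) - (-1) * (3 * (Y ^ 2 * c ^ 3)) = N"
      using eq by (simp add: N_def)
    then show ?thesis by (simp add: cong_iff_dvd_diff)
  qed
  then have "f (s * (F ^ 2 * 5 ^ h)) = f ((-1) * (3 * (Y ^ 2 * c ^ 3)))"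
    using cubic_charD(3)[OF f] N by simp
  then have "f 5 ^ h = 1"
    by (simp only: cubic_charD(1)[OF f] cubic_char_power[OF f] fF fY fc fs f3 cubic_char_minus_one[OF f]
        power_one mult_1 mult_1_right)
  moreover have "f 5 \<in> mu3"
    using cubic_charD(2)[OF f] N N5 P5 by (simp add: prime_imp_coprime)
  ultimately have f5: "f 5 = 1" using h(2) mu3_power_eq_one by blast
  have "of_nat 5 dvd ((sqrt3 X (Y * B))\<^sup>2 * eis_cnj (sqrt3 X (Y * B))) ^ ((5\<^sup>2 - 1) div 3) - f (int 5)"
    using N5 N by (intro cubic_charD(4)[OF f]) auto
  then have "of_int 5 dvd ((sqrt3 X (Y * B))\<^sup>2 * eis_cnj (sqrt3 X (Y * B))) ^ 8 - 1"
    by (simp add: f5)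
  moreover have "[X ^ 2 = 4 * (Y * B) ^ 2] (mod 5)"
  proof -
    have B5: "[(Y * B) ^ 2 = (Y * 1) ^ 2] (mod 5)" by (intro cong_pow cong_mult B(2) cong_refl)
    have c3: "[c ^ 3 = (-1) ^ 3] (mod 5)" by (intro cong_pow c)
    have e: "X ^ 2 = 3 * Y ^ 2 * c ^ 3 + s * F ^ 2 * 5 ^ h - 3 * (Y * B) ^ 2"
      using eq by simp
    \<comment> \<open>With c^3 = -1 and B = 1 modulo 5 the right-hand side is -6 * Y^2, that is 4 *
      Y^2.\<close>
    have "[3 * Y ^ 2 * c ^ 3 + s * F ^ 2 * 5 ^ h - 3 * (Y * B) ^ 2 = 3 * Y ^ 2 * (-1) ^ 3 + 0 - 3 * (Y * 1) ^ 2] (mod 5)"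
      by (intro cong_diff cong_add cong_mult cong_refl B5 c3)
        (use h(1) in \<open>simp add: cong_0_iff dvd_power\<close>)
    then have "[X ^ 2 = - 6 * Y ^ 2] (mod 5)" unfolding e by simp
    moreover have "[- 6 * Y ^ 2 = 4 * (Y * B) ^ 2] (mod 5)"
    proof -
      have "[- 6 * Y ^ 2 = 4 * Y ^ 2] (mod 5)" by (simp add: cong_iff_dvd_diff)
      moreover have "[4 * Y ^ 2 = 4 * (Y * B) ^ 2] (mod 5)"
        using B5 by (intro cong_scalar_left) (simp add: cong_sym)
      ultimately show ?thesis by (rule cong_trans)
    qed
    ultimately show ?thesis by (rule cong_trans)
  qed
  moreover have "\<not> 5 dvd Y * B"
  proof -
    have "\<not> 5 dvd B" using B(2) by (auto simp: cong_def dvd_eq_mod_eq_0)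
    then show ?thesis using Y P5 by (simp add: prime_dvd_mult_iff)
  qed
  ultimately show False using cubic_residue_5 by blast
qed

section \<open>Ideals of quadratic number fields\<close>

text \<open>Gauss's lemma. Pseudo-dividing a monic integer polynomial P with root x by the primitive
  multiple m of the quadratic leaves a remainder of degree at most 1, which is 0 because x is
  irrational. Then m divides P over the integers, so its leading coefficient is 1 or -1.\<close>

lemma monic_int_quadratic_coeffs:
  fixes x :: "'a :: field_char_0"
  assumes x: "algebraic_int x" "x \<notin> \<rat>" and root: "x ^ 2 + of_rat b * x + of_rat c = 0"
  shows "b \<in> \<int>" "c \<in> \<int>"
proof -
  obtain P :: "int poly" where P: "poly (map_poly of_int P) x = 0" "lead_coeff P = 1"
    using x(1) by (auto simp: algebraic_int_altdef_ipoly)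
  obtain b1 b2 c1 c2 where bc: "b = of_int b1 / of_int b2" "b2 > 0" "c = of_int c1 / of_int c2" "c2 > 0"
    by (metis quotient_of_div quotient_of_denom_pos surj_pair)
  define m0 :: "int poly" where "m0 = [: b2 * c1, b1 * c2, b2 * c2 :]"
  define m where "m = primitive_part m0"
  define e where "e = content m0"
  have "m0 \<noteq> 0" using bc by (simp add: m0_def)
  then have m: "content m = 1" "m0 = smult e m" "e \<noteq> 0"
    by (simp_all add: m_def e_def)
  then have deg: "degree m = 2"
    using bc by (metis degree_smult_eq m0_def degree_pCons_eq_if mult_eq_0_iff less_irrefl pCons_eq_0_iff
        numeral_2_eq_2 degree_0 one_add_one plus_1_eq_Suc)
  have ipoly_smult: "poly (map_poly of_int (smult k p)) y = of_int k * poly (map_poly of_int p) y"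
    for k p and y :: 'a
    by (simp add: map_poly_smult)
  have bc': "of_rat b = (of_int b1 / of_int b2 :: 'a)" "of_rat c = (of_int c1 / of_int c2 :: 'a)"
    by (simp_all add: bc of_rat_divide)
  have ipoly_add: "poly (map_poly of_int (p + p')) y = poly (map_poly of_int p) y + poly (map_poly of_int p') y"
    for p p' and y :: 'a
    by (induction p p' rule: poly_induct2) (simp_all add: map_poly_pCons algebra_simps)
  have ipoly_mult: "poly (map_poly of_int (p * p')) y = poly (map_poly of_int p) y * poly (map_poly of_int p') y"
    for p p' and y :: 'a
    by (induction p) (simp_all add: map_poly_pCons ipoly_add ipoly_smult algebra_simps)
  have "poly (map_poly of_int m0) x = of_int (b2 * c2) * (x ^ 2 + of_rat b * x + of_rat c)"
    using bc(2,4) unfolding bc'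
    by (simp add: m0_def map_poly_pCons power2_eq_square) (simp add: field_simps)
  then have mx: "poly (map_poly of_int m) x = 0"
    using root m(2,3) ipoly_smult[of e m x] by simp
  obtain q r where qr: "pseudo_divmod P m = (q, r)" by fastforce
  define k where "k = coeff m (degree m) ^ (Suc (degree P) - degree m)"
  have "m \<noteq> 0" using deg by auto
  then have eq: "smult k P = m * q + r" and r: "r = 0 \<or> degree r < 2" and k: "k \<noteq> 0"
    using pseudo_divmod[OF _ qr] deg leading_coeff_neq_0[of m] unfolding k_def by auto
  have "poly (map_poly of_int (m * q + r)) x = 0"
    using P(1) ipoly_smult[of k P x] eq by simp
  then have rx: "poly (map_poly of_int r) x = 0"
    using mx by (simp add: ipoly_add ipoly_mult)
  have "r = [: coeff r 0, coeff r 1 :]"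
    using r by (intro poly_eqI) (auto simp: coeff_pCons coeff_eq_0 split: nat.splits)
  then have r01: "of_int (coeff r 0) + x * of_int (coeff r 1) = 0"
    using rx by (metis (no_types, lifting) map_poly_pCons of_int_0 poly_0 poly_pCons map_poly_0 mult_zero_right add.right_neutral)
  have "coeff r 1 = 0"
  proof (rule ccontr)
    assume "coeff r 1 \<noteq> 0"
    then have "x = - of_int (coeff r 0) / of_int (coeff r 1)"
      using r01 by (simp add: field_simps eq_neg_iff_add_eq_0)
    then show False using x(2) by simp
  qed
  then have "r = 0" using r01 \<open>r = [: coeff r 0, coeff r 1 :]\<close> by simp
  then have "fract_poly m dvd smult (to_fract k) (fract_poly P)"
    using eq fract_poly_dvd[of m "smult k P"] unfolding fract_poly_smult by simp
  then have "fract_poly m dvd fract_poly P" using k by (simp add: dvd_smult_iff)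
  then have "m dvd P" using m(1) by (rule fract_poly_dvdD)
  then have "lead_coeff m dvd 1" using P(2) by (metis dvdE dvd_triv_left lead_coeff_mult)
  then have "coeff m 2 = 1 \<or> coeff m 2 = -1" using deg by auto
  moreover have "coeff m0 i = e * coeff m i" for i using m(2) by simp
  from this[of 2] this[of 1] this[of 0] have
    "b2 * c2 = e * coeff m 2" "b1 * c2 = e * coeff m 1" "b2 * c1 = e * coeff m 0"
    by (simp_all add: m0_def numeral_2_eq_2)
  ultimately have "b1 * c2 = (coeff m 1 * coeff m 2) * (b2 * c2)"
    "b2 * c1 = (coeff m 0 * coeff m 2) * (b2 * c2)"
    by auto
  then have "b1 = coeff m 1 * coeff m 2 * b2" "c1 = coeff m 0 * coeff m 2 * c2"
    using bc(2,4) by auto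
  then have "b = of_int (coeff m 1 * coeff m 2)" "c = of_int (coeff m 0 * coeff m 2)"
    using bc by auto
  then show "b \<in> \<int>" "c \<in> \<int>" by simp_all
qed

lemma int_subgroup_generator:
  fixes A :: "int set"
  assumes "0 \<in> A" "\<And>x y. x \<in> A \<Longrightarrow> y \<in> A \<Longrightarrow> x - y \<in> A"
  shows "\<exists>g\<in>A. \<forall>a\<in>A. g dvd a"
proof (cases "A = {0}")
  case False
  have neg: "- x \<in> A" if "x \<in> A" for x using assms(2)[OF assms(1) that] by simp
  then have add: "x + y \<in> A" if "x \<in> A" "y \<in> A" for x y using assms(2)[of x "- y"] that by simp
  obtain a where a: "a \<in> A" "a \<noteq> 0" using False assms(1) by blast
  define Q where "Q n \<longleftrightarrow> n > 0 \<and> int n \<in> A" for n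
  have "Q (nat \<bar>a\<bar>)" using a neg[of a] by (auto simp: Q_def abs_if)
  define n where "n = (LEAST n. Q n)"
  have n: "n > 0" "int n \<in> A" using LeastI[of Q, OF \<open>Q (nat \<bar>a\<bar>)\<close>] by (auto simp: n_def Q_def)
  have mult: "int n * int k \<in> A" for k
  proof (induction k)
    case (Suc k)
    then show ?case using add[OF n(2) Suc.IH] by (simp add: algebra_simps)
  qed (simp add: assms(1))
  have mult': "int n * k \<in> A" for k
    using mult[of "nat k"] neg[OF mult[of "nat (- k)"]] by (cases "k \<ge> 0") auto
  have "int n dvd x" if "x \<in> A" for x
  proof (rule ccontr)
    assume nd: "\<not> int n dvd x"
    have "x mod int n = x - int n * (x div int n)" by (simp add: minus_mult_div_eq_mod)
    then have "x mod int n \<in> A" using assms(2)[OF that mult'] by simp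
    moreover have "x mod int n > 0"
      using nd n(1) pos_mod_sign[of "int n" x] unfolding dvd_eq_mod_eq_0 by linarith
    ultimately have "Q (nat (x mod int n))" by (simp add: Q_def)
    then have "n \<le> nat (x mod int n)" unfolding n_def by (rule Least_le)
    then have "int n \<le> x mod int n" using n(1) by (simp add: le_nat_iff)
    moreover have "x mod int n < int n" using n(1) by simp
    ultimately show False by linarith
  qed
  then show ?thesis using n(2) by blast
qed (use assms in auto)

section \<open>Products of sets of complex numbers as ideals\<close>

lemma ideal_mult_mem: "x \<in> I \<Longrightarrow> y \<in> J \<Longrightarrow> x * y \<in> ideal_mult I J"
  unfolding ideal_mult_def
  by (rule CollectI, rule exI[of _ "1::nat"], rule exI[of _ "\<lambda>_. x"], rule exI[of _ "\<lambda>_. y"]) simp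

lemma ideal_mult_0: "0 \<in> ideal_mult I J"
  unfolding ideal_mult_def by (rule CollectI, rule exI[of _ "0::nat"]) simp

lemma ideal_mult_add:
  assumes "a \<in> ideal_mult I J" "b \<in> ideal_mult I J"
  shows "a + b \<in> ideal_mult I J"
proof -
  obtain k :: nat and x y where a: "a = (\<Sum>i<k. x i * y i)" "\<forall>i<k. x i \<in> I \<and> y i \<in> J"
    using assms(1) unfolding ideal_mult_def by blast
  obtain l :: nat and u v where b: "b = (\<Sum>i<l. u i * v i)" "\<forall>i<l. u i \<in> I \<and> v i \<in> J"
    using assms(2) unfolding ideal_mult_def by blast
  define x' y' where "x' i = (if i < k then x i else u (i - k))"
    and "y' i = (if i < k then y i else v (i - k))" for i
  have "(\<Sum>i<k+l. x' i * y' i) = (\<Sum>i<k. x' i * y' i) + (\<Sum>i<l. x' (k + i) * y' (k + i))"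
    by (induction l) (simp_all add: add.assoc)
  also have "\<dots> = a + b" by (simp add: a(1) b(1) x'_def y'_def)
  finally have "a + b = (\<Sum>i<k+l. x' i * y' i)" by simp
  moreover have "\<forall>i<k+l. x' i \<in> I \<and> y' i \<in> J" using a(2) b(2) by (auto simp: x'_def y'_def)
  ultimately show ?thesis unfolding ideal_mult_def by blast
qed

text \<open>The induction rule for \<open>ideal_mult\<close>: inclusions below are derived from it
  instead of from indexed sums.\<close>

lemma ideal_mult_least:
  assumes "0 \<in> S" "\<And>a b. a \<in> S \<Longrightarrow> b \<in> S \<Longrightarrow> a + b \<in> S"
    and "\<And>x y. x \<in> I \<Longrightarrow> y \<in> J \<Longrightarrow> x * y \<in> S"
  shows "ideal_mult I J \<subseteq> S"
proof
  fix a assume "a \<in> ideal_mult I J"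
  then obtain k :: nat and x y where a: "a = (\<Sum>i<k. x i * y i)" "\<forall>i<k. x i \<in> I \<and> y i \<in> J"
    unfolding ideal_mult_def by blast
  have "(\<Sum>i<j. x i * y i) \<in> S" if "j \<le> k" for j
    using that by (induction j) (use a(2) assms in auto)
  then show "a \<in> S" using a(1) by blast
qed

lemma ideal_mult_commute: "ideal_mult I J = ideal_mult J I"
  by (intro antisym ideal_mult_least) (auto simp: ideal_mult_0 ideal_mult_add mult.commute ideal_mult_mem
      intro: ideal_mult_mem[of _ _ _ _, THEN subst[of "_ * _" _ "\<lambda>x. x \<in> _", OF mult.commute]])

lemma ideal_mult_scale:
  assumes "z \<in> ideal_mult I J" "\<And>x. x \<in> I \<Longrightarrow> r * x \<in> I'"
  shows "r * z \<in> ideal_mult I' J"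
proof -
  have "ideal_mult I J \<subseteq> {z. r * z \<in> ideal_mult I' J}"
    by (rule ideal_mult_least)
      (auto simp: ideal_mult_0 distrib_left mult.assoc[symmetric] intro: ideal_mult_add ideal_mult_mem assms(2))
  then show ?thesis using assms(1) by blast
qed

lemma ideal_mult_assoc_subset: "ideal_mult (ideal_mult I J) L \<subseteq> ideal_mult I (ideal_mult J L)"
proof (rule ideal_mult_least)
  fix z l assume "z \<in> ideal_mult I J" and l: "l \<in> L"
  moreover have "ideal_mult I J \<subseteq> {z. z * l \<in> ideal_mult I (ideal_mult J L)}"
    by (rule ideal_mult_least)
      (auto simp: ideal_mult_0 distrib_right mult.assoc intro: ideal_mult_add ideal_mult_mem l)
  ultimately show "z * l \<in> ideal_mult I (ideal_mult J L)" by blast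
qed (auto simp: ideal_mult_0 ideal_mult_add)

lemma ideal_mult_assoc: "ideal_mult (ideal_mult I J) L = ideal_mult I (ideal_mult J L)"
proof (rule antisym[OF ideal_mult_assoc_subset])
  have "ideal_mult I (ideal_mult J L) = ideal_mult (ideal_mult L J) I"
    by (metis ideal_mult_commute)
  also have "\<dots> \<subseteq> ideal_mult L (ideal_mult J I)" by (rule ideal_mult_assoc_subset)
  also have "\<dots> = ideal_mult (ideal_mult I J) L" by (metis ideal_mult_commute)
  finally show "ideal_mult I (ideal_mult J L) \<subseteq> ideal_mult (ideal_mult I J) L" .
qed

section \<open>Elements and integers of a quadratic field\<close>

locale quadratic_number_field =
  fixes D :: int
  assumes not_square: "\<And>r :: rat. r ^ 2 \<noteq> of_int D"
begin

definition root :: complex where "root = csqrt (of_int D)"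

definition el :: "rat \<Rightarrow> rat \<Rightarrow> complex" where "el u v = of_rat u + of_rat v * root"

abbreviation K :: "complex set" where "K \<equiv> quadratic_field D"

abbreviation OK :: "complex set" where "OK \<equiv> ring_of_integers K"

lemma root_square: "root * root = of_int D"
  by (simp add: root_def power2_eq_square [symmetric])

lemma D_nonzero: "D \<noteq> 0"
  using not_square[of 0] by auto

lemma K_eq: "K = {el u v | u v. True}"
  by (simp add: quadratic_field_def el_def root_def)

lemma el_in_K [simp]: "el u v \<in> K"
  by (auto simp: K_eq)

lemma el_add: "el u v + el u' v' = el (u + u') (v + v')"
  by (simp add: el_def of_rat_add algebra_simps)

lemma el_diff: "el u v - el u' v' = el (u - u') (v - v')"
  by (simp add: el_def of_rat_diff algebra_simps)

lemma el_mult: "el u v * el u' v' = el (u * u' + of_int D * v * v') (u * v' + v * u')"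
proof -
  have "el u v * el u' v' = of_rat u * of_rat u' + (root * root) * (of_rat v * of_rat v') +
      (of_rat u * of_rat v' + of_rat v * of_rat u') * root"
    by (simp add: el_def algebra_simps)
  then show ?thesis unfolding root_square by (simp add: el_def of_rat_add of_rat_mult mult_ac)
qed

lemma el_rat: "el u 0 = of_rat u"
  by (simp add: el_def)

lemma el_zero: "el 0 0 = 0" and el_one: "el 1 0 = 1"
  by (simp_all add: el_def)

lemma el_eq_0_iff: "el u v = 0 \<longleftrightarrow> u = 0 \<and> v = 0"
proof
  assume "el u v = 0"
  then have eq: "of_rat u = - (of_rat v * root)" by (simp add: el_def eq_neg_iff_add_eq_0)
  have "of_rat (u ^ 2) = (of_rat u) ^ 2" by (simp add: of_rat_power)
  also have "\<dots> = (of_rat v) ^ 2 * (root * root)" unfolding eq by (simp add: power2_eq_square mult_ac)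
  also have "\<dots> = of_rat (v ^ 2 * of_int D)" unfolding root_square by (simp add: of_rat_mult of_rat_power)
  finally have "u ^ 2 = v ^ 2 * of_int D" by (simp only: of_rat_eq_iff)
  then have "(u / v) ^ 2 = of_int D" if "v \<noteq> 0" using that by (simp add: power_divide)
  then have "v = 0" using not_square by blast
  then show "u = 0 \<and> v = 0" using eq by simp
qed (simp add: el_zero)

lemma el_eq_iff: "el u v = el u' v' \<longleftrightarrow> u = u' \<and> v = v'"
  using el_eq_0_iff[of "u - u'" "v - v'"] by (simp add: el_diff[symmetric])

text \<open>The nontrivial automorphism of \<open>K\<close>, which for positive D is not complex
  conjugation. By \<open>el_eq_iff\<close> the choice is forced on \<open>K\<close>; outside
  \<open>K\<close> the value is arbitrary.\<close>

definition cj :: "complex \<Rightarrow> complex" where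
  "cj x = (let p = (SOME p. x = el (fst p) (snd p)) in el (fst p) (- snd p))"

lemma cj_el [simp]: "cj (el u v) = el u (- v)"
proof -
  have "\<exists>p. el u v = el (fst p) (snd p)" by (rule exI[of _ "(u, v)"]) simp
  then have "el u v = el (fst (SOME p. el u v = el (fst p) (snd p))) (snd (SOME p. el u v = el (fst p) (snd p)))"
    by (rule someI_ex)
  then show ?thesis by (simp add: cj_def Let_def el_eq_iff)
qed

lemma K_cases: assumes "x \<in> K" obtains u v where "x = el u v"
  using assms by (auto simp: K_eq)

lemma K_closed:
  assumes "x \<in> K" "y \<in> K"
  shows "x + y \<in> K" "x - y \<in> K" "x * y \<in> K" "cj x \<in> K"
  using assms by (auto elim!: K_cases simp: el_add el_diff el_mult)

lemma of_rat_in_K [simp]: "of_rat r \<in> K" and of_int_in_K [simp]: "of_int k \<in> K"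
  and zero_in_K [simp]: "0 \<in> K" and one_in_K [simp]: "1 \<in> K"
  using el_in_K[of r 0] el_in_K[of "of_int k" 0] el_in_K[of 0 0] el_in_K[of 1 0]
  by (simp_all only: el_rat of_rat_of_int_eq of_rat_0 of_rat_1)

lemma K_inverse: assumes "x \<in> K" shows "inverse x \<in> K"
proof (cases "x = 0")
  case False
  obtain u v where x: "x = el u v" using assms K_cases by blast
  define n where "n = u ^ 2 - of_int D * v ^ 2"
  have xc: "el u v * el u (- v) = of_rat n"
    by (simp add: el_mult n_def power2_eq_square el_rat[symmetric] mult.assoc)
  have "el u (- v) \<noteq> 0" using False by (simp add: x el_eq_0_iff)
  then have "n \<noteq> 0" using xc False x by auto
  then have "el u v * (el (1 / n) 0 * el u (- v)) = 1"
    using xc by (simp add: mult_ac el_rat of_rat_divide)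
  then have "inverse x = el (1 / n) 0 * el u (- v)"
    unfolding x by (rule inverse_unique)
  then show ?thesis by (simp add: el_mult)
qed simp

lemma cj_hom:
  assumes "x \<in> K" "y \<in> K"
  shows "cj (x + y) = cj x + cj y" "cj (x * y) = cj x * cj y" "cj (cj x) = x"
  using assms by (auto elim!: K_cases simp: el_add el_mult el_eq_iff)

lemma cj_rat [simp]: "cj (of_rat r) = of_rat r" "cj (of_int k) = of_int k" "cj 0 = 0"
  using cj_el[of r 0] cj_el[of "of_int k" 0] cj_el[of 0 0]
  by (simp_all only: el_rat of_rat_of_int_eq of_rat_0 minus_zero)

lemma el_mult_cj: "el u v * cj (el u v) = of_rat (u ^ 2 - of_int D * v ^ 2)"
  by (simp add: el_mult power2_eq_square el_rat[symmetric] mult.assoc)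

text \<open>D need not be squarefree, so integrality is read off trace and norm, the coefficients of
  the quadratic with root \<open>el u v\<close>, and not off congruences on the coordinates. The
  case v = 0 is separate because the quadratic is the minimal polynomial only of an irrational
  element.\<close>

theorem el_in_OK_iff: "el u v \<in> OK \<longleftrightarrow> 2 * u \<in> \<int> \<and> u ^ 2 - of_int D * v ^ 2 \<in> \<int>"
proof
  assume "el u v \<in> OK"
  then have ai: "algebraic_int (el u v)" by (simp add: ring_of_integers_def)
  show "2 * u \<in> \<int> \<and> u ^ 2 - of_int D * v ^ 2 \<in> \<int>"
  proof (cases "v = 0")
    case True
    then have "(of_rat u :: complex) \<in> \<int>"
      using ai rational_algebraic_int_is_int[of "of_rat u :: complex"] by (simp add: el_rat)
    then obtain k where "(of_rat u :: complex) = of_int k" by (elim Ints_cases)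
    then have "u = of_int k" by (metis of_rat_eq_iff of_rat_of_int_eq)
    then show ?thesis using True by simp
  next
    case False
    have "el u v \<notin> \<rat>"
      using False el_eq_iff el_rat by (metis Rats_cases)
    moreover have "el u v ^ 2 + of_rat (- (2 * u)) * el u v + of_rat (u ^ 2 - of_int D * v ^ 2) = 0"
      unfolding el_rat[symmetric] power2_eq_square[of "el u v"] el_mult el_add el_eq_0_iff
      by (simp add: power2_eq_square algebra_simps)
    ultimately have "- (2 * u) \<in> \<int>" "u ^ 2 - of_int D * v ^ 2 \<in> \<int>"
      using monic_int_quadratic_coeffs[OF ai] by blast+
    then show ?thesis by (metis Ints_minus minus_minus)
  qed
next
  assume "2 * u \<in> \<int> \<and> u ^ 2 - of_int D * v ^ 2 \<in> \<int>"
  then obtain t n where tn: "2 * u = of_int t" "u ^ 2 - of_int D * v ^ 2 = of_int n"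
    by (auto elim!: Ints_cases)
  have "el u v * el u v + of_rat (- (2 * u)) * el u v + of_rat (u ^ 2 - of_int D * v ^ 2) = 0"
    unfolding el_rat[symmetric] el_mult el_add el_eq_0_iff
    by (simp add: power2_eq_square algebra_simps)
  then have "poly [: of_int n, - of_int t, 1 :] (el u v) = 0"
    unfolding tn of_rat_minus of_rat_of_int_eq by (simp add: algebra_simps)
  moreover have "\<forall>i. coeff [: of_int n :: complex, - of_int t, 1 :] i \<in> \<int>"
    by (auto simp: coeff_pCons split: nat.splits)
  ultimately have "algebraic_int (el u v)" by (intro algebraic_int.intros[of "[: of_int n, - of_int t, 1 :]"]) auto
  then show "el u v \<in> OK" by (simp add: ring_of_integers_def)
qed

lemma OK_subset_K: "OK \<subseteq> K"
  by (auto simp: ring_of_integers_def)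

lemma of_int_in_OK [simp]: "of_int k \<in> OK" and zero_in_OK [simp]: "0 \<in> OK" and one_in_OK [simp]: "1 \<in> OK"
  and numeral_in_OK [simp]: "numeral w \<in> OK"
proof -
  show k: "of_int k \<in> OK" for k
    using el_in_OK_iff[of "of_int k" 0] by (simp add: el_rat)
  show "0 \<in> OK" "1 \<in> OK" "numeral w \<in> OK" using k[of 0] k[of 1] k[of "numeral w"] by simp_all
qed

lemma rat_in_OK_iff: "of_rat r \<in> OK \<longleftrightarrow> r \<in> \<int>"
proof
  assume "of_rat r \<in> OK"
  then have "(of_rat r :: complex) \<in> \<int>"
    using rational_algebraic_int_is_int[of "of_rat r :: complex"] by (simp add: ring_of_integers_def)
  then obtain k where "(of_rat r :: complex) = of_int k" by (elim Ints_cases)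
  then have "r = of_int k" by (metis of_rat_eq_iff of_rat_of_int_eq)
  then show "r \<in> \<int>" by simp
qed (auto elim!: Ints_cases)

lemma rat_quadratic_root_in_Ints:
  fixes t :: rat
  assumes "t ^ 2 - b * t + c = 0" "b \<in> \<int>" "c \<in> \<int>"
  shows "t \<in> \<int>"
proof (rule rational_algebraic_int_is_int)
  show "algebraic_int t"
    by (rule algebraic_int.intros[of "[: c, - b, 1 :]"])
      (use assms in \<open>auto simp: coeff_pCons algebra_simps power2_eq_square split: nat.splits\<close>)
  show "t \<in> \<rat>" by (cases t) (simp add: Fract_of_int_quotient)
qed

text \<open>The traces of \<open>x * y\<close> and of \<open>x * cj y\<close> are the two roots of a monic quadratic polynomial
  whose coefficients are expressed by the traces and norms of \<open>x\<close> and \<open>y\<close>.\<close>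

lemma trace_in_Ints:
  assumes "el u v \<in> OK" "el u' v' \<in> OK"
  shows "2 * (u * u' + of_int D * v * v') \<in> \<int>" "2 * (u * u' - of_int D * v * v') \<in> \<int>"
proof -
  define n n' where "n = u ^ 2 - of_int D * v ^ 2" and "n' = u' ^ 2 - of_int D * v' ^ 2"
  have i: "2 * u \<in> \<int>" "2 * u' \<in> \<int>" "n \<in> \<int>" "n' \<in> \<int>"
    using assms by (auto simp: el_in_OK_iff n_def n'_def)
  have ints: "a * a' \<in> \<int>" "m' * a ^ 2 + m * a' ^ 2 - 4 * m * m' \<in> \<int>"
    if "a \<in> \<int>" "a' \<in> \<int>" "m \<in> \<int>" "m' \<in> \<int>" for a a' m m' :: rat
    using that by (simp_all add: Ints_add Ints_diff Ints_mult Ints_power)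
  have i': "(2 * u) * (2 * u') \<in> \<int>" "n' * (2 * u) ^ 2 + n * (2 * u') ^ 2 - 4 * n * n' \<in> \<int>"
    using i ints by blast+
  have "(2 * (u * u' + of_int D * v * v')) ^ 2 - ((2 * u) * (2 * u')) * (2 * (u * u' + of_int D * v * v')) +
      (n' * (2 * u) ^ 2 + n * (2 * u') ^ 2 - 4 * n * n') = 0"
    by (simp add: n_def n'_def power2_eq_square algebra_simps)
  then show 1: "2 * (u * u' + of_int D * v * v') \<in> \<int>" using i' by (rule rat_quadratic_root_in_Ints)
  have "2 * (u * u' - of_int D * v * v') = (2 * u) * (2 * u') - 2 * (u * u' + of_int D * v * v')"
    by (simp add: algebra_simps)
  then show "2 * (u * u' - of_int D * v * v') \<in> \<int>" using i'(1) 1 by (metis Ints_diff)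
qed

lemma OK_mult:
  assumes "x \<in> OK" "y \<in> OK"
  shows "x * y \<in> OK"
proof -
  obtain u v u' v' where xy: "x = el u v" "y = el u' v'" using assms OK_subset_K K_cases by (metis subsetD)
  have "(u ^ 2 - of_int D * v ^ 2) * (u' ^ 2 - of_int D * v' ^ 2) \<in> \<int>"
    using assms by (simp add: xy el_in_OK_iff)
  also have "(u ^ 2 - of_int D * v ^ 2) * (u' ^ 2 - of_int D * v' ^ 2) =
      (u * u' + of_int D * v * v') ^ 2 - of_int D * (u * v' + v * u') ^ 2"
    by (simp add: power2_eq_square algebra_simps)
  finally show ?thesis
    using trace_in_Ints(1)[of u v u' v'] assms by (simp add: xy el_mult el_in_OK_iff)
qed

lemma OK_add:
  assumes "x \<in> OK" "y \<in> OK"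
  shows "x + y \<in> OK"
proof -
  obtain u v u' v' where xy: "x = el u v" "y = el u' v'" using assms OK_subset_K K_cases by (metis subsetD)
  have "(u ^ 2 - of_int D * v ^ 2) + (u' ^ 2 - of_int D * v' ^ 2) + 2 * (u * u' - of_int D * v * v') \<in> \<int>"
    using assms trace_in_Ints(2)[of u v u' v'] by (intro Ints_add) (auto simp: xy el_in_OK_iff)
  also have "(u ^ 2 - of_int D * v ^ 2) + (u' ^ 2 - of_int D * v' ^ 2) + 2 * (u * u' - of_int D * v * v') =
      (u + u') ^ 2 - of_int D * (v + v') ^ 2"
    by (simp add: power2_eq_square algebra_simps)
  finally show ?thesis
    using assms by (simp add: xy el_add el_in_OK_iff distrib_left)
qed

lemma OK_cj: "x \<in> OK \<Longrightarrow> cj x \<in> OK"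
  using OK_subset_K by (auto simp: el_in_OK_iff elim!: K_cases[of x])

lemma OK_minus: "x \<in> OK \<Longrightarrow> - x \<in> OK"
  using OK_mult[of "-1" x] of_int_in_OK[of "-1"] by simp

lemma OK_diff: "x \<in> OK \<Longrightarrow> y \<in> OK \<Longrightarrow> x - y \<in> OK"
  using OK_add[of x "- y"] OK_minus by simp

section \<open>Fractional ideals and their inverses\<close>

lemma fractional_idealD:
  assumes "fractional_ideal K I"
  shows "I \<subseteq> K" "0 \<in> I" "I \<noteq> {0}" "x \<in> I \<Longrightarrow> y \<in> I \<Longrightarrow> x + y \<in> I"
    "r \<in> OK \<Longrightarrow> x \<in> I \<Longrightarrow> r * x \<in> I" "x \<in> I \<Longrightarrow> y \<in> I \<Longrightarrow> x - y \<in> I"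
    "\<exists>c\<in>OK. c \<noteq> 0 \<and> (\<forall>x\<in>I. c * x \<in> OK)"
proof -
  show add: "x + y \<in> I" if "x \<in> I" "y \<in> I" for x y using assms that by (simp add: fractional_ideal_def)
  show scale: "r * x \<in> I" if "r \<in> OK" "x \<in> I" for r x using assms that by (simp add: fractional_ideal_def)
  show "x - y \<in> I" if "x \<in> I" "y \<in> I" for x y
    using add[OF that(1) scale[OF of_int_in_OK[of "-1"] that(2)]] by simp
qed (use assms in \<open>auto simp: fractional_ideal_def\<close>)

lemma cj_eq_0_iff: "x \<in> K \<Longrightarrow> cj x = 0 \<longleftrightarrow> x = 0"
  by (auto simp: el_eq_0_iff elim!: K_cases)

lemma OK_norm_int:
  assumes "x \<in> OK" "x \<noteq> 0"
  shows "\<exists>k. x * cj x = of_int k \<and> k \<noteq> 0"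
proof -
  obtain u v where x: "x = el u v" using assms OK_subset_K K_cases by blast
  obtain k where k: "u ^ 2 - of_int D * v ^ 2 = of_int k"
    using assms unfolding x el_in_OK_iff by (auto elim: Ints_cases)
  then have xk: "x * cj x = of_int k" unfolding x el_mult_cj by simp
  then have "k \<noteq> 0" using assms(2) cj_eq_0_iff[of x] x by auto
  then show ?thesis using xk by blast
qed

text \<open>After fixing a common denominator, I is a lattice in the plane of coordinates, and a
  triangular system generates it: \<open>\<beta>\<close> has the least second coordinate up to
  divisibility and \<open>\<alpha>\<close> generates the elements with second coordinate 0.\<close>

lemma two_generated:
  assumes I: "fractional_ideal K I"
  shows "\<exists>\<alpha>\<in>I. \<exists>\<beta>\<in>I. \<forall>x\<in>I. \<exists>r\<in>OK. \<exists>t\<in>OK. x = r * \<alpha> + t * \<beta>"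
proof -
  note I = fractional_idealD[OF I]
  obtain c where c: "c \<in> OK" "c \<noteq> 0" "\<And>x. x \<in> I \<Longrightarrow> c * x \<in> OK" using I(7) by blast
  obtain k where k: "c * cj c = of_int k" "k \<noteq> 0" using OK_norm_int[OF c(1,2)] by blast
  \<comment> \<open>The factor k, the norm of c, moves I into \<open>OK\<close>, and 2 clears the
    half-integral first coordinate. Integrality of the norm controls only D * v^2, so D is included
    to make the square of M * v an integer.\<close>
  define M :: rat where "M = of_int (2 * D * k)"
  have M: "M \<noteq> 0" using k(2) D_nonzero by (simp add: M_def)
  have coords: "\<exists>x y. w = el (of_int x / M) (of_int y / M)" if wI: "w \<in> I" for w
  proof -
    have "w \<in> K" using wI I(1) by blast
    then obtain u v where w: "w = el u v" by (rule K_cases)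
    have "cj c * (c * w) \<in> OK" by (intro OK_mult OK_cj c wI)
    also have "cj c * (c * w) = of_int k * w" using k(1) by (simp add: mult_ac)
    also have "\<dots> = el (of_int k) 0 * el u v" by (simp add: w el_rat)
    finally have "el (of_int k * u) (of_int k * v) \<in> OK" by (simp add: el_mult)
    then obtain x m where x: "2 * (of_int k * u) = of_int x"
      and m: "(of_int k * u) ^ 2 - of_int D * (of_int k * v) ^ 2 = of_int m"
      by (auto simp: el_in_OK_iff elim!: Ints_cases)
    have "(M * v) ^ 2 = of_int D * (4 * of_int D * (of_int k * v) ^ 2)"
      by (simp add: M_def power2_eq_square algebra_simps)
    also have "4 * of_int D * (of_int k * v) ^ 2 = (2 * (of_int k * u)) ^ 2 - 4 * of_int m"
      unfolding m[symmetric] by (simp add: power2_eq_square algebra_simps)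
    also have "of_int D * \<dots> = of_int (D * (x ^ 2 - 4 * m))" unfolding x by simp
    finally have "(M * v) ^ 2 - 0 * (M * v) + of_int (- (D * (x ^ 2 - 4 * m))) = 0" by simp
    then have "M * v \<in> \<int>" by (rule rat_quadratic_root_in_Ints) auto
    then obtain y where y: "M * v = of_int y" by (elim Ints_cases)
    have "M * u = of_int D * (2 * (of_int k * u))" by (simp add: M_def)
    then have "M * u = of_int (D * x)" unfolding x by simp
    then have "u = of_int (D * x) / M" "v = of_int y / M"
      using y M by (simp_all add: field_simps)
    then show ?thesis using w by blast
  qed
  have sub: "el (of_int (x - x') / M) (of_int (y - y') / M) =
      el (of_int x / M) (of_int y / M) - el (of_int x' / M) (of_int y' / M)" for x x' y y'
    by (simp add: el_diff diff_divide_distrib)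
  have scale: "el (of_int (l * x) / M) (of_int (l * y) / M) = of_int l * el (of_int x / M) (of_int y / M)" for l x y
  proof -
    have "of_int l = el (of_int l) 0" by (simp add: el_rat)
    then show ?thesis by (simp add: el_mult)
  qed
  have zero: "el (of_int 0 / M) (of_int 0 / M) \<in> I" using I(2) by (simp add: el_zero)
  define A where "A = {y. \<exists>x. el (of_int x / M) (of_int y / M) \<in> I}"
  have "\<exists>g\<in>A. \<forall>a\<in>A. g dvd a"
  proof (rule int_subgroup_generator)
    show "0 \<in> A" using zero unfolding A_def by blast
    fix y y' assume "y \<in> A" "y' \<in> A"
    then obtain x x' where "el (of_int x / M) (of_int y / M) \<in> I" "el (of_int x' / M) (of_int y' / M) \<in> I"
      unfolding A_def by blast
    then have "el (of_int (x - x') / M) (of_int (y - y') / M) \<in> I" unfolding sub by (rule I(6))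
    then show "y - y' \<in> A" unfolding A_def by blast
  qed
  then obtain y0 where y0: "y0 \<in> A" "\<And>y. y \<in> A \<Longrightarrow> y0 dvd y" by blast
  obtain x0 where x0: "el (of_int x0 / M) (of_int y0 / M) \<in> I" using y0(1) by (auto simp: A_def)
  define B where "B = {x. el (of_int x / M) (of_int 0 / M) \<in> I}"
  have "\<exists>g\<in>B. \<forall>a\<in>B. g dvd a"
  proof (rule int_subgroup_generator)
    show "0 \<in> B" using zero by (simp add: B_def)
    fix x x' assume "x \<in> B" "x' \<in> B"
    then show "x - x' \<in> B" using I(6) sub[of x x' 0 0] unfolding B_def by simp
  qed
  then obtain x1 where x1: "x1 \<in> B" "\<And>x. x \<in> B \<Longrightarrow> x1 dvd x" by blast
  define \<alpha> where "\<alpha> = el (of_int x1 / M) (of_int 0 / M)"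
  define \<beta> where "\<beta> = el (of_int x0 / M) (of_int y0 / M)"
  have "\<exists>r\<in>OK. \<exists>t\<in>OK. w = r * \<alpha> + t * \<beta>" if w: "w \<in> I" for w
  proof -
    obtain x y where xy: "w = el (of_int x / M) (of_int y / M)" using coords[OF w] by blast
    then have "y \<in> A" using w by (auto simp: A_def)
    then obtain t where t: "y = t * y0" using y0(2) by (metis dvdE mult.commute)
    have "w - of_int t * \<beta> = el (of_int (x - t * x0) / M) (of_int (y - t * y0) / M)"
      unfolding xy \<beta>_def scale[symmetric] sub ..
    then have wt: "w - of_int t * \<beta> = el (of_int (x - t * x0) / M) (of_int 0 / M)" by (simp add: t)
    have "w - of_int t * \<beta> \<in> I"
      using x0 by (intro I w) (auto simp: \<beta>_def)
    then have "x - t * x0 \<in> B" using wt by (simp add: B_def)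
    then obtain r where r: "x - t * x0 = r * x1" using x1(2) by (metis dvdE mult.commute)
    have "w - of_int t * \<beta> = of_int r * \<alpha>"
      using scale[of r x1 0] unfolding wt r \<alpha>_def by simp
    then have "w = of_int r * \<alpha> + of_int t * \<beta>" by (simp add: algebra_simps)
    then show ?thesis using of_int_in_OK by blast
  qed
  moreover have "\<alpha> \<in> I" "\<beta> \<in> I" using x1(1) x0 by (auto simp: \<alpha>_def \<beta>_def B_def)
  ultimately show ?thesis by blast
qed

lemma common_rational_gcd:
  fixes a b c :: rat
  assumes "a \<noteq> 0 \<or> b \<noteq> 0"
  obtains g x y z where "g \<noteq> 0" "a / g \<in> \<int>" "b / g \<in> \<int>" "c / g \<in> \<int>"
    "g = of_int x * a + of_int y * b + of_int z * c"
proof -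
  obtain a1 a2 b1 b2 c1 c2 where abc: "a = of_int a1 / of_int a2" "a2 > 0" "b = of_int b1 / of_int b2" "b2 > 0"
      "c = of_int c1 / of_int c2" "c2 > 0"
    by (metis quotient_of_div quotient_of_denom_pos surj_pair)
  define M where "M = a2 * b2 * c2"
  define A B C where "A = a1 * b2 * c2" and "B = b1 * a2 * c2" and "C = c1 * a2 * b2"
  have M: "M > 0" using abc by (simp add: M_def)
  have ABC: "a = of_int A / of_int M" "b = of_int B / of_int M" "c = of_int C / of_int M"
    using abc by (simp_all add: A_def B_def C_def M_def)
  define G where "G = gcd (gcd A B) C"
  have "A \<noteq> 0 \<or> B \<noteq> 0" using assms ABC by auto
  then have G: "G \<noteq> 0" by (auto simp: G_def)
  obtain x y where xy: "x * A + y * B = gcd A B" using bezout_int by blast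
  obtain u z where uz: "u * gcd A B + z * C = G" unfolding G_def using bezout_int by blast
  have "G = u * (x * A + y * B) + z * C" unfolding xy by (rule uz[symmetric])
  then have "G = (u * x) * A + (u * y) * B + z * C" by (simp add: algebra_simps)
  then have "of_int G / of_int M = of_int (u * x) * a + of_int (u * y) * b + of_int z * c"
    unfolding ABC by (simp add: add_divide_distrib)
  moreover have "of_int G / of_int M \<noteq> (0 :: rat)" using G M by simp
  moreover have int: "(of_int X / of_int M) / (of_int G / of_int M :: rat) \<in> \<int>" if "G dvd X" for X
    using that G M by (auto elim!: dvdE)
  have "G dvd A" "G dvd B" "G dvd C" unfolding G_def by (meson dvd_trans gcd_dvd1 gcd_dvd2)+
  then have "a / (of_int G / of_int M) \<in> \<int>" "b / (of_int G / of_int M) \<in> \<int>" "c / (of_int G / of_int M) \<in> \<int>"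
    unfolding ABC by (blast intro: int)+
  ultimately show ?thesis using that by blast
qed

text \<open>For generators \<open>\<alpha>\<close>, \<open>\<beta>\<close> of \<open>I\<close>, the product of \<open>I\<close> with its conjugate is generated by the
  rational greatest common divisor \<open>g\<close> of \<open>\<alpha> * cj \<alpha>\<close>, \<open>\<beta> * cj \<beta>\<close> and the trace of
  \<open>\<alpha> * cj \<beta>\<close>: the element \<open>\<alpha> * cj \<beta> / g\<close> is integral because its trace and norm are.\<close>

lemma fractional_ideal_inverse:
  assumes I: "fractional_ideal K I"
  shows "\<exists>J. fractional_ideal K J \<and> ideal_mult J I = OK"
proof -
  note ID = fractional_idealD[OF I]
  \<comment> \<open>Taking everything that multiplies I into \<open>OK\<close> makes J closed under
    addition and scaling at once; the generators serve only to show that 1 lies in the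
    product.\<close>
  define J where "J = {x \<in> K. \<forall>y\<in>I. x * y \<in> OK}"
  obtain \<alpha> \<beta> where gen: "\<alpha> \<in> I" "\<beta> \<in> I" "\<And>x. x \<in> I \<Longrightarrow> \<exists>r\<in>OK. \<exists>t\<in>OK. x = r * \<alpha> + t * \<beta>"
    using two_generated[OF I] by blast
  obtain u v u' v' where ab: "\<alpha> = el u v" "\<beta> = el u' v'" using gen ID(1) K_cases by (metis subsetD)
  define a where "a = u ^ 2 - of_int D * v ^ 2"
  define b where "b = u' ^ 2 - of_int D * v' ^ 2"
  define c where "c = 2 * (u * u' - of_int D * v * v')"
  have aa: "\<alpha> * cj \<alpha> = of_rat a" "\<beta> * cj \<beta> = of_rat b" unfolding ab a_def b_def by (simp_all only: el_mult_cj)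
  have cc: "\<alpha> * cj \<beta> + \<beta> * cj \<alpha> = of_rat c"
    by (simp add: ab el_mult el_add c_def el_rat[symmetric] mult_ac)
  have "\<alpha> \<noteq> 0 \<or> \<beta> \<noteq> 0" using ID(2,3) gen(3) by fastforce
  then have "a \<noteq> 0 \<or> b \<noteq> 0"
    using aa cj_eq_0_iff[of \<alpha>] cj_eq_0_iff[of \<beta>] ab by auto
  then obtain g x y z where g: "g \<noteq> 0" "a / g \<in> \<int>" "b / g \<in> \<int>" "c / g \<in> \<int>"
      and gxyz: "g = of_int x * a + of_int y * b + of_int z * c"
    by (rule common_rational_gcd)
  have ag: "\<alpha> * cj \<alpha> / of_rat g \<in> OK" "\<beta> * cj \<beta> / of_rat g \<in> OK"
    unfolding aa using g by (simp_all add: of_rat_divide[symmetric] rat_in_OK_iff)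
  have abg: "\<alpha> * cj \<beta> / of_rat g = el ((u * u' - of_int D * v * v') / g) ((v * u' - u * v') / g)"
  proof -
    have "inverse (of_rat g) = el (1 / g) 0"
      by (simp add: el_rat of_rat_inverse divide_inverse del: inverse_eq_divide)
    then show ?thesis by (simp add: divide_inverse[of _ "of_rat g"] ab el_mult mult_ac)
  qed
  have "(a / g) * (b / g) \<in> \<int>" using g(2,3) by (rule Ints_mult)
  also have "(a / g) * (b / g) = ((u * u' - of_int D * v * v') / g) ^ 2 - of_int D * ((v * u' - u * v') / g) ^ 2"
    using g(1) by (simp add: a_def b_def power2_eq_square field_simps)
  finally have abOK: "\<alpha> * cj \<beta> / of_rat g \<in> OK"
    using g(4) unfolding abg el_in_OK_iff by (simp add: c_def)
  then have baOK: "\<beta> * cj \<alpha> / of_rat g \<in> OK"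
  proof -
    have "\<beta> * cj \<alpha> / of_rat g = of_rat (c / g) - \<alpha> * cj \<beta> / of_rat g"
      unfolding of_rat_divide cc[symmetric] by (simp add: add_divide_distrib)
    moreover have "of_rat (c / g) \<in> OK" using g by (simp add: rat_in_OK_iff)
    ultimately show ?thesis using abOK OK_diff by simp
  qed
  have inK: "cj \<alpha> / of_rat g \<in> K" "cj \<beta> / of_rat g \<in> K"
    using K_closed(3)[OF _ K_inverse] by (simp_all add: divide_inverse ab)
  have aJ: "cj \<alpha> / of_rat g \<in> J" "cj \<beta> / of_rat g \<in> J"
  proof -
    have "cj \<alpha> / of_rat g * w \<in> OK \<and> cj \<beta> / of_rat g * w \<in> OK" if "w \<in> I" for w
    proof -
      obtain r t where rt: "r \<in> OK" "t \<in> OK" "w = r * \<alpha> + t * \<beta>" using gen(3)[OF \<open>w \<in> I\<close>] by blast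
      have "cj \<alpha> / of_rat g * w = r * (\<alpha> * cj \<alpha> / of_rat g) + t * (\<beta> * cj \<alpha> / of_rat g)"
        "cj \<beta> / of_rat g * w = r * (\<alpha> * cj \<beta> / of_rat g) + t * (\<beta> * cj \<beta> / of_rat g)"
        by (simp_all add: rt algebra_simps add_divide_distrib)
      moreover have "r * (\<alpha> * cj \<alpha> / of_rat g) + t * (\<beta> * cj \<alpha> / of_rat g) \<in> OK"
        "r * (\<alpha> * cj \<beta> / of_rat g) + t * (\<beta> * cj \<beta> / of_rat g) \<in> OK"
        by (intro OK_add OK_mult rt ag abOK baOK)+
      ultimately show ?thesis by metis
    qed
    then show "cj \<alpha> / of_rat g \<in> J" "cj \<beta> / of_rat g \<in> J" using inK by (simp_all add: J_def)
  qed
  have Jscale: "r * x \<in> J" if "r \<in> OK" "x \<in> J" for r x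
    using that OK_subset_K by (auto simp: J_def mult.assoc intro: OK_mult K_closed)
  have Jadd: "x + y \<in> J" if "x \<in> J" "y \<in> J" for x y
    using that by (auto simp: J_def distrib_right intro: OK_add K_closed)
  have sub: "ideal_mult J I \<subseteq> OK"
    by (rule ideal_mult_least) (auto simp: J_def intro: OK_add)
  have mscale: "r * x \<in> ideal_mult J I" if "r \<in> OK" "x \<in> ideal_mult J I" for r x
    using that(2) by (rule ideal_mult_scale) (rule Jscale[OF that(1)])
  have "of_rat g = of_int x * (\<alpha> * cj \<alpha>) + of_int y * (\<beta> * cj \<beta>) + of_int z * (\<alpha> * cj \<beta> + \<beta> * cj \<alpha>)"
    unfolding aa cc by (subst gxyz) (simp add: of_rat_add of_rat_mult)
  then have "of_rat g / of_rat g = (of_int x * (\<alpha> * cj \<alpha>) + of_int y * (\<beta> * cj \<beta>) + of_int z * (\<alpha> * cj \<beta> + \<beta> * cj \<alpha>)) / of_rat g"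
    by simp
  then have "1 = of_int x * (cj \<alpha> / of_rat g * \<alpha>) + of_int y * (cj \<beta> / of_rat g * \<beta>) +
      of_int z * (cj \<beta> / of_rat g * \<alpha> + cj \<alpha> / of_rat g * \<beta>)"
    using g(1) by (simp add: add_divide_distrib distrib_left mult_ac)
  also have "\<dots> \<in> ideal_mult J I"
    by (intro ideal_mult_add mscale of_int_in_OK ideal_mult_mem aJ gen(1,2))
  finally have one: "1 \<in> ideal_mult J I" .
  then have "OK \<subseteq> ideal_mult J I" using mscale[of _ 1] by auto
  then have eq: "ideal_mult J I = OK" using sub by blast
  have "fractional_ideal K J"
    unfolding fractional_ideal_def
  proof (intro conjI ballI)
    show "J \<noteq> {0}"
    proof
      assume "J = {0}"
      then have "ideal_mult J I \<subseteq> {0}" by (intro ideal_mult_least) auto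
      then show False using one by auto
    qed
    obtain w where w: "w \<in> I" "w \<noteq> 0" using ID(2,3) by blast
    obtain d where d: "d \<in> OK" "d \<noteq> 0" "d * w \<in> OK" using ID(7) w(1) by blast
    have "d * w * x \<in> OK" if "x \<in> J" for x
    proof -
      have "d * w * x = d * (x * w)" by (simp add: mult_ac)
      moreover have "x * w \<in> OK" using that w by (simp add: J_def)
      ultimately show ?thesis using OK_mult[OF d(1)] by metis
    qed
    then show "\<exists>c\<in>OK. c \<noteq> 0 \<and> (\<forall>x\<in>J. c * x \<in> OK)" using d w by (intro bexI[of _ "d * w"]) auto
  qed (auto simp: Jscale Jadd, auto simp: J_def)
  then show ?thesis using eq by blast
qed

lemma fractional_ideal_mult:
  assumes I: "fractional_ideal K I" and J: "fractional_ideal K J"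
  shows "fractional_ideal K (ideal_mult I J)"
  unfolding fractional_ideal_def
proof (intro conjI ballI)
  note ID = fractional_idealD[OF I] and JD = fractional_idealD[OF J]
  show "ideal_mult I J \<subseteq> K"
    using ID(1) JD(1) by (intro ideal_mult_least) (auto intro: K_closed)
  show "0 \<in> ideal_mult I J" by (rule ideal_mult_0)
  obtain x y where xy: "x \<in> I" "x \<noteq> 0" "y \<in> J" "y \<noteq> 0" using ID(2,3) JD(2,3) by blast
  have "x * y \<in> ideal_mult I J" by (rule ideal_mult_mem[OF xy(1,3)])
  moreover have "x * y \<noteq> 0" using xy by simp
  ultimately show "ideal_mult I J \<noteq> {0}" by blast
  show "r * x \<in> ideal_mult I J" if "r \<in> OK" "x \<in> ideal_mult I J" for r x
    using that(2) by (rule ideal_mult_scale) (rule ID(5)[OF that(1)])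
  obtain c d where c: "c \<in> OK" "c \<noteq> 0" "\<And>x. x \<in> I \<Longrightarrow> c * x \<in> OK"
    and d: "d \<in> OK" "d \<noteq> 0" "\<And>x. x \<in> J \<Longrightarrow> d * x \<in> OK" using ID(7) JD(7) by metis
  have "ideal_mult I J \<subseteq> {z. c * d * z \<in> OK}"
  proof (rule ideal_mult_least)
    fix x y assume "x \<in> I" "y \<in> J"
    then have "(c * x) * (d * y) \<in> OK" by (intro OK_mult c d)
    then show "x * y \<in> {z. c * d * z \<in> OK}" by (simp add: mult_ac)
  qed (auto simp: distrib_left intro: OK_add)
  then show "\<exists>c\<in>OK. c \<noteq> 0 \<and> (\<forall>x\<in>ideal_mult I J. c * x \<in> OK)"
    using c d by (intro bexI[of _ "c * d"]) (auto intro: OK_mult)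
qed (auto intro: ideal_mult_add)

lemma ideal_mult_OK:
  assumes "fractional_ideal K I"
  shows "ideal_mult OK I = I"
proof
  show "ideal_mult OK I \<subseteq> I"
    using fractional_idealD[OF assms] by (intro ideal_mult_least) auto
  show "I \<subseteq> ideal_mult OK I" using ideal_mult_mem[of 1 OK _ I] by auto
qed

abbreviation principal :: "complex \<Rightarrow> complex set" where "principal c \<equiv> (\<lambda>r. c * r) ` OK"

lemma fractional_ideal_principal:
  assumes "c \<in> K" "c \<noteq> 0"
  shows "fractional_ideal K (principal c)"
  unfolding fractional_ideal_def
proof (intro conjI ballI)
  show "principal c \<subseteq> K" using assms OK_subset_K by (auto intro: K_closed)
  show "0 \<in> principal c" by (rule image_eqI[of _ _ 0]) auto
  have "c \<in> principal c" by (rule image_eqI[of _ _ 1]) auto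
  then show "principal c \<noteq> {0}" using assms by auto
  show "x + y \<in> principal c" if "x \<in> principal c" "y \<in> principal c" for x y
    using that by (auto simp: distrib_left[symmetric] intro!: imageI OK_add)
  show "r * x \<in> principal c" if "r \<in> OK" "x \<in> principal c" for r x
    using that by (auto simp: mult.left_commute[of r] intro!: imageI OK_mult)
  obtain u v where c: "c = el u v" using assms K_cases by blast
  obtain u1 u2 v1 v2 where uv: "u = of_int u1 / of_int u2" "u2 > 0" "v = of_int v1 / of_int v2" "v2 > 0"
    by (metis quotient_of_div quotient_of_denom_pos surj_pair)
  define k where "k = u2 * v2"
  have k: "k \<noteq> 0" using uv by (simp add: k_def)
  obtain n where n: "inverse (c * cj c) = of_rat n"
    unfolding c el_mult_cj by (metis of_rat_inverse)
  have ic: "inverse c = cj c * of_rat n"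
    using assms n cj_eq_0_iff[of c] by (simp add: field_simps n[symmetric])
  obtain n1 n2 where n12: "n = of_int n1 / of_int n2" "n2 > 0"
    by (metis quotient_of_div quotient_of_denom_pos surj_pair)
  \<comment> \<open>An integral multiple of 1 / c is the common denominator that a fractional ideal
    requires of \<open>principal c\<close>.\<close>
  have "of_int (k * n2) * inverse c = el (of_int (n1 * (u1 * v2))) (of_int (- n1 * (v1 * u2)))"
  proof -
    have e: "of_int (k * n2) = el (of_int (k * n2)) 0" by (simp only: el_rat of_rat_of_int_eq)
    have "of_int (k * n2) * inverse c = el (of_int (k * n2)) 0 * (el u (- v) * el n 0)"
      unfolding ic e unfolding c cj_el el_rat ..
    also have "\<dots> = el (of_int (k * n2) * u * n) (- (of_int (k * n2) * v * n))" by (simp add: el_mult mult_ac)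
    finally show ?thesis using uv n12 by (simp add: k_def mult_ac)
  qed
  moreover have "el (of_int x) (of_int y) \<in> OK" for x y
    by (simp add: el_in_OK_iff)
  ultimately have d: "of_int (k * n2) * inverse c \<in> OK" by metis
  have cn: "of_int (k * n2) * inverse c \<noteq> 0" using k n12 assms by simp
  have "of_int (k * n2) * inverse c * x \<in> OK" if x: "x \<in> principal c" for x
  proof -
    obtain r where r: "r \<in> OK" "x = c * r" using x by blast
    have "of_int (k * n2) * inverse c * x = of_int (k * n2) * r" using assms(2) by (simp add: r)
    then show ?thesis using OK_mult[OF of_int_in_OK r(1)] by metis
  qed
  then show "\<exists>d\<in>OK. d \<noteq> 0 \<and> (\<forall>x\<in>principal c. d * x \<in> OK)" using d cn by blast
qed

lemma principal_mult: "ideal_mult (principal c) (principal d) = principal (c * d)"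
proof
  show "ideal_mult (principal c) (principal d) \<subseteq> principal (c * d)"
  proof (rule ideal_mult_least)
    show "0 \<in> principal (c * d)" by (rule image_eqI[of _ _ 0]) auto
    show "x + y \<in> principal (c * d)" if "x \<in> principal (c * d)" "y \<in> principal (c * d)" for x y
      using that by (auto simp: distrib_left[symmetric] intro!: imageI OK_add)
    fix x y assume "x \<in> principal c" "y \<in> principal d"
    then obtain r s where "r \<in> OK" "s \<in> OK" "x = c * r" "y = d * s" by blast
    then show "x * y \<in> principal (c * d)"
      by (intro image_eqI[of _ _ "r * s"]) (auto intro: OK_mult)
  qed
  show "principal (c * d) \<subseteq> ideal_mult (principal c) (principal d)"
  proof
    fix x assume "x \<in> principal (c * d)"
    then obtain r where r: "r \<in> OK" "x = c * d * r" by blast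
    have "(c * 1) * (d * r) \<in> ideal_mult (principal c) (principal d)"
      using r by (intro ideal_mult_mem) auto
    then show "x \<in> ideal_mult (principal c) (principal d)" using r by (simp add: mult_ac)
  qed
qed

section \<open>The ideal class group\<close>

abbreviation FG :: "complex set monoid" where "FG \<equiv> fractional_ideal_group K"

lemma FG_comm_group: "comm_group FG"
proof (rule comm_groupI)
  show "\<And>x y z. x \<in> carrier FG \<Longrightarrow> y \<in> carrier FG \<Longrightarrow> z \<in> carrier FG \<Longrightarrow>
      x \<otimes>\<^bsub>FG\<^esub> y \<otimes>\<^bsub>FG\<^esub> z = x \<otimes>\<^bsub>FG\<^esub> (y \<otimes>\<^bsub>FG\<^esub> z)"
    by (simp add: fractional_ideal_group_def ideal_mult_assoc)
  show "\<one>\<^bsub>FG\<^esub> \<in> carrier FG"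
    using fractional_ideal_principal[of 1] by (simp add: fractional_ideal_group_def)
  show "\<And>x y. x \<in> carrier FG \<Longrightarrow> y \<in> carrier FG \<Longrightarrow> x \<otimes>\<^bsub>FG\<^esub> y \<in> carrier FG"
    by (simp add: fractional_ideal_group_def fractional_ideal_mult)
  show "\<And>x y. x \<in> carrier FG \<Longrightarrow> y \<in> carrier FG \<Longrightarrow> x \<otimes>\<^bsub>FG\<^esub> y = y \<otimes>\<^bsub>FG\<^esub> x"
    unfolding fractional_ideal_group_def by simp (rule ideal_mult_commute)
  show "\<And>x. x \<in> carrier FG \<Longrightarrow> \<one>\<^bsub>FG\<^esub> \<otimes>\<^bsub>FG\<^esub> x = x"
    by (simp add: fractional_ideal_group_def ideal_mult_OK)
  show "\<And>x. x \<in> carrier FG \<Longrightarrow> \<exists>y\<in>carrier FG. y \<otimes>\<^bsub>FG\<^esub> x = \<one>\<^bsub>FG\<^esub>"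
    using fractional_ideal_inverse by (simp add: fractional_ideal_group_def)
qed

lemma principal_subgroup: "subgroup (principal_fractional_ideals K) FG"
proof -
  interpret comm_group FG by (rule FG_comm_group)
  have mem: "principal c \<in> principal_fractional_ideals K" if "c \<in> K" "c \<noteq> 0" for c
    using that by (auto simp: principal_fractional_ideals_def)
  have carr: "principal c \<in> carrier FG" if "c \<in> K" "c \<noteq> 0" for c
    using that by (simp add: fractional_ideal_group_def fractional_ideal_principal)
  have m: "principal c \<otimes>\<^bsub>FG\<^esub> principal d = principal (c * d)" for c d
    by (simp add: fractional_ideal_group_def principal_mult)
  have one: "\<one>\<^bsub>FG\<^esub> = principal 1" by (simp add: fractional_ideal_group_def)
  show ?thesis
  proof (rule subgroupI)
    show "principal_fractional_ideals K \<subseteq> carrier FG"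
      using carr by (auto simp: principal_fractional_ideals_def)
    show "principal_fractional_ideals K \<noteq> {}" using mem[of 1] by auto
    fix I J assume IJ: "I \<in> principal_fractional_ideals K" "J \<in> principal_fractional_ideals K"
    then obtain c d where cd: "I = principal c" "c \<in> K" "c \<noteq> 0" "J = principal d" "d \<in> K" "d \<noteq> 0"
      by (auto simp: principal_fractional_ideals_def)
    show "I \<otimes>\<^bsub>FG\<^esub> J \<in> principal_fractional_ideals K"
      unfolding cd m using cd by (intro mem K_closed) auto
  next
    fix I assume "I \<in> principal_fractional_ideals K"
    then obtain c where c: "I = principal c" "c \<in> K" "c \<noteq> 0"
      by (auto simp: principal_fractional_ideals_def)
    have "inv\<^bsub>FG\<^esub> I = principal (inverse c)"
      using c m[of "inverse c" c] one by (intro inv_equality) (auto intro: carr K_inverse)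
    then show "inv\<^bsub>FG\<^esub> I \<in> principal_fractional_ideals K"
      using c mem[of "inverse c"] K_inverse by auto
  qed
qed


text \<open>Lagrange's theorem in the quotient group. It also covers an infinite class group, where
  the exponent is 0 and the power is \<open>OK\<close>.\<close>

lemma power_class_number_principal:
  assumes "fractional_ideal K I"
  shows "I [^]\<^bsub>FG\<^esub> class_number K \<in> principal_fractional_ideals K"
proof -
  interpret comm_group FG by (rule FG_comm_group)
  define H where "H = principal_fractional_ideals K"
  have sub: "subgroup H FG" unfolding H_def by (rule principal_subgroup)
  interpret normal H FG using sub by (rule subgroup_imp_normal)
  interpret Q: group "FG Mod H" by (rule factorgroup_is_group)
  have I: "I \<in> carrier FG" using assms by (simp add: fractional_ideal_group_def)
  have pow: "(H #>\<^bsub>FG\<^esub> I) [^]\<^bsub>FG Mod H\<^esub> n = H #>\<^bsub>FG\<^esub> (I [^]\<^bsub>FG\<^esub> n)" for n :: nat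
  proof (induction n)
    case 0
    show ?case using subgroup.subset[OF sub] by simp
  next
    case (Suc n)
    then show ?case using hom_mult[OF r_coset_hom_Mod, of "I [^]\<^bsub>FG\<^esub> n" I] I by simp
  qed
  have "H #>\<^bsub>FG\<^esub> I \<in> carrier (FG Mod H)" using I by (simp add: carrier_FactGroup)
  then have "(H #>\<^bsub>FG\<^esub> I) [^]\<^bsub>FG Mod H\<^esub> Coset.order (FG Mod H) = H"
    using Q.pow_order_eq_1 by simp
  then have "H #>\<^bsub>FG\<^esub> (I [^]\<^bsub>FG\<^esub> Coset.order (FG Mod H)) = H" by (simp only: pow)
  then have "I [^]\<^bsub>FG\<^esub> Coset.order (FG Mod H) \<in> H"
    by (rule coset_join1[OF _ nat_pow_closed[OF I] sub])
  then show ?thesis by (simp add: H_def class_number_def class_group_def)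
qed

lemma cj_image_ideal_mult:
  assumes "I \<subseteq> K" "J \<subseteq> K"
  shows "cj ` ideal_mult I J = ideal_mult (cj ` I) (cj ` J)"
proof
  have K: "ideal_mult I J \<subseteq> K" using assms by (intro ideal_mult_least) (auto intro: K_closed)
  have "ideal_mult I J \<subseteq> {z \<in> K. cj z \<in> ideal_mult (cj ` I) (cj ` J)}"
  proof (rule ideal_mult_least)
    fix x y assume xy: "x \<in> I" "y \<in> J"
    then have "x \<in> K" "y \<in> K" using assms by auto
    moreover have "cj x * cj y \<in> ideal_mult (cj ` I) (cj ` J)" using xy by (intro ideal_mult_mem) auto
    ultimately show "x * y \<in> {z \<in> K. cj z \<in> ideal_mult (cj ` I) (cj ` J)}"
      by (simp add: cj_hom K_closed)
  qed (auto simp: ideal_mult_0 cj_hom intro: ideal_mult_add K_closed)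
  then show "cj ` ideal_mult I J \<subseteq> ideal_mult (cj ` I) (cj ` J)" by blast
  show "ideal_mult (cj ` I) (cj ` J) \<subseteq> cj ` ideal_mult I J"
  proof (rule ideal_mult_least)
    show "0 \<in> cj ` ideal_mult I J" by (rule image_eqI[of _ _ 0]) (auto simp: ideal_mult_0)
    fix x y assume "x \<in> cj ` ideal_mult I J" "y \<in> cj ` ideal_mult I J"
    then obtain x' y' where xy: "x' \<in> ideal_mult I J" "y' \<in> ideal_mult I J" "x = cj x'" "y = cj y'" by blast
    then have "x + y = cj (x' + y')" using K by (simp add: cj_hom subset_iff)
    then show "x + y \<in> cj ` ideal_mult I J" using xy ideal_mult_add by blast
  next
    fix x y assume "x \<in> cj ` I" "y \<in> cj ` J"
    then obtain x' y' where xy: "x' \<in> I" "y' \<in> J" "x = cj x'" "y = cj y'" by blast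
    then have "x * y = cj (x' * y')" using assms by (simp add: cj_hom subset_iff)
    then show "x * y \<in> cj ` ideal_mult I J" using xy ideal_mult_mem by blast
  qed
qed

lemma cj_image_OK: "cj ` OK = OK"
proof
  show "OK \<subseteq> cj ` OK"
  proof
    fix x assume x: "x \<in> OK"
    then have "x \<in> K" using OK_subset_K by blast
    then have "x = cj (cj x)" by (simp add: cj_hom(3)[of x x])
    then show "x \<in> cj ` OK" using OK_cj[OF x] by blast
  qed
qed (auto intro: OK_cj)

lemma cj_image_principal:
  assumes "c \<in> K"
  shows "cj ` principal c = principal (cj c)"
proof -
  have "cj ` principal c = (\<lambda>r. cj c * cj r) ` OK"
    unfolding image_image using assms OK_subset_K by (intro image_cong) (auto simp: cj_hom subset_iff)
  also have "\<dots> = (\<lambda>r. cj c * r) ` (cj ` OK)" by (simp only: image_image)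
  finally show ?thesis by (simp only: cj_image_OK)
qed

section \<open>The ideal (5, sqrt D - 2) and its powers\<close>

definition P5 :: "complex set" where
  "P5 = {5 * r + (root - 2) * t | r t. r \<in> OK \<and> t \<in> OK}"

lemma root_el: "root = el 0 1"
  by (simp add: el_def)

lemma root_in_OK: "root \<in> OK"
  unfolding root_el by (simp add: el_in_OK_iff)

lemma P5_subset: "P5 \<subseteq> OK"
  unfolding P5_def using root_in_OK by (auto intro!: OK_add OK_mult OK_diff)

lemma fractional_ideal_P5: "fractional_ideal K P5"
  unfolding fractional_ideal_def
proof (intro conjI ballI)
  show "P5 \<subseteq> K" using P5_subset OK_subset_K by blast
  show "0 \<in> P5" unfolding P5_def by (rule CollectI, rule exI[of _ 0], rule exI[of _ 0]) simp
  have "5 \<in> P5" unfolding P5_def by (rule CollectI, rule exI[of _ 1], rule exI[of _ 0]) simp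
  then show "P5 \<noteq> {0}" by auto
  show "x + y \<in> P5" if xy: "x \<in> P5" "y \<in> P5" for x y
  proof -
    obtain r t r' t' where rt: "r \<in> OK" "t \<in> OK" "x = 5 * r + (root - 2) * t"
        "r' \<in> OK" "t' \<in> OK" "y = 5 * r' + (root - 2) * t'"
      using xy unfolding P5_def by blast
    have "x + y = 5 * (r + r') + (root - 2) * (t + t')"
      unfolding rt(3,6) by (simp add: algebra_simps)
    moreover have "r + r' \<in> OK" "t + t' \<in> OK" using rt by (auto intro: OK_add)
    ultimately show ?thesis unfolding P5_def by blast
  qed
  show "c * x \<in> P5" if c: "c \<in> OK" and x: "x \<in> P5" for c x
  proof -
    obtain r t where rt: "r \<in> OK" "t \<in> OK" "x = 5 * r + (root - 2) * t"
      using x unfolding P5_def by blast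
    have "c * x = 5 * (c * r) + (root - 2) * (c * t)"
      unfolding rt(3) by (simp add: algebra_simps)
    moreover have "c * r \<in> OK" "c * t \<in> OK" using c rt by (auto intro: OK_mult)
    ultimately show ?thesis unfolding P5_def by blast
  qed
  show "\<exists>c\<in>OK. c \<noteq> 0 \<and> (\<forall>x\<in>P5. c * x \<in> OK)"
    using P5_subset by (intro bexI[of _ 1]) auto
qed

text \<open>The product of \<open>root - 2\<close> with its conjugate is 4 - D, a multiple of 5.
  Conversely 5 = 25 - 20, and -20 is the sum of 5 * (- root - 2) and (root - 2) * 5.\<close>

lemma P5_mult_cj:
  assumes D: "[D = 4] (mod 5)"
  shows "ideal_mult P5 (cj ` P5) = principal 5"
proof
  obtain k where k: "D = 4 + 5 * k" using D by (metis cong_iff_lin cong_sym)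
  have "root - 2 = el (- 2) 1" by (simp add: el_def)
  then have "cj (root - 2) = el (- 2) (- 1)" by (simp only: cj_el)
  then have cj_root: "cj (root - 2) = - root - 2" by (simp add: el_def)
  have cjP5: "\<exists>r t. r \<in> OK \<and> t \<in> OK \<and> y = 5 * r + (- root - 2) * t" if y: "y \<in> cj ` P5" for y
  proof -
    obtain r t where rt: "r \<in> OK" "t \<in> OK" "y = cj (5 * r + (root - 2) * t)"
      using y unfolding P5_def by blast
    have "root - 2 \<in> OK" by (intro OK_diff root_in_OK numeral_in_OK)
    then have "r \<in> K" "t \<in> K" "root - 2 \<in> K" "5 \<in> K"
      using rt(1,2) numeral_in_OK[of "num.Bit1 (num.Bit0 num.One)"] OK_subset_K by blast+
    then have "y = 5 * cj r + (- root - 2) * cj t"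
      using cj_rat(2)[of 5] unfolding rt(3) by (simp add: cj_hom K_closed cj_root)
    then show ?thesis using rt OK_cj by blast
  qed
  show "ideal_mult P5 (cj ` P5) \<subseteq> principal 5"
  proof (rule ideal_mult_least)
    show "0 \<in> principal 5" by (rule image_eqI[of _ _ 0]) auto
    have "(5::complex) \<in> K" using of_int_in_K[of 5] by simp
    then show "x + y \<in> principal 5" if "x \<in> principal 5" "y \<in> principal 5" for x y
      using fractional_idealD(4)[OF fractional_ideal_principal[of 5]] that by simp
    fix x y assume x: "x \<in> P5" and y: "y \<in> cj ` P5"
    obtain r t where rt: "r \<in> OK" "t \<in> OK" "x = 5 * r + (root - 2) * t" using x unfolding P5_def by blast
    obtain r' t' where rt': "r' \<in> OK" "t' \<in> OK" "y = 5 * r' + (- root - 2) * t'" using cjP5[OF y] by blast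
    have "x * y = 5 * (5 * (r * r')) + 5 * (r * t' * (- root - 2)) + 5 * ((root - 2) * (t * r')) + (4 - root * root) * (t * t')"
      unfolding rt rt' by (simp add: algebra_simps)
    also have "(4 - root * root) = 5 * of_int (- k)" unfolding root_square by (simp add: k)
    finally have "x * y = 5 * (5 * (r * r') + r * t' * (- root - 2) + (root - 2) * (t * r') + of_int (- k) * (t * t'))"
      by (simp add: algebra_simps)
    moreover have "5 * (r * r') + r * t' * (- root - 2) + (root - 2) * (t * r') + of_int (- k) * (t * t') \<in> OK"
      using rt rt' root_in_OK by (intro OK_add OK_mult OK_diff OK_minus of_int_in_OK numeral_in_OK)
    ultimately show "x * y \<in> principal 5" by blast
  qed
  have five: "5 \<in> P5" unfolding P5_def by (rule CollectI, rule exI[of _ 1], rule exI[of _ 0]) simp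
  have r2: "root - 2 \<in> P5" unfolding P5_def by (rule CollectI, rule exI[of _ 0], rule exI[of _ 1]) simp
  have five': "5 \<in> cj ` P5" using five cj_rat(2)[of 5] by (metis imageI of_int_numeral)
  have r2': "- root - 2 \<in> cj ` P5" using r2 cj_root by (metis imageI)
  have m: "5 * 5 \<in> ideal_mult P5 (cj ` P5)" "5 * (- root - 2) \<in> ideal_mult P5 (cj ` P5)"
    "(root - 2) * 5 \<in> ideal_mult P5 (cj ` P5)"
    by (intro ideal_mult_mem five five' r2 r2')+
  have "5 * 5 + (5 * (- root - 2) + (root - 2) * 5) \<in> ideal_mult P5 (cj ` P5)"
    by (intro ideal_mult_add m)
  then have 5: "5 \<in> ideal_mult P5 (cj ` P5)" by simp
  show "principal 5 \<subseteq> ideal_mult P5 (cj ` P5)"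
  proof
    fix x assume "x \<in> principal 5"
    then obtain r where r: "r \<in> OK" "x = r * 5" by (auto simp: mult.commute)
    show "x \<in> ideal_mult P5 (cj ` P5)" unfolding r(2)
      by (rule ideal_mult_scale[OF 5]) (rule fractional_idealD(5)[OF fractional_ideal_P5 r(1)])
  qed
qed

text \<open>The power of \<open>root - 2\<close> is a member of the ideal power that 5 does not
  divide; it will show that a generator is not divisible by 5 either.\<close>

lemma P5_power:
  assumes D: "[D = 4] (mod 5)"
  shows "P5 [^]\<^bsub>FG\<^esub> h \<subseteq> OK" "(root - 2) ^ h \<in> P5 [^]\<^bsub>FG\<^esub> h"
    "ideal_mult (P5 [^]\<^bsub>FG\<^esub> h) (cj ` (P5 [^]\<^bsub>FG\<^esub> h)) = principal (5 ^ h)"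
proof -
  have Suc: "P5 [^]\<^bsub>FG\<^esub> Suc h = ideal_mult (P5 [^]\<^bsub>FG\<^esub> h) P5" for h :: nat
    by (simp add: fractional_ideal_group_def)
  have zero: "P5 [^]\<^bsub>FG\<^esub> (0::nat) = OK" by (simp add: fractional_ideal_group_def)
  show sub: "P5 [^]\<^bsub>FG\<^esub> h \<subseteq> OK" for h :: nat
  proof (induction h)
    case (Suc h)
    show ?case unfolding \<open>\<And>h. P5 [^]\<^bsub>FG\<^esub> Suc h = ideal_mult (P5 [^]\<^bsub>FG\<^esub> h) P5\<close>
      using Suc.IH P5_subset by (intro ideal_mult_least) (auto intro: OK_add OK_mult)
  qed (simp add: fractional_ideal_group_def)
  have r2: "root - 2 \<in> P5" unfolding P5_def by (rule CollectI, rule exI[of _ 0], rule exI[of _ 1]) simp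
  show "(root - 2) ^ h \<in> P5 [^]\<^bsub>FG\<^esub> h"
  proof (induction h)
    case (Suc h)
    then have "(root - 2) ^ h * (root - 2) \<in> ideal_mult (P5 [^]\<^bsub>FG\<^esub> h) P5"
      using r2 by (intro ideal_mult_mem)
    then show ?case by (simp only: Suc power_Suc2 assms(1) \<open>\<And>h. P5 [^]\<^bsub>FG\<^esub> Suc h = ideal_mult (P5 [^]\<^bsub>FG\<^esub> h) P5\<close>)
  qed (simp add: fractional_ideal_group_def)
  show "ideal_mult (P5 [^]\<^bsub>FG\<^esub> h) (cj ` (P5 [^]\<^bsub>FG\<^esub> h)) = principal (5 ^ h)"
  proof (induction h)
    case 0
    have "ideal_mult OK OK = OK"
      using fractional_ideal_principal[of 1] by (intro ideal_mult_OK) simp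
    then show ?case unfolding zero cj_image_OK by simp
  next
    case (Suc h)
    define A where "A = P5 [^]\<^bsub>FG\<^esub> h"
    have "cj ` ideal_mult A P5 = ideal_mult (cj ` A) (cj ` P5)"
      using sub P5_subset OK_subset_K unfolding A_def by (intro cj_image_ideal_mult) blast+
    then have "ideal_mult (ideal_mult A P5) (cj ` ideal_mult A P5) =
        ideal_mult (ideal_mult A P5) (ideal_mult (cj ` A) (cj ` P5))" by simp
    also have "\<dots> = ideal_mult A (ideal_mult (ideal_mult P5 (cj ` A)) (cj ` P5))"
      by (simp only: ideal_mult_assoc)
    also have "\<dots> = ideal_mult A (ideal_mult (ideal_mult (cj ` A) P5) (cj ` P5))"
      by (simp only: ideal_mult_commute[of P5 "cj ` A"])
    also have "\<dots> = ideal_mult (ideal_mult A (cj ` A)) (ideal_mult P5 (cj ` P5))"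
      by (simp only: ideal_mult_assoc)
    also have "\<dots> = principal (5 ^ h * 5)"
      using Suc.IH by (simp only: A_def P5_mult_cj[OF D] principal_mult)
    finally show ?case
      unfolding \<open>\<And>h. P5 [^]\<^bsub>FG\<^esub> Suc h = ideal_mult (P5 [^]\<^bsub>FG\<^esub> h) P5\<close> A_def power_Suc2 .
  qed
qed

text \<open>\<open>x - 2 * y\<close> is the reduction modulo the conjugate prime \<open>(5, root + 2)\<close>, under which
  \<open>root\<close> goes to \<open>-2\<close>.\<close>

lemma root_minus_2_power:
  "\<exists>x y :: int. (root - 2) ^ h = el (of_int x) (of_int y) \<and> [x - 2 * y = (-4) ^ h] (mod 5)"
  if D: "[D = 4] (mod 5)"
proof (induction h)
  case 0
  show ?case by (rule exI[of _ 1], rule exI[of _ 0]) (simp add: el_one)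
next
  case (Suc h)
  then obtain x y :: int where xy: "(root - 2) ^ h = el (of_int x) (of_int y)" "[x - 2 * y = (-4) ^ h] (mod 5)"
    by blast
  have r2: "root - 2 = el (- 2) 1" by (simp add: el_def)
  have "(root - 2) ^ Suc h = el (of_int x) (of_int y) * el (- 2) 1" 
    unfolding power_Suc2 xy(1) unfolding r2 ..
  also have "\<dots> = el (of_int (- 2 * x + D * y)) (of_int (x - 2 * y))" by (simp add: el_mult mult_ac)
  finally have 1: "(root - 2) ^ Suc h = el (of_int (- 2 * x + D * y)) (of_int (x - 2 * y))" .
  have "[(- 2 * x + D * y) - 2 * (x - 2 * y) = (- 2 * x + 4 * y) - 2 * (x - 2 * y)] (mod 5)"
    by (intro cong_diff cong_add cong_refl cong_mult D)
  also have "(- 2 * x + 4 * y) - 2 * (x - 2 * y) = -4 * (x - 2 * y)" by simp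
  also have "[-4 * (x - 2 * y) = -4 * (-4) ^ h] (mod 5)" by (intro cong_mult xy cong_refl)
  finally show ?case using 1 by (metis power_Suc)
qed

text \<open>A generator \<open>\<alpha>\<close> of the h-th power of \<open>P5\<close> has norm
  associated to 5^h; both quotients are rational and integral, so the norm is 5^h up to sign. If 5
  divided \<open>\<alpha>\<close>, it would divide (root - 2)^h, which reduces to (-4)^h when root
  goes to -2 modulo 5.\<close>

lemma exists_norm_power_of_5:
  assumes D: "[D = 4] (mod 5)"
  shows "\<exists>u v (s :: int). (s = 1 \<or> s = -1) \<and> el u v \<in> OK \<and> el (u / 5) (v / 5) \<notin> OK \<and>
    u ^ 2 - of_int D * v ^ 2 = of_int (s * 5 ^ class_number K)"
proof -
  define h where "h = class_number K"
  define A where "A = P5 [^]\<^bsub>FG\<^esub> h"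
  have "A \<in> principal_fractional_ideals K"
    unfolding A_def h_def by (rule power_class_number_principal[OF fractional_ideal_P5])
  then obtain \<alpha> where \<alpha>: "A = principal \<alpha>" "\<alpha> \<in> K" "\<alpha> \<noteq> 0"
    by (auto simp: principal_fractional_ideals_def)
  have A: "A \<subseteq> OK" "(root - 2) ^ h \<in> A" "ideal_mult A (cj ` A) = principal (5 ^ h)"
    unfolding A_def by (rule P5_power[OF D])+
  have "\<alpha> \<in> A" unfolding \<alpha> by (rule image_eqI[of _ _ 1]) auto
  then have "\<alpha> \<in> OK" using A(1) by blast
  obtain u v where uv: "\<alpha> = el u v" using \<alpha>(2) by (rule K_cases)
  define \<nu> where "\<nu> = u ^ 2 - of_int D * v ^ 2"
  have N: "\<alpha> * cj \<alpha> = of_rat \<nu>" unfolding uv el_mult_cj \<nu>_def ..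
  have "principal (of_rat \<nu>) = principal (5 ^ h)"
    using A(3) \<alpha>(2) unfolding \<alpha>(1) by (simp only: cj_image_principal principal_mult N)
  then have "of_rat \<nu> \<in> principal (5 ^ h)" "5 ^ h \<in> principal (of_rat \<nu>)"
    by (metis image_eqI mult.right_neutral one_in_OK)+
  then obtain r r' where r: "r \<in> OK" "of_rat \<nu> = 5 ^ h * r" and r': "r' \<in> OK" "5 ^ h = of_rat \<nu> * r'" by blast
  have "\<nu> \<noteq> 0" using r'(2) by auto
  have "r = of_rat \<nu> / 5 ^ h" unfolding r(2) by simp
  moreover have "r' = 5 ^ h / of_rat \<nu>" using \<open>\<nu> \<noteq> 0\<close> unfolding r'(2) by simp
  ultimately have "r = of_rat (\<nu> / 5 ^ h)" "r' = of_rat (5 ^ h / \<nu>)"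
    by (simp_all add: of_rat_divide of_rat_power)
  then have "\<nu> / 5 ^ h \<in> \<int>" "5 ^ h / \<nu> \<in> \<int>" using r(1) r'(1) by (simp_all only: rat_in_OK_iff)
  then obtain s t where st: "\<nu> / 5 ^ h = of_int s" "5 ^ h / \<nu> = of_int t" by (auto elim!: Ints_cases)
  have "of_int (s * t) = (\<nu> / 5 ^ h) * (5 ^ h / \<nu>)" by (simp only: of_int_mult st)
  also have "\<dots> = 1" using \<open>\<nu> \<noteq> 0\<close> by simp
  finally have "s * t = 1" by (simp only: of_int_eq_1_iff)
  then have s: "s = 1 \<or> s = -1" by (metis zmult_eq_1_iff)
  have \<nu>: "\<nu> = of_int (s * 5 ^ h)" using st(1) by (simp add: field_simps)
  have "el (u / 5) (v / 5) \<notin> OK"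
  proof
    assume g: "el (u / 5) (v / 5) \<in> OK"
    obtain r where r: "r \<in> OK" "(root - 2) ^ h = \<alpha> * r" using A(2) unfolding \<alpha>(1) by blast
    have "\<alpha> = 5 * el (u / 5) (v / 5)" unfolding uv by (simp add: el_def of_rat_divide algebra_simps)
    then have e: "(root - 2) ^ h = 5 * (el (u / 5) (v / 5) * r)" using r(2) by simp
    define \<delta> where "\<delta> = el (u / 5) (v / 5) * r"
    have \<delta>: "\<delta> \<in> OK" unfolding \<delta>_def by (intro OK_mult g r)
    obtain x y :: int where xy: "(root - 2) ^ h = el (of_int x) (of_int y)" "[x - 2 * y = (-4) ^ h] (mod 5)"
      using root_minus_2_power[OF D] by blast
    have "5 * el (of_int x / 5) (of_int y / 5) = el (of_int x) (of_int y)"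
      by (simp add: el_def of_rat_divide algebra_simps)
    then have "\<delta> = el (of_int x / 5) (of_int y / 5)" using e xy(1) unfolding \<delta>_def by simp
    then have i: "2 * (of_int x / 5) \<in> (\<int> :: rat set)"
        "(of_int x / 5) ^ 2 - of_int D * (of_int y / 5) ^ 2 \<in> (\<int> :: rat set)"
      using \<delta> by (simp_all add: el_in_OK_iff)
    obtain a where "2 * (of_int x / 5) = (of_int a :: rat)" using i(1) by (elim Ints_cases)
    then have "of_int (2 * x) = (of_int (5 * a) :: rat)" by simp
    then have "2 * x = 5 * a" by (simp only: of_int_eq_iff)
    then have x5: "5 dvd x" by presburger
    obtain b where "(of_int x / 5) ^ 2 - of_int D * (of_int y / 5) ^ 2 = (of_int b :: rat)"
      using i(2) by (elim Ints_cases)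
    then have "of_int (x ^ 2 - D * y ^ 2) = (of_int (25 * b) :: rat)" by (simp add: power_divide field_simps)
    then have "x ^ 2 - D * y ^ 2 = 25 * b" by (simp only: of_int_eq_iff)
    then have "D * y ^ 2 = x ^ 2 - 25 * b" by simp
    moreover have "5 dvd x ^ 2 - 25 * b" using x5 by (simp add: power2_eq_square)
    ultimately have "5 dvd D * y ^ 2" by simp
    moreover have P: "prime (5::int)" by simp
    moreover have "\<not> 5 dvd D" using D by (auto simp: cong_def dvd_eq_mod_eq_0)
    ultimately have "5 dvd y" using prime_dvd_multD prime_dvd_power by blast
    then have "5 dvd x - 2 * y" using x5 by simp
    then have "5 dvd (-4 :: int) ^ h" using xy(2) cong_dvd_iff by blast
    then have "5 dvd (-4 :: int)" using P prime_dvd_power by blast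
    then show False by simp
  qed
  then show ?thesis using s \<nu> \<open>\<alpha> \<in> OK\<close> unfolding uv \<nu>_def h_def by blast
qed

end

section \<open>Divisibility of the class number by 3\<close>

lemma odd_prime_dvd_four_mult:
  fixes q D :: int
  assumes "prime q" "q \<noteq> 2" "q dvd 4 * D"
  shows "q dvd D"
proof -
  have "q dvd 2 ^ 2 * D" using assms(3) by simp
  then have "q dvd 2 ^ 2 \<or> q dvd D" using assms(1) by (rule prime_dvd_multD[rotated])
  moreover have "\<not> q dvd 2 ^ 2"
  proof
    assume "q dvd 2 ^ 2"
    then have "q dvd 2" using assms(1) prime_dvd_power by blast
    then show False using assms(1,2) primes_dvd_imp_eq[of q 2] by simp
  qed
  ultimately show ?thesis by blast
qed

theorem theorem2p4:
  fixes n :: nat and a b :: int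
  assumes "n > 1" and "odd n"
    and "[a = 19] (mod 30)" and "[b = 6] (mod 15)" and "gcd a b = 1"
  shows "3 dvd class_number (quadratic_field (3 * (a ^ (3 * n) - b ^ (2 * n))))"
proof (rule ccontr)
  define c B where "c = a ^ n" and "B = b ^ n"
  define m where "m = c ^ 3 - B ^ 2"
  define D where "D = 3 * m"
  have D_eq: "3 * (a ^ (3 * n) - b ^ (2 * n)) = D"
    by (simp add: D_def m_def c_def B_def power_mult[symmetric] mult.commute)
  assume "\<not> 3 dvd class_number (quadratic_field (3 * (a ^ (3 * n) - b ^ (2 * n))))"
  then have h3: "\<not> 3 dvd class_number (quadratic_field D)" unfolding D_eq .
  have a_mod: "[a = 1] (mod 3)" "[a = -1] (mod 5)" "[a = 1] (mod 2)"
    using cong_dvd_modulus[OF assms(3), of 3] cong_dvd_modulus[OF assms(3), of 5]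
      cong_dvd_modulus[OF assms(3), of 2] by (simp_all add: cong_def)
  have b_mod: "[b = 0] (mod 3)" "[b = 1] (mod 5)"
    using cong_dvd_modulus[OF assms(4), of 3] cong_dvd_modulus[OF assms(4), of 5] by (simp_all add: cong_def)
  have c3: "[c = 1] (mod 3)" using cong_pow[OF a_mod(1), of n] by (simp add: c_def)
  \<comment> \<open>Odd n keeps the sign; with c = 1 the number D would be divisible by 5.\<close>
  have c5: "[c = -1] (mod 5)" using cong_pow[OF a_mod(2), of n] assms(2) by (simp add: c_def)
  have B5: "[B = 1] (mod 5)" using cong_pow[OF b_mod(2), of n] by (simp add: B_def)
  have "3 dvd b" using b_mod(1) by (simp add: cong_0_iff)
  then have "3 ^ n dvd B" unfolding B_def by (rule dvd_power_same)
  \<comment> \<open>A single factor 3 in b becomes 9 dividing B because n > 1; the symbol at 3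
    depends on it.\<close>
  moreover have "(3::int) ^ 2 dvd 3 ^ n" using assms(1) by (intro le_imp_power_dvd) auto
  ultimately have "3 ^ 2 dvd B" using dvd_trans by blast
  then have B9: "9 dvd B" by simp
  have P3: "prime (3::int)" and P5: "prime (5::int)" by simp_all
  have m3: "[m = 1 ^ 3 - 0 ^ 2] (mod 3)" unfolding m_def
    using B9 by (intro cong_diff cong_pow c3) (auto simp: cong_0_iff)
  then have nm3: "\<not> 3 dvd m" by (auto simp: cong_def dvd_eq_mod_eq_0)
  have m5: "[m = (-1) ^ 3 - 1 ^ 2] (mod 5)" unfolding m_def by (intro cong_diff cong_pow c5 B5)
  have D5: "[D = 4] (mod 5)"
  proof -
    have "[3 * m = 3 * ((-1) ^ 3 - 1 ^ 2)] (mod 5)" by (intro cong_mult m5 cong_refl)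
    also have "[3 * ((-1) ^ 3 - 1 ^ 2) = 4] (mod (5::int))" by (simp add: cong_def)
    finally show ?thesis by (simp add: D_def)
  qed
  interpret quadratic_number_field D
  proof
    fix r :: rat
    show "r ^ 2 \<noteq> of_int D"
    proof
      assume r: "r ^ 2 = of_int D"
      then have "poly [: of_int (- D), 0, 1 :] r = 0" by (simp add: power2_eq_square)
      then have "algebraic_int r"
        by (rule algebraic_int.intros[rotated 2]) (auto simp: coeff_pCons split: nat.splits)
      moreover have "r \<in> \<rat>" by (cases r) (simp add: Fract_of_int_quotient)
      ultimately have "r \<in> \<int>" by (rule rational_algebraic_int_is_int)
      then obtain k where "r = of_int k" by (elim Ints_cases)
      then have "k ^ 2 = 3 * m" using r unfolding D_def by (metis of_int_eq_iff of_int_power)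
      \<comment> \<open>D is not a square because 3 divides it exactly once, m being 1 modulo
        3.\<close>
      then have "3 dvd k" using P3 by (metis dvd_triv_left prime_dvd_power)
      then obtain j where "k = 3 * j" by blast
      then have "m = 3 * j ^ 2" using \<open>k ^ 2 = 3 * m\<close> by (simp add: power2_eq_square)
      then show False using nm3 by simp
    qed
  qed
  define h where "h = class_number K"
  have h: "h > 0" "\<not> 3 dvd h" using h3 by (auto simp: h_def intro: gr0I)
  obtain u v s where s: "s = 1 \<or> s = -1" and uv: "el u v \<in> OK" "el (u / 5) (v / 5) \<notin> OK"
    and norm: "u ^ 2 - of_int D * v ^ 2 = of_int (s * 5 ^ h)"
    using exists_norm_power_of_5[OF D5] unfolding h_def by blast
  obtain x where x: "2 * u = of_int x" using uv(1) by (auto simp: el_in_OK_iff elim: Ints_cases)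
  obtain Y F where YF: "quotient_of v = (Y, F)" by fastforce
  then have v: "v = of_int Y / of_int F" "F > 0" "coprime F Y"
    using quotient_of_div[OF YF] quotient_of_denom_pos[OF YF] quotient_of_coprime[OF YF]
    by (simp_all add: coprime_commute)
  have "of_int (x ^ 2 * F ^ 2) = (2 * u) ^ 2 * of_int F ^ 2" unfolding x by simp
  also have "\<dots> = 4 * of_int F ^ 2 * (u ^ 2 - of_int D * v ^ 2) + 4 * of_int D * (v * of_int F) ^ 2"
    by (simp add: power2_eq_square algebra_simps)
  also have "v * of_int F = of_int Y" using v by simp
  also have "4 * of_int F ^ 2 * (u ^ 2 - of_int D * v ^ 2) + 4 * of_int D * of_int Y ^ 2 =
      (of_int (4 * F ^ 2 * (s * 5 ^ h) + 4 * D * Y ^ 2) :: rat)"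
    unfolding norm by simp
  finally have eq4: "x ^ 2 * F ^ 2 = 4 * F ^ 2 * (s * 5 ^ h) + 4 * D * Y ^ 2"
    by (simp only: of_int_eq_iff)
  \<comment> \<open>Integrality of u^2 - D * v^2 and of 2 * u forces the square of the denominator F
    of v into 4 * D.\<close>
  then have "F ^ 2 * (x ^ 2 - 4 * (s * 5 ^ h)) = 4 * D * Y ^ 2" by (simp add: algebra_simps)
  then have "F ^ 2 dvd 4 * D * Y ^ 2" by (metis dvd_triv_left)
  moreover have "coprime (F ^ 2) (Y ^ 2)" using v(3) by simp
  ultimately have "F ^ 2 dvd 4 * D" by (simp add: coprime_dvd_mult_left_iff)
  then obtain d where d: "4 * D = F ^ 2 * d" by blast
  have "F ^ 2 * x ^ 2 = F ^ 2 * (4 * (s * 5 ^ h) + d * Y ^ 2)"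
    using eq4 unfolding d by (simp add: algebra_simps)
  then have xd: "x ^ 2 = 4 * (s * 5 ^ h) + d * Y ^ 2" using v(2) by simp
  \<comment> \<open>Since u = x / 2 may be half-integral, it has to be checked that X = F * u is an
    integer. For odd F the factor 4 passes to d, so x is even.\<close>
  have "even (F * x)"
  proof (cases "even F")
    case False
    have "4 dvd F ^ 2 * d" using d by (metis dvd_triv_left)
    moreover have "coprime (2 ^ 2) (F ^ 2)"
      using False by (simp only: coprime_power_left_iff coprime_power_right_iff) simp
    ultimately have "4 dvd d" by (simp add: coprime_dvd_mult_right_iff)
    then have "even (x ^ 2)" unfolding xd by (auto elim!: dvdE)
    then show ?thesis by simp
  qed simp
  then obtain X where X: "F * x = 2 * X" by blast
  have Fq: "q dvd D" if "prime q" "q dvd F" "q \<noteq> 2" for q :: int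
  proof (rule odd_prime_dvd_four_mult[OF that(1,3)])
    show "q dvd 4 * D" unfolding d using that(2) by (simp add: power2_eq_square)
  qed
  have F3: "\<not> 3 dvd F"
  proof
    assume "3 dvd F"
    then have "3 * 3 dvd F ^ 2" unfolding power2_eq_square by (rule mult_dvd_mono[OF _ \<open>3 dvd F\<close>])
    then have "3 * 3 dvd 4 * D" unfolding d by (rule dvd_mult2)
    then have "3 * 3 dvd 3 * (4 * m)" by (simp add: D_def)
    then have "3 dvd 4 * m" by (simp only: dvd_mult_cancel_left) simp
    then show False using nm3 by presburger
  qed
  have F5: "\<not> 5 dvd F"
  proof
    assume "5 dvd F"
    then have "5 dvd D" using P5 Fq by auto
    then show False using D5 by (auto simp: cong_def dvd_eq_mod_eq_0)
  qed
  have Fc: "coprime F c"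
  proof (rule ccontr)
    assume "\<not> coprime F c"
    then have "\<not> is_unit (gcd F c)" by (simp add: coprime_iff_gcd_eq_1)
    moreover have "gcd F c \<noteq> 0" using v(2) by simp
    ultimately obtain q :: int where q: "prime q" "q dvd gcd F c" using prime_divisorE by blast
    then have qa: "q dvd a" unfolding c_def using prime_dvd_power by auto
    \<comment> \<open>The prime 2 is the only one that could divide F without dividing D; a odd
      rules it out here.\<close>
    have "q \<noteq> 2" using qa a_mod(3) by (auto simp: cong_def dvd_eq_mod_eq_0)
    then have "q dvd 3 * m" using Fq q unfolding D_def by auto
    moreover have "\<not> q dvd 3"
      using q F3 P3 primes_dvd_imp_eq[of q 3] by auto
    ultimately have "q dvd m" using q(1) by (simp add: prime_dvd_mult_iff)
    moreover have "q dvd c ^ 3" using q(2) by (simp add: power3_eq_cube)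
    ultimately have "q dvd c ^ 3 - m" by (rule dvd_diff[rotated])
    then have "q dvd B ^ 2" by (simp add: m_def)
    then have "q dvd b" unfolding B_def using q(1) prime_dvd_power by blast
    then have "q dvd gcd a b" using qa by simp
    then show False using assms(5) q(1) by (simp add: not_prime_unit)
  qed
  \<comment> \<open>If 5 divided Y it would divide x as well, and then u / 5 and v / 5 would have
    integral trace and norm.\<close>
  have Y5: "\<not> 5 dvd Y"
  proof
    assume "5 dvd Y"
    then obtain Y' where Y': "Y = 5 * Y'" by blast
    have "5 dvd x ^ 2"
      unfolding xd Y' using h(1) by (simp add: dvd_power power2_eq_square)
    then have "5 dvd x" using P5 prime_dvd_power by blast
    then obtain x' where x': "x = 5 * x'" by blast
    have e: "4 * (s * 5 ^ h) = 25 * (x' ^ 2 - d * Y' ^ 2)"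
      using xd unfolding x' Y' by (simp add: power2_eq_square algebra_simps)
    then have "25 dvd 4 * (s * 5 ^ h)" by simp
    moreover have "coprime (5 ^ 2) (2 ^ 2 :: int)"
      unfolding coprime_power_left_iff coprime_power_right_iff by simp
    then have "coprime 25 (4 :: int)" by simp
    ultimately have "25 dvd s * 5 ^ h" using coprime_dvd_mult_right_iff by blast
    then obtain w where w: "s * 5 ^ h = 25 * w" by blast
    have "2 * (u / 5) = of_int x'" using x unfolding x' by simp
    moreover have "(u / 5) ^ 2 - of_int D * (v / 5) ^ 2 = (u ^ 2 - of_int D * v ^ 2) / 25"
      by (simp add: power_divide diff_divide_distrib)
    then have "(u / 5) ^ 2 - of_int D * (v / 5) ^ 2 = of_int w" unfolding norm w by simp
    ultimately have "el (u / 5) (v / 5) \<in> OK" by (simp add: el_in_OK_iff)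
    then show False using uv(2) by blast
  qed
  have "4 * X ^ 2 = x ^ 2 * F ^ 2" using X by (simp add: power_mult_distrib[symmetric] mult.commute)
  then have "X ^ 2 = F ^ 2 * (s * 5 ^ h) + D * Y ^ 2" unfolding eq4 by simp
  \<comment> \<open>Substituting D = 3 * c^3 - 3 * B^2 and moving the B-term to the left turns the
    norm form of \<open>K\<close> into that of \<open>\<kappa>\<close>.\<close>
  then have "X ^ 2 + 3 * (Y * B) ^ 2 = 3 * Y ^ 2 * c ^ 3 + s * F ^ 2 * 5 ^ h"
    by (simp add: D_def m_def algebra_simps power_mult_distrib)
  then show False
  proof (rule norm_equation_impossible[OF _ s h B9 B5 c5 F3 F5 Fc v(3) Y5])
    fix q :: nat assume q: "prime q" "int q dvd F" "q \<noteq> 2"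
    then have "int q dvd 2 * X" unfolding X[symmetric] by simp
    then have "int q dvd 2 \<or> int q dvd X" using q(1) by (intro prime_dvd_multD) auto
    moreover have "\<not> int q dvd 2"
    proof
      assume "int q dvd 2"
      then have "q dvd 2" by presburger
      then show False using q primes_dvd_imp_eq[of q 2] by simp
    qed
    ultimately show "int q dvd X" by blast
  qed
qed

end
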